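(* Let $\mathcal{A}$ be a unital complex algebra, $\psi,\varphi:\mathcal{A}\to\mathbb{C}$ unital linear functionals, $\omega:\mathcal{A}\to\mathbb{C}$ a tracial (possibly non-unital) linear functional, and let $(\mathcal{A}_i)_{i\in I}$ be unital subalgebras of $\mathcal{A}$. The following are equivalent: 1. the algebras $\mathcal{A}_i$, $i\in I$, are cyclically conditionally free relatively to $(\psi,\varphi,\omega)$; 2. the algebras $\mathcal{A}_i$, $i\in I$, are conditionally free relatively to $(\psi,\varphi)$, and the subalgebras $T(\mathcal{A}_i)$, $i\in I$, of $T(\mathcal{A})$ are cyclically free relatively to the pair $\big(\psi,\ \omega-[\varphi]+(1-\omega(1_{\mathcal{A}}))[\psi]\big)$; 3. the mixed cyclic conditional free cumulants $\kappa^{\omega|\varphi,\psi}$, the mixed free cumulants $\kappa^{\psi}$ and the mixed conditionally free cumulants $\kappa^{\varphi|\psi}$ vanish.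
   Context: Tensor algebra: $T(\mathcal{A})=\mathbb{C}1\oplus\bigoplus_{n\ge1}\mathcal{A}^{\otimes n}$, $T(\mathcal{A}_i)=\mathbb{C}1\oplus\bigoplus_{n\ge1}\mathcal{A}_i^{\otimes n}$. A linear functional $f$ on $\mathcal{A}$ is extended to $T(\mathcal{A})$ by $f(a_1\otimes\cdots\otimes a_n)=f(a_1\cdots a_n)$, $f(1)=f(1_{\mathcal{A}})$. A sequence $a_k\in\mathcal{B}_{j_k}$, $1\le k\le n$, is alternating if $j_k\ne j_{k+1}$ for $1\le k\le n-1$, and cyclically alternating if $n\ge2$ and moreover $j_n\ne j_1$; it is $\psi$-centered if all $\psi(a_k)=0$. Unital subalgebras $(\mathcal{B}_i)$ are: - conditionally free relatively to $(\psi,\varphi)$ if $\psi(a_1\cdots a_n)=0$ and $\varphi(a_1\cdots a_n)=\varphi(a_1)\cdots\varphi(a_n)$ for all alternating $\psi$-centered sequences; - cyclically conditionally free relatively to $(\psi,\varphi,\omega)$ if they are conditionally free relatively to $(\psi,\varphi)$ and $\omega(a_1\cdots a_n)=\varphi(a_1)\cdots\varphi(a_n)$ for all cyclically alternating $\psi$-centered sequences; - cyclically free relatively to $(\psi,\omega)$ if they are free with respect to $\psi$ and $\omega(a_1\cdots a_n)=0$ for all cyclically alternating $\psi$-centered sequences. Boolean cumulants $\beta^\psi$: $\psi(a_1\cdots a_n)=\sum_{I}\prod_{\{i,\ldots,j\}\in I}\beta^\psi(a_i,\ldots,a_j)$, sum over interval partitions $I$ of $[n]=\{1,\ldots,n\}$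 (same for $\varphi$). The functional $[\psi]$ on $T(\mathcal{A})$: $[\psi](1)=1$ and $$[\psi](a_1,\ldots,a_n)=[\psi](a_1\otimes\cdots\otimes a_n)=\sum_{\ell=1}^n\sum_{1\le i_1<\cdots<i_\ell\le n}\prod_{k=1}^{\ell}\beta^\psi(a_{i_k},\ldots,a_{i_{k+1}-1}),$$ with $i_{\ell+1}=i_1$ and indices read cyclically modulo $n$ (the last factor is $\beta^\psi(a_{i_\ell},\ldots,a_n,a_1,\ldots,a_{i_1-1})$); $[\varphi]$ is defined likewise. Free cumulants $\kappa^\psi_n$: $\psi(a_1\cdots a_n)=\sum_{\pi\in NC(n)}\prod_{V\in\pi}\kappa^\psi_{|V|}(a_V)$, where $NC(n)$ is the set of non-crossing partitions of $[n]$ and $a_V$ lists $(a_v)_{v\in V}$ in increasing order. Conditionally free cumulants $\kappa^{\varphi|\psi}_n$: $\varphi(a_1\cdots a_n)=\sum_{\pi\in NC(n)}\prod_{V\text{ outer}}\kappa^{\varphi|\psi}_{|V|}(a_V)\prod_{V\text{ inner}}\kappa^\psi_{|V|}(a_V)$, where a block $V$ is inner if there is another block containing $i<j$ with $i<v<j$ for all $v\in V$, and outer otherwise. Cyclic conditional free cumulants $\kappa^{\omega|\varphi,\psi}_n:\mathcal{A}^{\otimes n}\to\mathbb{C}$, defined recursively by $$\omega(a_1\cdots a_n)+(1-\omega(1_{\mathcal{A}}))[\psi](a_1,\ldots,a_n)-[\varphi](a_1,\ldots,a_n)=\sum_{\pi\in NC(n)}[\kappa^\psi,\kappa^{\omega|\varphi,\psi}]_\pi(a_1,\ldots,a_n),$$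 where, for $f=(f_n)$ and a sequence $Df=(Df_n)$ of cyclically invariant functionals, $[f,Df]_\pi(a_1,\ldots,a_n)=\sum_{V\in\pi}Df_{|V|}(a_V)\prod_{W\in\pi,W\ne V}f_{|W|}(a_{(W,\prec_V)})$. Here $a_{(W,\prec_V)}$ lists $(a_w)_{w\in W}$ in the following order: arrange $1,\ldots,n$ clockwise on a circle; since $\pi$ is non-crossing, $W$ lies in one arc between two cyclically consecutive elements of $V$ (the whole circle minus $V$ if $|V|=1$), and $W$ is listed in the order met when traversing this arc clockwise. A cumulant is mixed if its arguments $a_k\in\mathcal{A}_{j_k}$ come from at least two distinct algebras, i.e. the $j_k$ are not all equal; "mixed cumulants vanish" means all such values are zero. *)

theory Defs
  imports
    Complex_Main
    "HOL-Library.Poly_Mapping"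
    "HOL-Library.Disjoint_Sets"
begin

section \<open>Unital complex algebras\<close>

class scaleC =
  fixes scaleC :: "complex \<Rightarrow> 'a \<Rightarrow> 'a" (infixr \<open>*\<^sub>C\<close> 75)

class complex_algebra_1 = scaleC + ring_1 +
  assumes scaleC_add_right: "c *\<^sub>C (x + y) = c *\<^sub>C x + c *\<^sub>C y"
    and scaleC_add_left: "(c + d) *\<^sub>C x = c *\<^sub>C x + d *\<^sub>C x"
    and scaleC_scaleC: "c *\<^sub>C d *\<^sub>C x = (c * d) *\<^sub>C x"
    and scaleC_one: "1 *\<^sub>C x = x"
    and mult_scaleC_left: "(c *\<^sub>C x) * y = c *\<^sub>C (x * y)"
    and mult_scaleC_right: "x * (c *\<^sub>C y) = c *\<^sub>C (x * y)"

global_interpretation complex_vector: vector_space "scaleC :: complex \<Rightarrow> 'a \<Rightarrow> 'a::complex_algebra_1"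
  by unfold_locales (simp_all add: scaleC_add_right scaleC_add_left scaleC_scaleC scaleC_one)

abbreviation linear_functional :: "('a::complex_algebra_1 \<Rightarrow> complex) \<Rightarrow> bool" where
  "linear_functional \<equiv> Vector_Spaces.linear scaleC (*)"

definition unital_functional :: "('a::complex_algebra_1 \<Rightarrow> complex) \<Rightarrow> bool" where
  "unital_functional f \<longleftrightarrow> linear_functional f \<and> f 1 = 1"

definition tracial_functional :: "('a::complex_algebra_1 \<Rightarrow> complex) \<Rightarrow> bool" where
  "tracial_functional f \<longleftrightarrow> linear_functional f \<and> (\<forall>x y. f (x * y) = f (y * x))"

definition unital_subalgebra :: "'a::complex_algebra_1 set \<Rightarrow> bool" where
  "unital_subalgebra B \<longleftrightarrow>
     complex_vector.subspace B \<and> 1 \<in> B \<and> (\<forall>x\<in>B. \<forall>y\<in>B. x * y \<in> B)"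


section \<open>The tensor algebra\<close>

text \<open>
  The tensor algebra of an algebra $A$ (only the vector space structure of $A$ matters) is the
  free unital complex algebra on the set $A$, that is, the monoid algebra of the free monoid of
  words in elements of $A$, modulo the two-sided ideal which makes the map sending $a$ to the
  one-letter word $a$ linear. Its product is the tensor product; its unit, the empty word, is
  different from the one-letter word $1_A$.
\<close>

datatype 'a tensor_word = Tensor_Word (letters: "'a list")

instantiation tensor_word :: (type) monoid_add
begin

definition zero_tensor_word :: "'a tensor_word" where
  "0 = Tensor_Word []"

definition plus_tensor_word :: "'a tensor_word \<Rightarrow> 'a tensor_word \<Rightarrow> 'a tensor_word" where
  "v + w = Tensor_Word (letters v @ letters w)"

instance
  by standard (simp_all add: zero_tensor_word_def plus_tensor_word_def)

end

type_synonym 'a free_algebra = "'a tensor_word \<Rightarrow>\<^sub>0 complex"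

abbreviation free_scalar :: "complex \<Rightarrow> 'a free_algebra" where
  "free_scalar c \<equiv> Poly_Mapping.single 0 c"

abbreviation free_letter :: "'a \<Rightarrow> 'a free_algebra" where
  "free_letter a \<equiv> Poly_Mapping.single (Tensor_Word [a]) 1"

inductive_set tensor_ideal :: "'a::complex_algebra_1 free_algebra set" where
  ideal_gen_add: "free_letter (a + b) - free_letter a - free_letter b \<in> tensor_ideal"
| ideal_gen_scale: "free_letter (c *\<^sub>C a) - free_scalar c * free_letter a \<in> tensor_ideal"
| ideal_zero: "0 \<in> tensor_ideal"
| ideal_add: "x \<in> tensor_ideal \<Longrightarrow> y \<in> tensor_ideal \<Longrightarrow> x + y \<in> tensor_ideal"
| ideal_mult: "x \<in> tensor_ideal \<Longrightarrow> u * x * v \<in> tensor_ideal"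

lemma ideal_mult_left: "x \<in> tensor_ideal \<Longrightarrow> u * x \<in> tensor_ideal"
  using ideal_mult[of x u 1] by simp

lemma ideal_mult_right: "x \<in> tensor_ideal \<Longrightarrow> x * v \<in> tensor_ideal"
  using ideal_mult[of x 1 v] by simp

lemma ideal_uminus: "x \<in> tensor_ideal \<Longrightarrow> - x \<in> tensor_ideal"
  using ideal_mult_left[of x "- 1"] by simp

definition tensor_eq :: "'a::complex_algebra_1 free_algebra \<Rightarrow> 'a free_algebra \<Rightarrow> bool" where
  "tensor_eq x y \<longleftrightarrow> x - y \<in> tensor_ideal"

lemma tensor_eq_add: "tensor_eq x x' \<Longrightarrow> tensor_eq y y' \<Longrightarrow> tensor_eq (x + y) (x' + y')"
  unfolding tensor_eq_def using ideal_add[of "x - x'" "y - y'"] by (simp add: algebra_simps)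

lemma tensor_eq_uminus: "tensor_eq x x' \<Longrightarrow> tensor_eq (- x) (- x')"
  unfolding tensor_eq_def using ideal_uminus[of "x - x'"] by simp

lemma tensor_eq_mult:
  assumes "tensor_eq x x'" "tensor_eq y y'"
  shows "tensor_eq (x * y) (x' * y')"
proof -
  have "x * y - x' * y' = (x - x') * y + x' * (y - y')"
    by (simp add: algebra_simps)
  then show ?thesis
    using assms unfolding tensor_eq_def by (simp add: ideal_add ideal_mult_left ideal_mult_right)
qed

lemma tensor_eq_refl: "tensor_eq x x"
  by (simp add: tensor_eq_def ideal_zero)

lemma tensor_eq_sym: "tensor_eq x y \<Longrightarrow> tensor_eq y x"
  unfolding tensor_eq_def using ideal_uminus[of "x - y"] by simp

lemma tensor_eq_trans: "tensor_eq x y \<Longrightarrow> tensor_eq y z \<Longrightarrow> tensor_eq x z"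
  unfolding tensor_eq_def using ideal_add[of "x - y" "y - z"] by simp

lemma equivp_tensor_eq: "equivp tensor_eq"
  by (intro equivpI reflpI sympI transpI) (fact tensor_eq_refl tensor_eq_sym tensor_eq_trans)+

quotient_type (overloaded) 'a tensor_algebra = "'a::complex_algebra_1 free_algebra" / tensor_eq
  by (rule equivp_tensor_eq)


subsection \<open>Linear extension from words to the free algebra\<close>

definition multilinear :: "('a::complex_algebra_1 list \<Rightarrow> complex) \<Rightarrow> bool" where
  "multilinear F \<longleftrightarrow>
     (\<forall>us vs a b. F (us @ [a + b] @ vs) = F (us @ [a] @ vs) + F (us @ [b] @ vs)) \<and>
     (\<forall>us vs c a. F (us @ [c *\<^sub>C a] @ vs) = c * F (us @ [a] @ vs))"

lemma multilinear_add:
  "multilinear F \<Longrightarrow> F (us @ (a + b) # vs) = F (us @ a # vs) + F (us @ b # vs)"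
  by (simp add: multilinear_def)

lemma multilinear_scale: "multilinear F \<Longrightarrow> F (us @ (c *\<^sub>C a) # vs) = c * F (us @ a # vs)"
  by (simp add: multilinear_def)

definition free_extend :: "('a list \<Rightarrow> complex) \<Rightarrow> 'a free_algebra \<Rightarrow> complex" where
  "free_extend F x = (\<Sum>w\<in>Poly_Mapping.keys x. Poly_Mapping.lookup x w * F (letters w))"

lemma free_extend_superset:
  assumes "finite S" "Poly_Mapping.keys x \<subseteq> S"
  shows "free_extend F x = (\<Sum>w\<in>S. Poly_Mapping.lookup x w * F (letters w))"
  unfolding free_extend_def
  by (rule sum.mono_neutral_left) (use assms in \<open>auto simp: in_keys_iff\<close>)

lemma free_extend_zero [simp]: "free_extend F 0 = 0"
  by (simp add: free_extend_def)

lemma free_extend_single [simp]: "free_extend F (Poly_Mapping.single w c) = c * F (letters w)"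
  by (simp add: free_extend_def)

lemma free_extend_add: "free_extend F (x + y) = free_extend F x + free_extend F y"
proof -
  let ?S = "Poly_Mapping.keys x \<union> Poly_Mapping.keys y"
  have "Poly_Mapping.keys (x + y) \<subseteq> ?S"
    by (rule Poly_Mapping.keys_add)
  then show ?thesis
    by (simp add: free_extend_superset[of ?S] lookup_add algebra_simps sum.distrib)
qed

lemma free_extend_diff: "free_extend F (x - y) = free_extend F x - free_extend F y"
  using free_extend_add[of F "x - y" y] by simp

lemma free_algebra_induct [case_names zero single add]:
  assumes "P 0" "\<And>w c. P (Poly_Mapping.single w c)"
    and "\<And>x y. P x \<Longrightarrow> P y \<Longrightarrow> P (x + y)"
  shows "P (x :: 'a free_algebra)"
proof (induction x rule: update_induct)
  case const
  show ?case by (simp add: assms(1) flip: zero_poly_mapping_def)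
next
  case (update f w c)
  have "Poly_Mapping.update w c f = f + Poly_Mapping.single w c"
    using update(1) by (intro poly_mapping_eqI)
      (auto simp: lookup_update lookup_add lookup_single in_keys_iff)
  then show ?case using update assms by simp
qed

lemma free_extend_scalar: "free_extend F (free_scalar c * x) = c * free_extend F x"
  by (induction x rule: free_algebra_induct)
    (simp_all add: mult_single free_extend_add algebra_simps)

lemma free_extend_ideal:
  assumes F: "multilinear F" and x: "x \<in> tensor_ideal"
  shows "free_extend F x = 0"
proof -
  have "free_extend F (u * x * v) = 0" for u v
    using x
  proof (induction arbitrary: u v rule: tensor_ideal.induct)
    case (ideal_gen_add a b)
    show ?case
    proof (induction u rule: free_algebra_induct)
      case (single w c)
      show ?case
      proof (induction v rule: free_algebra_induct)
        case (single w' d)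
        then show ?case using F
          by (simp add: algebra_simps mult_single free_extend_diff free_extend_add
              plus_tensor_word_def multilinear_add)
      qed (simp_all add: distrib_left free_extend_add)
    qed (simp_all add: distrib_right free_extend_add)
  next
    case (ideal_gen_scale k a)
    show ?case
    proof (induction u rule: free_algebra_induct)
      case (single w c)
      show ?case
      proof (induction v rule: free_algebra_induct)
        case (single w' d)
        then show ?case using F
          by (simp add: algebra_simps mult_single free_extend_diff free_extend_add
              zero_tensor_word_def plus_tensor_word_def multilinear_scale)
      qed (simp_all add: distrib_left free_extend_add)
    qed (simp_all add: distrib_right free_extend_add)
  next
    case (ideal_mult x u' v')
    then show ?case by (metis mult.assoc)
  qed (simp_all add: distrib_left distrib_right free_extend_add)
  from this[of 1 1] show ?thesis by simp
qed

lemma one_not_in_tensor_ideal: "1 \<notin> tensor_ideal"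
proof
  assume "(1 :: 'a free_algebra) \<in> tensor_ideal"
  moreover have "multilinear (\<lambda>as :: 'a list. if as = [] then 1 else 0)"
    by (simp add: multilinear_def)
  ultimately have "free_extend (\<lambda>as :: 'a list. if as = [] then 1 else 0) 1 = 0"
    by (rule free_extend_ideal[rotated])
  then show False
    by (simp add: free_extend_def lookup_one zero_tensor_word_def)
qed


subsection \<open>The algebra structure\<close>

instantiation tensor_algebra :: (complex_algebra_1) complex_algebra_1
begin

lift_definition zero_tensor_algebra :: "'a tensor_algebra" is 0 .

lift_definition one_tensor_algebra :: "'a tensor_algebra" is 1 .

lift_definition plus_tensor_algebra ::
  "'a tensor_algebra \<Rightarrow> 'a tensor_algebra \<Rightarrow> 'a tensor_algebra" is "(+)"
  by (rule tensor_eq_add)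

lift_definition uminus_tensor_algebra :: "'a tensor_algebra \<Rightarrow> 'a tensor_algebra" is uminus
  by (rule tensor_eq_uminus)

lift_definition minus_tensor_algebra ::
  "'a tensor_algebra \<Rightarrow> 'a tensor_algebra \<Rightarrow> 'a tensor_algebra" is "(-)"
  using tensor_eq_add tensor_eq_uminus by fastforce

lift_definition times_tensor_algebra ::
  "'a tensor_algebra \<Rightarrow> 'a tensor_algebra \<Rightarrow> 'a tensor_algebra" is "(*)"
  by (rule tensor_eq_mult)

lift_definition scaleC_tensor_algebra :: "complex \<Rightarrow> 'a tensor_algebra \<Rightarrow> 'a tensor_algebra"
  is "\<lambda>c x. free_scalar c * x"
  by (intro tensor_eq_mult tensor_eq_refl)

instance
proof -
  have scalar_commute: "x * free_scalar c = free_scalar c * x" for x :: "'a free_algebra" and c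
    by (induction x rule: free_algebra_induct) (simp_all add: mult_single algebra_simps)
  have eqI: "x = y \<Longrightarrow> tensor_eq x y" for x y :: "'a free_algebra"
    by (simp add: tensor_eq_refl)
  show "OFCLASS('a tensor_algebra, complex_algebra_1_class)"
  proof (standard; (transfer, (rule eqI)?))
    show "\<not> tensor_eq (0 :: 'a free_algebra) 1"
      using one_not_in_tensor_ideal ideal_uminus[of "- 1"] by (auto simp: tensor_eq_def)
  next
    fix c and x y :: "'a free_algebra"
    show "x * (free_scalar c * y) = free_scalar c * (x * y)"
      by (metis mult.assoc scalar_commute)
  qed (simp_all add: algebra_simps single_add mult_single flip: mult.assoc)
qed

end

lift_definition pure_tensor :: "'a::complex_algebra_1 list \<Rightarrow> 'a tensor_algebra"
  is "\<lambda>as. Poly_Mapping.single (Tensor_Word as) 1" .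

definition tensor_subalgebra :: "'a::complex_algebra_1 set \<Rightarrow> 'a tensor_algebra set" where
  "tensor_subalgebra B = complex_vector.span (pure_tensor ` lists B)"

definition tensor_extend ::
    "('a::complex_algebra_1 list \<Rightarrow> complex) \<Rightarrow> 'a tensor_algebra \<Rightarrow> complex" where
  "tensor_extend F = (THE f. linear_functional f \<and> (\<forall>as. f (pure_tensor as) = F as))"

lemma linear_functional_iff:
  "linear_functional f \<longleftrightarrow> (\<forall>x y. f (x + y) = f x + f y) \<and> (\<forall>c x. f (c *\<^sub>C x) = c * f x)"
  by (auto simp: Vector_Spaces.linear_def module_hom_def module_hom_axioms_def vector_space_def
      module_def algebra_simps scaleC_add_right scaleC_add_left scaleC_scaleC scaleC_one)

lemma tensor_extend_unique_exists:
  assumes F: "multilinear F"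
  shows "\<exists>!f. linear_functional f \<and> (\<forall>as. f (pure_tensor as) = F as)"
proof -
  define f :: "'a tensor_algebra \<Rightarrow> complex" where
    "f t = free_extend F (rep_tensor_algebra t)" for t
  have f_abs: "f (abs_tensor_algebra x) = free_extend F x" for x
  proof -
    have "tensor_eq (rep_tensor_algebra (abs_tensor_algebra x)) x"
      by (simp add: Quotient3_rep_abs[OF Quotient3_tensor_algebra] tensor_eq_refl)
    then show ?thesis
      using free_extend_ideal[OF F, of "rep_tensor_algebra (abs_tensor_algebra x) - x"]
      by (simp add: f_def tensor_eq_def free_extend_diff)
  qed
  have ex: "\<exists>x. t = abs_tensor_algebra x" for t :: "'a tensor_algebra"
    by (metis Quotient3_abs_rep[OF Quotient3_tensor_algebra])
  have lin: "linear_functional f"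
    unfolding linear_functional_iff
  proof (intro conjI allI)
    fix s t :: "'a tensor_algebra" and c
    obtain x y where "s = abs_tensor_algebra x" "t = abs_tensor_algebra y"
      using ex by meson
    then show "f (s + t) = f s + f t" "f (c *\<^sub>C s) = c * f s"
      by (simp_all add: plus_tensor_algebra.abs_eq scaleC_tensor_algebra.abs_eq f_abs
          free_extend_add free_extend_scalar)
  qed
  have pure: "f (pure_tensor as) = F as" for as
    by (simp add: pure_tensor.abs_eq f_abs)
  show ?thesis
  proof (rule ex1I[of _ f])
    show "linear_functional f \<and> (\<forall>as. f (pure_tensor as) = F as)"
      using lin pure by blast
  next
    fix g assume g: "linear_functional g \<and> (\<forall>as. g (pure_tensor as) = F as)"
    have "g (abs_tensor_algebra x) = free_extend F x" for x
    proof (induction x rule: free_algebra_induct)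
      case zero
      have "g (0 + 0) = g 0 + g 0"
        using g unfolding linear_functional_iff by blast
      then show ?case by (simp flip: zero_tensor_algebra.abs_eq)
    next
      case (single w c)
      have "abs_tensor_algebra (Poly_Mapping.single w c) = c *\<^sub>C pure_tensor (letters w)"
        by (simp add: pure_tensor.abs_eq scaleC_tensor_algebra.abs_eq mult_single)
      then show ?case using g by (simp add: linear_functional_iff)
    next
      case (add x y)
      then show ?case using g
        by (simp add: linear_functional_iff free_extend_add flip: plus_tensor_algebra.abs_eq)
    qed
    then show "g = f"
      by (metis ex ext f_abs)
  qed
qed

abbreviation tensor_functional ::
    "('a::complex_algebra_1 \<Rightarrow> complex) \<Rightarrow> 'a tensor_algebra \<Rightarrow> complex" where
  "tensor_functional f \<equiv> tensor_extend (\<lambda>as. f (prod_list as))"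


section \<open>Notions of independence\<close>

definition alternating :: "'i set \<Rightarrow> ('i \<Rightarrow> 'a set) \<Rightarrow> 'i list \<Rightarrow> 'a list \<Rightarrow> bool" where
  "alternating I B js as \<longleftrightarrow>
     as \<noteq> [] \<and> set js \<subseteq> I \<and> list_all2 (\<lambda>j a. a \<in> B j) js as \<and> distinct_adj js"

definition cyclically_alternating :: "'i set \<Rightarrow> ('i \<Rightarrow> 'a set) \<Rightarrow> 'i list \<Rightarrow> 'a list \<Rightarrow> bool" where
  "cyclically_alternating I B js as \<longleftrightarrow>
     alternating I B js as \<and> 2 \<le> length as \<and> last js \<noteq> hd js"

definition centered :: "('a \<Rightarrow> complex) \<Rightarrow> 'a list \<Rightarrow> bool" where
  "centered \<psi> as \<longleftrightarrow> (\<forall>a\<in>set as. \<psi> a = 0)"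

definition free_wrt ::
    "'i set \<Rightarrow> ('i \<Rightarrow> 'a::complex_algebra_1 set) \<Rightarrow> ('a \<Rightarrow> complex) \<Rightarrow> bool" where
  "free_wrt I B \<psi> \<longleftrightarrow>
     (\<forall>js as. alternating I B js as \<and> centered \<psi> as \<longrightarrow> \<psi> (prod_list as) = 0)"

definition conditionally_free ::
    "'i set \<Rightarrow> ('i \<Rightarrow> 'a::complex_algebra_1 set) \<Rightarrow> ('a \<Rightarrow> complex) \<Rightarrow> ('a \<Rightarrow> complex) \<Rightarrow> bool" where
  "conditionally_free I B \<psi> \<phi> \<longleftrightarrow>
     (\<forall>js as. alternating I B js as \<and> centered \<psi> as \<longrightarrow>
        \<psi> (prod_list as) = 0 \<and> \<phi> (prod_list as) = prod_list (map \<phi> as))"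

definition cyclically_conditionally_free ::
    "'i set \<Rightarrow> ('i \<Rightarrow> 'a::complex_algebra_1 set) \<Rightarrow>
     ('a \<Rightarrow> complex) \<Rightarrow> ('a \<Rightarrow> complex) \<Rightarrow> ('a \<Rightarrow> complex) \<Rightarrow> bool" where
  "cyclically_conditionally_free I B \<psi> \<phi> \<omega> \<longleftrightarrow>
     conditionally_free I B \<psi> \<phi> \<and>
     (\<forall>js as. cyclically_alternating I B js as \<and> centered \<psi> as \<longrightarrow>
        \<omega> (prod_list as) = prod_list (map \<phi> as))"

definition cyclically_free ::
    "'i set \<Rightarrow> ('i \<Rightarrow> 'a::complex_algebra_1 set) \<Rightarrow> ('a \<Rightarrow> complex) \<Rightarrow> ('a \<Rightarrow> complex) \<Rightarrow> bool" where
  "cyclically_free I B \<psi> \<omega> \<longleftrightarrow>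
     free_wrt I B \<psi> \<and>
     (\<forall>js as. cyclically_alternating I B js as \<and> centered \<psi> as \<longrightarrow> \<omega> (prod_list as) = 0)"


section \<open>Partitions\<close>

text \<open>
  Positions in a list of length $n$ are numbered from $0$ to $n - 1$, so partitions of $[n]$
  become partitions of \<open>{..<n}\<close>; for a block \<open>V\<close>, the list $a_V$ is \<open>nths as V\<close>.
\<close>

definition interval_partitions :: "nat \<Rightarrow> nat set set set" where
  "interval_partitions n = {P. partition_on {..<n} P \<and> (\<forall>V\<in>P. \<exists>i j. V = {i..j})}"

definition noncrossing_partitions :: "nat \<Rightarrow> nat set set set" where
  "noncrossing_partitions n =
     {P. partition_on {..<n} P \<and>
         \<not> (\<exists>V\<in>P. \<exists>W\<in>P. V \<noteq> W \<and>
              (\<exists>i\<in>V. \<exists>j\<in>W. \<exists>k\<in>V. \<exists>l\<in>W. i < j \<and> j < k \<and> k < l))}"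

definition inner_block :: "nat set set \<Rightarrow> nat set \<Rightarrow> bool" where
  "inner_block P V \<longleftrightarrow> (\<exists>W\<in>P. W \<noteq> V \<and> (\<exists>i\<in>W. \<exists>j\<in>W. \<forall>v\<in>V. i < v \<and> v < j))"

text \<open>
  The list $a_{(W,\prec_V)}$: traverse the circle clockwise from an element of \<open>V\<close>, here its
  maximum, back to itself. Starting in \<open>V\<close>, this traversal runs through each arc of the complement
  of \<open>V\<close> clockwise and without interruption.
\<close>

definition nths_from :: "'a list \<Rightarrow> nat set \<Rightarrow> nat set \<Rightarrow> 'a list" where
  "nths_from as V W = nths as {w \<in> W. Max V < w} @ nths as {w \<in> W. w < Max V}"

lemma interval_partitions_noncrossing: "interval_partitions n \<subseteq> noncrossing_partitions n"
proof
  fix P assume P: "P \<in> interval_partitions n"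
  then have part: "partition_on {..<n} P"
    and interval: "\<forall>V\<in>P. \<exists>i j. V = {i..j}"
    unfolding interval_partitions_def by blast+
  have False if *: "V \<in> P" "W \<in> P" "V \<noteq> W" "i \<in> V" "j \<in> W" "k \<in> V" "i < j" "j < k" for V W i j k
  proof -
    obtain a b where "V = {a..b}"
      using interval \<open>V \<in> P\<close> by blast
    then have "j \<in> V"
      using *(4,6-8) by simp
    moreover have "V \<inter> W = {}"
      using partition_onD2[OF part] *(1-3) by (rule disjointD)
    ultimately show False
      using \<open>j \<in> W\<close> by blast
  qed
  then have "\<not> (\<exists>V\<in>P. \<exists>W\<in>P. V \<noteq> W \<and>
      (\<exists>i\<in>V. \<exists>j\<in>W. \<exists>k\<in>V. \<exists>l\<in>W. i < j \<and> j < k \<and> k < l))"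
    by (metis (no_types, lifting))
  with part show "P \<in> noncrossing_partitions n"
    by (simp only: noncrossing_partitions_def mem_Collect_eq simp_thms)
qed

lemma finite_noncrossing_partitions: "finite (noncrossing_partitions n)"
  by (rule finite_subset[OF _ finitely_many_partition_on[of "{..<n}"]])
    (auto simp: noncrossing_partitions_def)

lemma full_interval_partition:
  assumes "n \<noteq> 0"
  shows "{{..<n}} \<in> interval_partitions n"
proof -
  have "{..<n} = {0..n - 1}"
    using assms by auto
  moreover have "{..<n} \<noteq> {}"
    using assms by auto
  ultimately show ?thesis
    unfolding interval_partitions_def using partition_on_space[of "{..<n}"] by blast
qed

lemma length_nths_block_less:
  assumes P: "P \<in> noncrossing_partitions (length as) - {{{..<length as}}}" and V: "V \<in> P"
  shows "length (nths as V) < length as"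
proof -
  have part: "partition_on {..<length as} P"
    using P by (auto simp: noncrossing_partitions_def)
  then have sub: "V \<subseteq> {..<length as}" and ne: "V \<noteq> {}"
    using V by (auto simp: partition_on_def)
  have "V \<noteq> {..<length as}"
  proof
    assume V_eq: "V = {..<length as}"
    have "W = V" if "W \<in> P" for W
    proof (rule ccontr)
      assume "W \<noteq> V"
      then have "W \<inter> V = {}"
        using disjointD[OF partition_onD2[OF part] that V] by blast
      moreover have "W \<subseteq> V" "W \<noteq> {}"
        using part V_eq that unfolding partition_on_def by blast+
      ultimately show False
        by blast
    qed
    then have "P = {{..<length as}}"
      using V V_eq by blast
    then show False
      using P by simp
  qed
  then have "card V < card {..<length as}"
    by (intro psubset_card_mono) (use sub in auto)
  moreover have "{i. i < length as \<and> i \<in> V} = V"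
    using sub by auto
  ultimately show ?thesis
    by (simp add: length_nths)
qed


section \<open>Cumulants\<close>

text \<open>
  Each family of cumulants is defined by solving its moment-cumulant formula for the term indexed
  by the one-block partition; the formulas themselves are proved after each definition. The values
  of the cumulants at the empty list are meaningless and never used.
\<close>

function boolean_cumulant :: "('a::monoid_mult \<Rightarrow> complex) \<Rightarrow> 'a list \<Rightarrow> complex" where
  "boolean_cumulant \<psi> as =
     \<psi> (prod_list as) -
     (\<Sum>P \<in> interval_partitions (length as) - {{{..<length as}}}.
        \<Prod>V\<in>P. boolean_cumulant \<psi> (nths as V))"
  by auto
termination
proof (relation "measure (length \<circ> snd)", goal_cases)
  case (2 \<psi> as P V)
  then have "P \<in> noncrossing_partitions (length as) - {{{..<length as}}}"
    using interval_partitions_noncrossing by blast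
  from length_nths_block_less[OF this \<open>V \<in> P\<close>] show ?case
    by simp
qed simp

declare boolean_cumulant.simps [simp del]

function free_cumulant :: "('a::monoid_mult \<Rightarrow> complex) \<Rightarrow> 'a list \<Rightarrow> complex" where
  "free_cumulant \<psi> as =
     \<psi> (prod_list as) -
     (\<Sum>P \<in> noncrossing_partitions (length as) - {{{..<length as}}}.
        \<Prod>V\<in>P. free_cumulant \<psi> (nths as V))"
  by auto
termination
  by (relation "measure (length \<circ> snd)") (simp_all add: length_nths_block_less)

declare free_cumulant.simps [simp del]

function cfree_cumulant ::
    "('a::monoid_mult \<Rightarrow> complex) \<Rightarrow> ('a \<Rightarrow> complex) \<Rightarrow> 'a list \<Rightarrow> complex" where
  "cfree_cumulant \<phi> \<psi> as =
     \<phi> (prod_list as) -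
     (\<Sum>P \<in> noncrossing_partitions (length as) - {{{..<length as}}}.
        (\<Prod>V \<in> {V\<in>P. \<not> inner_block P V}. cfree_cumulant \<phi> \<psi> (nths as V)) *
        (\<Prod>V \<in> {V\<in>P. inner_block P V}. free_cumulant \<psi> (nths as V)))"
  by auto
termination
  by (relation "measure (length \<circ> snd \<circ> snd)") (simp_all add: length_nths_block_less)

declare cfree_cumulant.simps [simp del]

definition cyclic_boolean :: "('a::monoid_mult \<Rightarrow> complex) \<Rightarrow> 'a list \<Rightarrow> complex" where
  \<comment> \<open>The functional $[\psi]$; \<open>S\<close> is the set of starting points $i_1 < \cdots < i_\ell$ of the
      cyclic segments, and the segment starting at \<open>i\<close> ends just before the next point of \<open>S\<close>
      (which is \<open>i\<close> itself, after a full turn, if \<open>S = {i}\<close>).\<close>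
  "cyclic_boolean \<psi> as =
     (if as = [] then 1
      else \<Sum>S \<in> Pow {..<length as} - {{}}.
             \<Prod>i\<in>S. boolean_cumulant \<psi>
               (take (LEAST d. 0 < d \<and> (i + d) mod length as \<in> S) (rotate i as)))"

function cyclic_cfree_cumulant ::
    "('a::monoid_mult \<Rightarrow> complex) \<Rightarrow> ('a \<Rightarrow> complex) \<Rightarrow> ('a \<Rightarrow> complex) \<Rightarrow> 'a list \<Rightarrow> complex" where
  "cyclic_cfree_cumulant \<omega> \<phi> \<psi> as =
     \<omega> (prod_list as) + (1 - \<omega> 1) * cyclic_boolean \<psi> as - cyclic_boolean \<phi> as -
     (\<Sum>P \<in> noncrossing_partitions (length as) - {{{..<length as}}}.
        \<Sum>V\<in>P. cyclic_cfree_cumulant \<omega> \<phi> \<psi> (nths as V) *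
          (\<Prod>W \<in> P - {V}. free_cumulant \<psi> (nths_from as V W)))"
  by auto
termination
  by (relation "measure (length \<circ> snd \<circ> snd \<circ> snd)") (simp_all add: length_nths_block_less)

declare cyclic_cfree_cumulant.simps [simp del]

lemma nths_full: "nths as {..<length as} = as"
  by (simp add: nths_all)

lemma sum_split_full:
  assumes "as \<noteq> []" "interval_partitions (length as) \<subseteq> Q" "Q \<subseteq> noncrossing_partitions (length as)"
  shows "(\<Sum>P\<in>Q. g P) = g {{..<length as}} + (\<Sum>P \<in> Q - {{{..<length as}}}. g P :: complex)"
proof (rule sum.remove)
  show "finite Q"
    using assms(3) finite_noncrossing_partitions by (rule finite_subset)
  show "{{..<length as}} \<in> Q"
    using assms(1,2) full_interval_partition by auto
qed

theorem boolean_moment_cumulant: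
  assumes "as \<noteq> []"
  shows "\<psi> (prod_list as) =
    (\<Sum>P \<in> interval_partitions (length as). \<Prod>V\<in>P. boolean_cumulant \<psi> (nths as V))"
  using boolean_cumulant.simps[of \<psi> as]
  by (simp add: sum_split_full[OF assms order.refl interval_partitions_noncrossing] nths_full)

theorem free_moment_cumulant:
  assumes "as \<noteq> []"
  shows "\<psi> (prod_list as) =
    (\<Sum>P \<in> noncrossing_partitions (length as). \<Prod>V\<in>P. free_cumulant \<psi> (nths as V))"
  using free_cumulant.simps[of \<psi> as]
  by (simp add: sum_split_full[OF assms interval_partitions_noncrossing order.refl] nths_full)

theorem cfree_moment_cumulant:
  assumes "as \<noteq> []"
  shows "\<phi> (prod_list as) =
    (\<Sum>P \<in> noncrossing_partitions (length as).
        (\<Prod>V \<in> {V\<in>P. \<not> inner_block P V}. cfree_cumulant \<phi> \<psi> (nths as V)) *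
        (\<Prod>V \<in> {V\<in>P. inner_block P V}. free_cumulant \<psi> (nths as V)))"
proof -
  have "{V \<in> {{..<length as}}. \<not> inner_block {{..<length as}} V} = {{..<length as}}"
    and "{V \<in> {{..<length as}}. inner_block {{..<length as}} V} = {}"
    by (auto simp: inner_block_def)
  note eqs = this
  show ?thesis
    unfolding sum_split_full[OF assms interval_partitions_noncrossing order.refl] eqs
    using cfree_cumulant.simps[of \<phi> \<psi> as] by (simp add: nths_full)
qed

theorem cyclic_cfree_moment_cumulant:
  assumes "as \<noteq> []"
  shows "\<omega> (prod_list as) + (1 - \<omega> 1) * cyclic_boolean \<psi> as - cyclic_boolean \<phi> as =
    (\<Sum>P \<in> noncrossing_partitions (length as).
        \<Sum>V\<in>P. cyclic_cfree_cumulant \<omega> \<phi> \<psi> (nths as V) *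
          (\<Prod>W \<in> P - {V}. free_cumulant \<psi> (nths_from as V W)))"
  using cyclic_cfree_cumulant.simps[of \<omega> \<phi> \<psi> as]
  by (simp add: sum_split_full[OF assms interval_partitions_noncrossing order.refl] nths_full)

definition mixed_vanish :: "'i set \<Rightarrow> ('i \<Rightarrow> 'a set) \<Rightarrow> ('a list \<Rightarrow> complex) \<Rightarrow> bool" where
  "mixed_vanish I A \<kappa> \<longleftrightarrow>
     (\<forall>js as. set js \<subseteq> I \<and> list_all2 (\<lambda>j a. a \<in> A j) js as \<and>
        (\<exists>j\<in>set js. \<exists>j'\<in>set js. j \<noteq> j') \<longrightarrow> \<kappa> as = 0)"

end

theory Submission
  imports Defs
begin

text \<open>
  Summing out the blocks other than a distinguished one turns every moment-cumulant formula into
  a sum over the subsets \<open>V\<close> of the positions of a word: \<open>V\<close> carries the cumulant, and each gap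
  of \<open>V\<close> carries a moment. For \<open>\<psi>\<close> and \<open>\<phi>\<close>, the block \<open>V\<close> contains the first letter and only the
  last gap is evaluated by \<open>\<phi>\<close>; for $\omega - [\varphi] + (1 - \omega(1))[\psi]$, \<open>V\<close> is any nonempty
  subset, and its cyclic gaps are evaluated by \<open>\<psi>\<close>.

  Write a word as a product of runs $r_1 \cdots r_m$ of letters of the same algebra, and let
  $t_k = r_k - \psi(r_k) 1$ in the tensor algebra. In the expansion of a functional at
  $t_1 \otimes \cdots \otimes t_m$, a block \<open>V\<close> of one colour that meets two runs leaves a gap that
  contains a full centred run, so freeness with respect to \<open>\<psi>\<close> kills its contribution. Hence these
  values are exactly those required by (conditional, cyclic) freeness if the mixed cumulants
  vanish; conversely, by induction on the length, the only mixed cumulant left in the expansion is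
  the one of the whole word, so it must vanish. This gives the equivalence of 2 and 3.

  For the equivalence of 1 and 2, conditional freeness implies
  $[\varphi](t_1 \otimes \cdots \otimes t_m) = \varphi(t_1) \cdots \varphi(t_m)$ for cyclically
  alternating runs: Boolean cumulants vanish on $s \otimes t_2 \otimes \cdots \otimes t_{m-1}
  \otimes p$ for nonempty words \<open>s\<close> and \<open>p\<close> of the outer runs, so that in $[\varphi]$ only the
  linear partitions, whose sum is \<open>\<phi>\<close>, survive.
\<close>

section \<open>Peeling a block off a non-crossing partition\<close>

text \<open>Partitions are left behind early because the recursion \<open>scan\<close> carries the
  current gap as an element of the algebra and is linear in it. Passing a run into the gap and
  deleting the run then differ exactly by replacing the run's value by its centred value, so whole
  runs can be centred without looking at partitions again. Two obstacles come from the circle. The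
  last gap wraps around the end of the word, so its partitions have to be renumbered by a rotation,
  which preserves non-crossing but not the order. Moreover only words whose first and last colours
  differ are controlled by cyclic freeness. Other mixed words have to be rotated first, which
  requires cyclic invariance of \<kappa>^{\<omega>|\<phi>,\<psi>}. This is not built into the
  recursive definition; it is extracted from the trace property of \<omega> and the rotation
  invariance of [\<phi>] and [\<psi>]. The constant 1 - \<omega>(1) makes the modified functional
  vanish on the empty word, where a sum over nonempty blocks is empty. Free cumulants are treated as
  the case \<phi> = \<psi> of the conditionally free ones.\<close>

definition alternate :: "nat set \<Rightarrow> nat set \<Rightarrow> bool" where
  "alternate V W \<longleftrightarrow> (\<exists>i\<in>V. \<exists>j\<in>W. \<exists>k\<in>V. \<exists>l\<in>W. i < j \<and> j < k \<and> k < l)"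

text \<open>Arbitrary ground sets are allowed because the gaps of a block are themselves
  partitioned. \<open>alternate\<close> is not symmetric; quantifying over ordered pairs of blocks
  excludes both orders.\<close>

definition nc_on :: "nat set \<Rightarrow> nat set set set" where
  "nc_on X = {P. partition_on X P \<and> (\<forall>V\<in>P. \<forall>W\<in>P. V \<noteq> W \<longrightarrow> \<not> alternate V W)}"

lemma noncrossing_partitions_eq: "noncrossing_partitions n = nc_on {..<n}"
  by (simp add: noncrossing_partitions_def nc_on_def alternate_def disj_imp)

lemma finite_nc_on: "finite X \<Longrightarrow> finite (nc_on X)"
  by (rule finite_subset[OF _ finitely_many_partition_on[of X]]) (auto simp: nc_on_def)

lemma nc_on_empty [simp]: "nc_on {} = {{}}"
  by (auto simp: nc_on_def partition_on_empty)

lemma nc_on_partition: "P \<in> nc_on X \<Longrightarrow> partition_on X P"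
  by (simp add: nc_on_def)

lemma nc_on_sub: "P \<in> nc_on X \<Longrightarrow> V \<in> P \<Longrightarrow> V \<subseteq> X"
  by (auto simp: nc_on_def partition_on_def)

lemma alternateI:
  "i \<in> V \<Longrightarrow> j \<in> W \<Longrightarrow> k \<in> V \<Longrightarrow> l \<in> W \<Longrightarrow> i < j \<Longrightarrow> j < k \<Longrightarrow> k < l \<Longrightarrow> alternate V W"
  unfolding alternate_def by metis

lemma alternate_singleton: "\<not> alternate {l} W" "\<not> alternate W {l}"
  by (auto simp: alternate_def)

lemma nc_on_not_alternate: "P \<in> nc_on X \<Longrightarrow> V \<in> P \<Longrightarrow> W \<in> P \<Longrightarrow> V \<noteq> W \<Longrightarrow> \<not> alternate V W"
  by (simp add: nc_on_def)

lemma nc_on_alternate: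
  "P \<in> nc_on X \<Longrightarrow> V \<in> P \<Longrightarrow> W \<in> P \<Longrightarrow> i \<in> V \<Longrightarrow> j \<in> W \<Longrightarrow> k \<in> V \<Longrightarrow> l \<in> W
    \<Longrightarrow> i < j \<Longrightarrow> j < k \<Longrightarrow> k < l \<Longrightarrow> V = W"
  using nc_on_not_alternate alternateI by metis

lemma partition_on_same:
  "partition_on X P \<Longrightarrow> V \<in> P \<Longrightarrow> W \<in> P \<Longrightarrow> x \<in> V \<Longrightarrow> x \<in> W \<Longrightarrow> V = W"
  unfolding partition_on_def disjoint_def by blast

lemma partition_on_ex: "partition_on X P \<Longrightarrow> x \<in> X \<Longrightarrow> \<exists>V\<in>P. x \<in> V"
  unfolding partition_on_def by blast

lemma partition_on_sub: "partition_on X P \<Longrightarrow> V \<in> P \<Longrightarrow> V \<subseteq> X"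
  unfolding partition_on_def by blast

lemma partition_on_nonempty: "partition_on X P \<Longrightarrow> V \<in> P \<Longrightarrow> \<exists>x. x \<in> V"
  unfolding partition_on_def by (metis all_not_in_conv)

lemma partition_onI':
  assumes "\<And>V. V \<in> P \<Longrightarrow> V \<subseteq> X" "\<And>V. V \<in> P \<Longrightarrow> V \<noteq> {}"
    and "\<And>x. x \<in> X \<Longrightarrow> \<exists>V\<in>P. x \<in> V"
    and "\<And>V W x. V \<in> P \<Longrightarrow> W \<in> P \<Longrightarrow> x \<in> V \<Longrightarrow> x \<in> W \<Longrightarrow> V = W"
  shows "partition_on X P"
  unfolding partition_on_def disjoint_def using assms by blast

lemma partition_on_add_block:
  assumes "V \<subseteq> X" "V \<noteq> {}" "partition_on (X - V) P"
  shows "partition_on X (insert V P)" "V \<notin> P"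
proof -
  have "disjnt V (\<Union>P)" using partition_onD1[OF assms(3)] by (auto simp: disjnt_def)
  then show "partition_on X (insert V P)" "V \<notin> P"
    using assms by (auto simp: partition_on_insert disjnt_def)
qed

lemma partition_on_remove_block:
  assumes "partition_on X P" "V \<in> P"
  shows "partition_on (X - V) (P - {V})"
proof -
  have "disjnt V (\<Union>(P - {V}))"
    using partition_on_same[OF assms] by (auto simp: disjnt_def)
  then show ?thesis
    using partition_on_insert[of V "P - {V}" X] assms by (simp add: insert_absorb)
qed

text \<open>
  Decomposing a partition along the block of \<open>l\<close>, letter by letter. The set \<open>E\<close> of positions
  before \<open>l\<close> is empty for the linear formulas; for the cyclic one it is the part of the last
  gap that lies beyond the end of the word.
\<close>

definition nc_start :: "nat \<Rightarrow> nat set \<Rightarrow> nat \<Rightarrow> nat set set set" where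
  "nc_start n E l = {P \<in> nc_on ({l..<n} \<union> E). \<forall>V\<in>P. l \<in> V \<longrightarrow> V \<inter> E = {}}"

definition block_at :: "nat set set \<Rightarrow> nat \<Rightarrow> nat set" where
  "block_at P l = (THE V. V \<in> P \<and> l \<in> V)"

lemma block_at_eq: "partition_on X P \<Longrightarrow> V \<in> P \<Longrightarrow> l \<in> V \<Longrightarrow> block_at P l = V"
  unfolding block_at_def by (rule the_equality) (auto dest: partition_on_same)

text \<open>Here \<open>v\<close> is the successor of \<open>l\<close> in its block:
  \<open>Q\<close> partitions the gap between them, and \<open>l\<close> is added to the block of
  \<open>v\<close> in \<open>P\<close>.\<close>

definition nc_join :: "nat \<Rightarrow> nat \<Rightarrow> nat set set \<Rightarrow> nat set set \<Rightarrow> nat set set" where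
  "nc_join l v Q P = Q \<union> (\<lambda>W. if v \<in> W then insert l W else W) ` P"

text \<open>If the block stops at \<open>l\<close>, all later positions and those of
  \<open>E\<close> together form the last gap, so blocks may now mix the two kinds of positions
  freely.\<close>

lemma nc_start_singleton:
  assumes E: "E \<subseteq> {..<l}" and l: "l < n"
  shows "bij_betw (insert {l}) (nc_on ({Suc l..<n} \<union> E)) {P \<in> nc_start n E l. {l} \<in> P}"
proof (rule bij_betw_byWitness[where f' = "\<lambda>P. P - {{l}}"])
  let ?X = "{l..<n} \<union> E"
  have X: "{Suc l..<n} \<union> E = ?X - {l}" "{l} \<subseteq> ?X" using E l by auto
  note add = partition_on_add_block[OF X(2) insert_not_empty]
  have P: "{l} \<notin> P" "insert {l} P \<in> nc_start n E l" if P: "P \<in> nc_on ({Suc l..<n} \<union> E)" for P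
  proof -
    have part: "partition_on (?X - {l}) P" using nc_on_partition[OF P] X(1) by simp
    have "\<not> alternate V W" if "V \<in> insert {l} P" "W \<in> insert {l} P" "V \<noteq> W" for V W
      using that nc_on_not_alternate[OF P, of V W] alternate_singleton by auto
    moreover have "V \<inter> E = {}" if "V \<in> insert {l} P" "l \<in> V" for V
      using partition_on_same[OF add(1)[OF part] that(1), of "{l}" l] that(2) E by auto
    ultimately show "{l} \<notin> P" "insert {l} P \<in> nc_start n E l"
      using add[OF part] by (simp_all add: nc_start_def nc_on_def)
  qed
  then show "\<forall>P\<in>nc_on ({Suc l..<n} \<union> E). insert {l} P - {{l}} = P"
    "insert {l} ` nc_on ({Suc l..<n} \<union> E) \<subseteq> {P \<in> nc_start n E l. {l} \<in> P}"
    by auto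
  show "\<forall>P\<in>{P \<in> nc_start n E l. {l} \<in> P}. insert {l} (P - {{l}}) = P"
    by auto
  show "(\<lambda>P. P - {{l}}) ` {P \<in> nc_start n E l. {l} \<in> P} \<subseteq> nc_on ({Suc l..<n} \<union> E)"
    unfolding X(1) using partition_on_remove_block[of ?X _ "{l}"]
    by (auto simp: nc_start_def nc_on_def)
qed

lemma nc_join_eq:
  assumes "partition_on X P" "V \<in> P" "v \<in> V"
  shows "nc_join l v Q P = Q \<union> insert (insert l V) (P - {V})"
proof -
  have "(\<lambda>W. if v \<in> W then insert l W else W) ` (P - {V}) = (\<lambda>W. W) ` (P - {V})"
    by (intro image_cong refl) (use partition_on_same[OF assms(1,2)] assms(3) in auto)
  moreover have "(\<lambda>W. if v \<in> W then insert l W else W) ` insert V (P - {V}) =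
      insert (insert l V) ((\<lambda>W. if v \<in> W then insert l W else W) ` (P - {V}))"
    using assms(3) by (simp only: image_insert if_True)
  moreover have "insert V (P - {V}) = P" using assms(2) by blast
  ultimately show ?thesis unfolding nc_join_def by simp
qed

definition nc_gap :: "nat \<Rightarrow> nat \<Rightarrow> nat set set \<Rightarrow> nat set set" where
  "nc_gap l v P = {W \<in> P. W \<subseteq> {l<..<v}}"

definition nc_rest :: "nat \<Rightarrow> nat \<Rightarrow> nat set set \<Rightarrow> nat set set" where
  "nc_rest l v P = (\<lambda>W. W - {l}) ` {W \<in> P. \<not> W \<subseteq> {l<..<v}}"

lemma nc_split_join:
  assumes E: "E \<subseteq> {..<l}" and v: "l < v" "v < n"
    and Q: "Q \<in> nc_on {Suc l..<v}" and P: "P \<in> nc_start n E v"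
  shows "nc_gap l v (nc_join l v Q P) = Q" "nc_rest l v (nc_join l v Q P) = P"
proof -
  have Qp: "\<And>W. W \<in> Q \<Longrightarrow> W \<subseteq> {l<..<v}"
    using nc_on_sub[OF Q] by fastforce
  have Pp: "partition_on ({v..<n} \<union> E) P" using P by (auto simp: nc_start_def nc_on_def)
  have Pn: "\<not> W \<subseteq> {l<..<v}" "l \<notin> W" if WP: "W \<in> P" for W
  proof -
    obtain x where "x \<in> W" using partition_on_nonempty[OF Pp WP] by blast
    moreover have "W \<subseteq> {v..<n} \<union> E" by (rule partition_on_sub[OF Pp that])
    ultimately show "\<not> W \<subseteq> {l<..<v}" "l \<notin> W" using v E by fastforce+
  qed
  have "{W \<in> nc_join l v Q P. W \<subseteq> {l<..<v}} = Q"
    using Qp Pn by (auto simp: nc_join_def)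
  moreover have "{W \<in> nc_join l v Q P. \<not> W \<subseteq> {l<..<v}} = (\<lambda>W. if v \<in> W then insert l W else W) ` P"
    using Qp Pn by (auto simp: nc_join_def)
  moreover have "(\<lambda>W. W - {l}) ` (\<lambda>W. if v \<in> W then insert l W else W) ` P = P"
  proof -
    have "(if v \<in> W then insert l W else W) - {l} = W" if "W \<in> P" for W
      using Pn(2)[OF that] by auto
    then have "(\<lambda>W. (if v \<in> W then insert l W else W) - {l}) ` P = (\<lambda>W. W) ` P"
      by (intro image_cong refl)
    then show ?thesis unfolding image_image by simp
  qed
  ultimately show "nc_gap l v (nc_join l v Q P) = Q" "nc_rest l v (nc_join l v Q P) = P"
    by (simp_all add: nc_gap_def nc_rest_def)
qed

lemma nc_join_split:
  assumes E: "E \<subseteq> {..<l}" and v: "l < v" "v < n"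
    and P: "P \<in> nc_start n E l" and V: "V \<in> P" "l \<in> V" "v \<in> V" "V \<inter> {l<..<v} = {}"
  shows "nc_join l v (nc_gap l v P) (nc_rest l v P) = P"
proof -
  have part: "partition_on ({l..<n} \<union> E) P"
    using P by (auto simp: nc_start_def nc_on_def)
  have "(if v \<in> W - {l} then insert l (W - {l}) else W - {l}) = W" if "W \<in> P" for W
  proof (cases "W = V")
    case False
    then have "l \<notin> W" "v \<notin> W" using partition_on_same[OF part] V that by blast+
    then show ?thesis by auto
  qed (use V v in auto)
  then have "(\<lambda>W. if v \<in> W - {l} then insert l (W - {l}) else W - {l}) ` {W \<in> P. \<not> W \<subseteq> {l<..<v}} =
      (\<lambda>W. W) ` {W \<in> P. \<not> W \<subseteq> {l<..<v}}"
    by (intro image_cong refl) simp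
  then have "(\<lambda>W. if v \<in> W then insert l W else W) ` (\<lambda>W. W - {l}) ` {W \<in> P. \<not> W \<subseteq> {l<..<v}} =
      {W \<in> P. \<not> W \<subseteq> {l<..<v}}"
    unfolding image_image by simp
  then show ?thesis
    unfolding nc_join_def nc_gap_def nc_rest_def by blast
qed

text \<open>Blocks of \<open>Q\<close> sit strictly between \<open>l\<close> and \<open>v\<close>,
  where no other block has a point. Hence they cross nothing, and a crossing with the enlarged block
  would already be one in \<open>P\<close>.\<close>

lemma nc_join_in:
  assumes E: "E \<subseteq> {..<l}" and v: "l < v" "v < n"
    and Q: "Q \<in> nc_on {Suc l..<v}" and P: "P \<in> nc_start n E v"
  shows "nc_join l v Q P \<in> {P \<in> nc_start n E l. \<exists>V\<in>P. l \<in> V \<and> v \<in> V \<and> V \<inter> {l<..<v} = {}}"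
proof -
  have Qp: "partition_on {Suc l..<v} Q" by (rule nc_on_partition[OF Q])
  have Pp: "partition_on ({v..<n} \<union> E) P" and Pnc: "P \<in> nc_on ({v..<n} \<union> E)"
    using P by (auto simp: nc_start_def nc_on_def)
  have "v \<in> {v..<n} \<union> E" using v by auto
  then obtain V where V: "V \<in> P" "v \<in> V" using partition_on_ex[OF Pp] by blast
  then have VE: "V \<inter> E = {}" using P by (auto simp: nc_start_def)
  have V_le: "v \<le> x" if "x \<in> V" for x
    using that VE partition_on_sub[OF Pp V(1)] by fastforce
  have join: "nc_join l v Q P = Q \<union> insert (insert l V) (P - {V})"
    by (rule nc_join_eq[OF Pp V])
  have Qsub: "l < x" "x < v" if "W \<in> Q" "x \<in> W" for W x
    using partition_on_sub[OF Qp that(1)] that(2) by auto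
  have Psub: "x < l \<or> v \<le> x" "x \<noteq> l" "x \<in> E \<or> v \<le> x" "x \<in> E \<or> x < n" if "W \<in> P" "x \<in> W" for W x
    using partition_on_sub[OF Pp that(1)] that(2) E v by fastforce+
  have Pp': "x < l \<or> v \<le> x" if "W \<in> P - {V}" "x \<in> W" for W x
    using Psub that by blast
  have Ev: "x < l" if "x \<in> E" for x using that E by auto
  have part: "partition_on ({l..<n} \<union> E) (nc_join l v Q P)"
    unfolding join
  proof (rule partition_onI')
    fix W assume W: "W \<in> Q \<union> insert (insert l V) (P - {V})"
    show "W \<subseteq> {l..<n} \<union> E"
    proof
      fix x assume "x \<in> W"
      with W show "x \<in> {l..<n} \<union> E"
      proof (elim UnE insertE)
        assume "W \<in> Q"
        then show ?thesis using Qsub[of W x] \<open>x \<in> W\<close> v by auto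
      next
        assume "W = insert l V"
        then show ?thesis using Psub[OF V(1), of x] V_le[of x] \<open>x \<in> W\<close> v Ev[of x] by fastforce
      next
        assume "W \<in> P - {V}"
        then show ?thesis using partition_on_sub[OF Pp, of W] \<open>x \<in> W\<close> v by auto
      qed
    qed
    show "W \<noteq> {}" using W Qp Pp by (auto simp: partition_on_def)
  next
    fix x assume x: "x \<in> {l..<n} \<union> E"
    consider "x = l" | "x \<in> {Suc l..<v}" | "x \<in> {v..<n} \<union> E" using x by fastforce
    then show "\<exists>W\<in>Q \<union> insert (insert l V) (P - {V}). x \<in> W"
    proof cases
      case 2
      then show ?thesis using partition_on_ex[OF Qp] by blast
    next
      case 3
      then obtain W where "W \<in> P" "x \<in> W" using partition_on_ex[OF Pp] by blast
      then show ?thesis by (cases "W = V") auto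
    qed auto
  next
    fix U W x assume UW: "U \<in> Q \<union> insert (insert l V) (P - {V})" "W \<in> Q \<union> insert (insert l V) (P - {V})"
      and x: "x \<in> U" "x \<in> W"
    have *: "\<not> (l < x \<and> x < v)" if "Y \<in> insert (insert l V) (P - {V})" "x \<in> Y" for Y
      using that Psub(1)[of Y x] V_le[of x] by (cases "Y = insert l V") auto
    have **: "Y \<noteq> insert l V" if "Y \<in> P - {V}" "x \<in> Y" "x \<in> insert l V" for Y
      using that Psub(2)[of Y x] partition_on_same[OF Pp, of Y V x] V(1) by blast
    show "U = W"
    proof (cases "l < x \<and> x < v")
      case True
      then have "U \<in> Q" "W \<in> Q" using * UW x by blast+
      then show ?thesis using partition_on_same[OF Qp] x by blast
    next
      case False
      then have "U \<in> insert (insert l V) (P - {V})" "W \<in> insert (insert l V) (P - {V})"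
        using UW x Qsub by blast+
      then show ?thesis
        using x partition_on_same[OF Pp, of U W x] partition_on_same[OF Pp, of U V x]
          partition_on_same[OF Pp, of V W x] V(1) Psub(2) by blast
    qed
  qed
  have V_alt: "\<not> alternate (insert l V) W" "\<not> alternate W (insert l V)" if W: "W \<in> P - {V}" for W
  proof -
    note Pn = nc_on_alternate[OF Pnc V(1), of W] nc_on_alternate[OF Pnc, of W V]
    have VW: "V \<noteq> W" "W \<in> P" using W by auto
    have g: "v < j" if "j \<in> W" "l < j" for j
    proof -
      have "j \<noteq> v" using V VW partition_on_same[OF Pp, of V W v] that(1) by blast
      then show ?thesis using Pp'[OF W that(1)] that(2) by linarith
    qed
    show "\<not> alternate (insert l V) W"
    proof
      assume "alternate (insert l V) W"
      then obtain i j k m where *: "i \<in> insert l V" "j \<in> W" "k \<in> insert l V" "m \<in> W" "i < j" "j < k" "k < m"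
        unfolding alternate_def by blast
      have k: "k \<in> V" using * V_le[of i] v by fastforce
      \<comment> \<open>In a crossing, \<open>l\<close> can be replaced by \<open>v\<close>: points
        of \<open>W\<close> beyond \<open>l\<close> also lie beyond \<open>v\<close>.\<close>
      define i' where "i' = (if i = l then v else i)"
      have "i' \<in> V" "i' < j" using * g[of j] V by (auto simp: i'_def)
      then show False using Pn(1)[of i' j k m] * k VW by blast
    qed
    show "\<not> alternate W (insert l V)"
    proof
      assume "alternate W (insert l V)"
      then obtain i j k m where *: "i \<in> W" "j \<in> insert l V" "k \<in> W" "m \<in> insert l V" "i < j" "j < k" "k < m"
        unfolding alternate_def by blast
      have m: "m \<in> V" using * V_le[of j] v by fastforce
      define j' where "j' = (if j = l then v else j)"
      have "j' \<in> V" "i < j'" "j' < k" using * g[of k] V v by (auto simp: j'_def)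
      then have "W = V" using Pn(2)[OF VW(2) V(1) *(1) _ *(3) m _ _ *(7)] by blast
      then show False using VW(1) by simp
    qed
  qed
  have far: "x \<le> l \<or> v \<le> x" if "W \<in> insert (insert l V) (P - {V})" "x \<in> W" for W x
    using that Pp'[of W x] V_le[of x] by fastforce
  have alt: "\<not> alternate U W" if UW: "U \<in> nc_join l v Q P" "W \<in> nc_join l v Q P" "U \<noteq> W" for U W
  proof -
    consider "U \<in> Q" "W \<in> Q" | "U \<in> Q" "W \<in> insert (insert l V) (P - {V})"
      | "W \<in> Q" "U \<in> insert (insert l V) (P - {V})"
      | "U \<in> insert (insert l V) (P - {V})" "W \<in> insert (insert l V) (P - {V})"
      using UW(1,2) unfolding join by blast
    then show ?thesis
    proof cases
      case 1
      then show ?thesis using Q UW(3) by (auto simp: nc_on_def)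
    next
      case 2
      then show ?thesis using Qsub[OF 2(1)] far[OF 2(2)] unfolding alternate_def
        by (metis leD order.strict_trans order_le_less_trans)
    next
      case 3
      then show ?thesis using Qsub[OF 3(1)] far[OF 3(2)] unfolding alternate_def
        by (metis leD order.strict_trans order_le_less_trans)
    next
      case 4
      then show ?thesis using V_alt UW(3) Pnc unfolding nc_on_def by blast
    qed
  qed
  have start: "W \<inter> E = {}" if "W \<in> nc_join l v Q P" "l \<in> W" for W
  proof -
    have "W = insert l V"
      using partition_on_same[OF part that(1), of "insert l V" l] that(2) by (auto simp: join)
    then show ?thesis using VE Ev by blast
  qed
  have "nc_join l v Q P \<in> nc_start n E l"
    using part alt start by (simp add: nc_start_def nc_on_def)
  moreover have "insert l V \<in> nc_join l v Q P" "insert l V \<inter> {l<..<v} = {}"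
    using V_le by (auto simp: join leD)
  ultimately show ?thesis
    by (intro CollectI conjI bexI[of _ "insert l V"]) (use V(2) in simp_all)
qed

text \<open>Since \<open>l\<close> and \<open>v\<close> are consecutive in one block, a block
  meeting the gap between them cannot leave it without crossing that block.\<close>

lemma nc_split_in:
  assumes E: "E \<subseteq> {..<l}" and v: "l < v" "v < n"
    and P: "P \<in> nc_start n E l" and V: "V \<in> P" "l \<in> V" "v \<in> V" "V \<inter> {l<..<v} = {}"
  shows "nc_gap l v P \<in> nc_on {Suc l..<v}" "nc_rest l v P \<in> nc_start n E v"
proof -
  have part: "partition_on ({l..<n} \<union> E) P" and nc: "P \<in> nc_on ({l..<n} \<union> E)"
    using P by (auto simp: nc_start_def nc_on_def)
  have VE: "V \<inter> E = {}" using P V by (auto simp: nc_start_def)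
  have in_gap: "W \<subseteq> {l<..<v}" if W: "W \<in> P" "x \<in> W" "l < x" "x < v" for W x
  proof
    fix y assume y: "y \<in> W"
    have WV: "W \<noteq> V" using W V by auto
    have "y \<noteq> l" "y \<noteq> v" using WV partition_on_same[OF part W(1) V(1)] y V by auto
    moreover have "\<not> v < y" using nc_on_alternate[OF nc V(1) W(1), of l x v y] W V y WV by auto
    moreover have "\<not> y < l" using nc_on_alternate[OF nc W(1) V(1), of y l x v] W V y WV by auto
    ultimately show "y \<in> {l<..<v}" by auto
  qed
  have "partition_on {Suc l..<v} {W \<in> P. W \<subseteq> {l<..<v}}"
  proof (rule partition_onI')
    fix x assume x: "x \<in> {Suc l..<v}"
    then have "x \<in> {l..<n} \<union> E" using v by auto
    then obtain W where W: "W \<in> P" "x \<in> W" using partition_on_ex[OF part] by blast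
    then have "W \<subseteq> {l<..<v}" using in_gap[of W x] x by auto
    then show "\<exists>W\<in>{W \<in> P. W \<subseteq> {l<..<v}}. x \<in> W" using W by blast
  next
    fix W assume "W \<in> {W \<in> P. W \<subseteq> {l<..<v}}"
    then show "W \<subseteq> {Suc l..<v}" "W \<noteq> {}" using part by (auto simp: partition_on_def Suc_le_eq)
  qed (use partition_on_same[OF part] in blast)
  then have Q: "{W \<in> P. W \<subseteq> {l<..<v}} \<in> nc_on {Suc l..<v}"
    using nc by (auto simp: nc_on_def)
  let ?R = "(\<lambda>W. W - {l}) ` {W \<in> P. \<not> W \<subseteq> {l<..<v}}"
  have notgap: "x \<in> E \<or> v \<le> x" if "W \<in> P" "\<not> W \<subseteq> {l<..<v}" "x \<in> W - {l}" for W x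
    using in_gap[OF that(1), of x] that partition_on_sub[OF part that(1)] by fastforce
  have Rpart: "partition_on ({v..<n} \<union> E) ?R"
  proof (rule partition_onI')
    fix W assume "W \<in> ?R"
    then obtain U where U: "U \<in> P" "\<not> U \<subseteq> {l<..<v}" "W = U - {l}" by blast
    show "W \<subseteq> {v..<n} \<union> E" using notgap[OF U(1,2)] partition_on_sub[OF part U(1)] U(3) by fastforce
    show "W \<noteq> {}"
    proof (cases "U = V")
      case False
      then have "l \<notin> U" using partition_on_same[OF part U(1) V(1)] V by blast
      then show ?thesis using U part by (auto simp: partition_on_def)
    qed (use U V v in auto)
  next
    fix x assume x: "x \<in> {v..<n} \<union> E"
    then have xl: "x \<in> {l..<n} \<union> E" "x \<noteq> l" "\<not> (l < x \<and> x < v)" using v E by auto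
    then obtain W where W: "W \<in> P" "x \<in> W" using partition_on_ex[OF part] by blast
    then have "W - {l} \<in> ?R" using xl by (intro imageI) auto
    then show "\<exists>W\<in>?R. x \<in> W" using W xl by blast
  next
    fix U W x assume "U \<in> ?R" "W \<in> ?R" "x \<in> U" "x \<in> W"
    then show "U = W" using partition_on_same[OF part] by auto
  qed
  have "\<not> alternate U W" if UW: "U \<in> ?R" "W \<in> ?R" "U \<noteq> W" for U W
  proof -
    obtain U' W' where *: "U' \<in> P" "W' \<in> P" "U = U' - {l}" "W = W' - {l}" using UW by blast
    then have "\<not> alternate U' W'" using UW(3) nc by (auto simp: nc_on_def)
    then show ?thesis using *(3,4) unfolding alternate_def by blast
  qed
  moreover have "W \<inter> E = {}" if W: "W \<in> ?R" "v \<in> W" for W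
  proof -
    from W(1) obtain U where U: "U \<in> P" "W = U - {l}" by blast
    then have "U = V" using partition_on_same[OF part U(1) V(1)] V W by blast
    then show ?thesis using VE U by blast
  qed
  ultimately have "?R \<in> nc_start n E v"
    using Rpart unfolding nc_start_def nc_on_def by blast
  with Q show "nc_gap l v P \<in> nc_on {Suc l..<v}" "nc_rest l v P \<in> nc_start n E v"
    by (simp_all add: nc_gap_def nc_rest_def)
qed

lemma nc_join_bij:
  assumes E: "E \<subseteq> {..<l}" and v: "l < v" "v < n"
  shows "bij_betw (\<lambda>(Q, P). nc_join l v Q P) (nc_on {Suc l..<v} \<times> nc_start n E v)
    {P \<in> nc_start n E l. \<exists>V\<in>P. l \<in> V \<and> v \<in> V \<and> V \<inter> {l<..<v} = {}}"
  by (rule bij_betw_byWitness[where f' = "\<lambda>P. (nc_gap l v P, nc_rest l v P)"])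
    (auto simp: nc_split_join[OF assms] nc_join_split[OF assms] nc_split_in[OF assms]
      dest: nc_join_in[OF assms])

text \<open>Case distinction on the second element \<open>v\<close> of the block of
  \<open>l\<close>, if there is one.\<close>

lemma nc_start_sum:
  fixes G :: "nat set set \<Rightarrow> complex"
  assumes E: "E \<subseteq> {..<l}" and l: "l < n"
  shows "(\<Sum>P\<in>nc_start n E l. G P) = (\<Sum>P\<in>nc_on ({Suc l..<n} \<union> E). G (insert {l} P)) +
    (\<Sum>v\<in>{Suc l..<n}. \<Sum>Q\<in>nc_on {Suc l..<v}. \<Sum>P\<in>nc_start n E v. G (nc_join l v Q P))"
proof -
  have finE: "finite E" using E by (rule finite_subset) simp
  have fin: "finite (nc_start n E l)" for l
    unfolding nc_start_def by (rule finite_subset[OF _ finite_nc_on[of "{l..<n} \<union> E"]]) (use finE in auto)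
  let ?B = "\<lambda>v. {P \<in> nc_start n E l. \<exists>V\<in>P. l \<in> V \<and> v \<in> V \<and> V \<inter> {l<..<v} = {}}"
  let ?A = "{P \<in> nc_start n E l. {l} \<in> P}"
  have split: "nc_start n E l = ?A \<union> (\<Union>v\<in>{Suc l..<n}. ?B v)"
  proof (intro equalityI subsetI)
    fix P assume P: "P \<in> nc_start n E l"
    then have part: "partition_on ({l..<n} \<union> E) P" by (auto simp: nc_start_def nc_on_def)
    have "l \<in> {l..<n} \<union> E" using l by auto
    then obtain V where V: "V \<in> P" "l \<in> V" using partition_on_ex[OF part] by blast
    then have Vs: "V \<subseteq> {l..<n}" using P partition_on_sub[OF part V(1)] by (auto simp: nc_start_def)
    show "P \<in> ?A \<union> (\<Union>v\<in>{Suc l..<n}. ?B v)"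
    proof (cases "V = {l}")
      case False
      define v where "v = Min (V - {l})"
      have finV: "finite V" using Vs finite_subset by blast
      have ne: "V - {l} \<noteq> {}" using False V by auto
      have v: "v \<in> V - {l}" unfolding v_def using finV ne by (intro Min_in) auto
      have min: "v \<le> x" if "x \<in> V" "x \<noteq> l" for x unfolding v_def using finV that by (intro Min_le) auto
      then have "V \<inter> {l<..<v} = {}" by fastforce
      moreover have "v \<in> {Suc l..<n}" using v Vs by force
      ultimately show ?thesis using P V v by blast
    qed (use P V in auto)
  qed auto
  have part: "partition_on ({l..<n} \<union> E) P" if "P \<in> nc_start n E l" for P
    using that by (auto simp: nc_start_def nc_on_def)
  have disj1: "?A \<inter> (\<Union>v\<in>{Suc l..<n}. ?B v) = {}"
  proof -
    have False if P: "P \<in> nc_start n E l" "{l} \<in> P" "V \<in> P" "l \<in> V" "v \<in> V" "v \<in> {Suc l..<n}" for P V v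
      using partition_on_same[OF part[OF P(1)] P(2,3)] P by auto
    then show ?thesis by blast
  qed
  have disj2: "?B v \<inter> ?B u = {}" if uv: "v \<in> {Suc l..<n}" "u \<in> {Suc l..<n}" "v \<noteq> u" for u v
  proof -
    have False if P: "P \<in> nc_start n E l" "V \<in> P" "l \<in> V" "v \<in> V" "V \<inter> {l<..<v} = {}"
      "W \<in> P" "l \<in> W" "u \<in> W" "W \<inter> {l<..<u} = {}" for P V W
    proof -
      have "V = W" using partition_on_same[OF part[OF P(1)]] P by blast
      then show False using P uv by (cases "u < v") force+
    qed
    then show ?thesis by blast
  qed
  have "sum G (nc_start n E l) = sum G ?A + sum G (\<Union>v\<in>{Suc l..<n}. ?B v)"
    by (subst split, rule sum.union_disjoint) (use fin disj1 in auto)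
  also have "sum G (\<Union>v\<in>{Suc l..<n}. ?B v) = (\<Sum>v\<in>{Suc l..<n}. sum G (?B v))"
    by (rule sum.UNION_disjoint) (use fin disj2 in auto)
  also have "sum G ?A = (\<Sum>P\<in>nc_on ({Suc l..<n} \<union> E). G (insert {l} P))"
    by (rule sum.reindex_bij_betw[OF nc_start_singleton[OF E l], symmetric])
  also have "(\<Sum>v\<in>{Suc l..<n}. sum G (?B v)) =
      (\<Sum>v\<in>{Suc l..<n}. \<Sum>Q\<in>nc_on {Suc l..<v}. \<Sum>P\<in>nc_start n E v. G (nc_join l v Q P))"
  proof (rule sum.cong[OF refl])
    fix v assume "v \<in> {Suc l..<n}"
    then have v: "l < v" "v < n" by auto
    show "sum G (?B v) = (\<Sum>Q\<in>nc_on {Suc l..<v}. \<Sum>P\<in>nc_start n E v. G (nc_join l v Q P))"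
      using sum.reindex_bij_betw[OF nc_join_bij[OF E v], of G]
      by (simp add: sum.cartesian_product case_prod_unfold)
  qed
  finally show ?thesis .
qed

section \<open>Sums over blocks\<close>

text \<open>\<open>inner_part\<close> collects the blocks in the finished gaps of \<open>V\<close>;
  \<open>outer_part\<close> collects those in the last gap, which lies beyond \<open>Max V\<close>
  and includes \<open>E\<close>.\<close>

definition inner_part :: "nat set set \<Rightarrow> nat set \<Rightarrow> nat \<Rightarrow> nat set set" where
  "inner_part P V l = {W \<in> P. W \<noteq> V \<and> (\<exists>x\<in>W. l < x \<and> x < Max V)}"

definition outer_part :: "nat set set \<Rightarrow> nat set \<Rightarrow> nat \<Rightarrow> nat set set" where
  "outer_part P V l = {W \<in> P. W \<noteq> V \<and> \<not> (\<exists>x\<in>W. l < x \<and> x < Max V)}"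

text \<open>\<open>T\<close> takes the whole family of blocks in the last gap, not one block at a
  time, since in the conditionally free formula a block's weight depends on which other blocks
  surround it.\<close>

definition block_weight ::
    "(nat set \<Rightarrow> complex) \<Rightarrow> (nat set \<Rightarrow> complex) \<Rightarrow> (nat set set \<Rightarrow> complex) \<Rightarrow>
      nat \<Rightarrow> nat set set \<Rightarrow> complex" where
  "block_weight F k T l P = F (block_at P l) *
     (\<Prod>W\<in>inner_part P (block_at P l) l. k W) * T (outer_part P (block_at P l) l)"

lemma nc_start_partition: "P \<in> nc_start n E l \<Longrightarrow> partition_on ({l..<n} \<union> E) P"
  by (simp add: nc_start_def nc_on_def)

lemma nc_start_block:
  assumes "P \<in> nc_start n E l" "E \<subseteq> {..<l}" "l < n"
  shows "block_at P l \<in> P" "l \<in> block_at P l" "block_at P l \<subseteq> {l..<n}"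
proof -
  note part = nc_start_partition[OF assms(1)]
  have "l \<in> {l..<n} \<union> E" using assms by auto
  then obtain V where V: "V \<in> P" "l \<in> V" using partition_on_ex[OF part] by blast
  then have eq: "block_at P l = V" by (rule block_at_eq[OF part])
  show "block_at P l \<in> P" "l \<in> block_at P l" using V eq by auto
  have "V \<inter> E = {}" using assms(1) V by (auto simp: nc_start_def)
  then show "block_at P l \<subseteq> {l..<n}" using partition_on_sub[OF part V(1)] eq by auto
qed

lemma block_weight_singleton:
  assumes "P \<in> nc_on ({Suc l..<n} \<union> E)" "E \<subseteq> {..<l}" "l < n"
  shows "block_weight F k T l (insert {l} P) = F {l} * T P"
proof -
  have "insert {l} P \<in> nc_start n E l"
    using nc_start_singleton[OF assms(2,3)] assms(1) by (auto simp: bij_betw_def)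
  then have part: "partition_on ({l..<n} \<union> E) (insert {l} P)" by (rule nc_start_partition)
  have V: "block_at (insert {l} P) l = {l}"
    by (rule block_at_eq[OF part]) auto
  have "{l} \<notin> P"
    using nc_on_sub[OF assms(1)] assms(2) by fastforce
  then have "inner_part (insert {l} P) {l} l = {}" "outer_part (insert {l} P) {l} l = P"
    by (auto simp: inner_part_def outer_part_def)
  then show ?thesis by (simp add: block_weight_def V)
qed

text \<open>Putting \<open>l\<close> in front of a block leaves its maximum unchanged, so the last
  gap stays the same and the finished gaps gain exactly \<open>Q\<close>.\<close>

lemma block_weight_join:
  assumes Q: "Q \<in> nc_on {Suc l..<v}" and P: "P \<in> nc_start n E v"
    and E: "E \<subseteq> {..<l}" and v: "l < v" "v < n"
  shows "block_weight F k T l (nc_join l v Q P) =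
    (\<Prod>W\<in>Q. k W) * block_weight (\<lambda>V. F (insert l V)) k T v P"
proof -
  have Ev: "E \<subseteq> {..<v}" using E v by auto
  define V where "V = block_at P v"
  note Pp = nc_start_partition[OF P]
  have V: "V \<in> P" "v \<in> V" "V \<subseteq> {v..<n}"
    using nc_start_block[OF P Ev v(2)] by (auto simp: V_def)
  have finV: "finite V" using V(3) finite_subset by blast
  have join: "nc_join l v Q P = Q \<union> insert (insert l V) (P - {V})"
    by (rule nc_join_eq[OF Pp V(1,2)])
  have "nc_join l v Q P \<in> nc_start n E l"
    using nc_join_bij[OF E v] Q P by (fastforce simp: bij_betw_def)
  then have "partition_on ({l..<n} \<union> E) (nc_join l v Q P)" by (rule nc_start_partition)
  then have block: "block_at (nc_join l v Q P) l = insert l V"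
    by (rule block_at_eq) (auto simp: join)
  have "v \<le> Max V" using V finV by (intro Max_ge) auto
  then have "l \<le> Max V" using v by linarith
  moreover have "Max (insert l V) = max l (Max V)" by (rule Max_insert) (use finV V in auto)
  ultimately have Max: "Max (insert l V) = Max V" by linarith
  have Qsub: "W \<subseteq> {l<..<v}" if "W \<in> Q" for W
    using nc_on_sub[OF Q that] by auto
  have Qne: "\<exists>x. x \<in> W" if "W \<in> Q" for W
    by (rule partition_on_nonempty[OF nc_on_partition[OF Q] that])
  have Psub: "x < l \<or> v \<le> x" if "W \<in> P" "x \<in> W" for W x
    using partition_on_sub[OF Pp that(1)] that(2) E by fastforce
  have Pl: "l \<notin> W" if "W \<in> P" for W using Psub[OF that, of l] v by auto
  have Pv: "v \<notin> W" if "W \<in> P" "W \<noteq> V" for W using partition_on_same[OF Pp that(1) V(1)] that V by blast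
  have P_iff: "(\<exists>x\<in>W. l < x \<and> x < Max V) \<longleftrightarrow> (\<exists>x\<in>W. v < x \<and> x < Max V)" if "W \<in> P" "W \<noteq> V" for W
    using Psub[OF that(1)] Pv[OF that] v by (metis le_neq_implies_less less_trans not_less_iff_gr_or_eq)
  have Q_in: "\<exists>x\<in>W. l < x \<and> x < Max V" if "W \<in> Q" for W
    using Qsub[OF that] Qne[OF that] \<open>v \<le> Max V\<close> by fastforce
  have QV: "W \<noteq> insert l V" if "W \<in> Q" for W using Qsub[OF that] by auto
  have QP: "W \<notin> Q" if "W \<in> P" for W
    using Qsub[of W] Psub[OF that] partition_on_nonempty[OF Pp that] by fastforce
  have inner: "inner_part (nc_join l v Q P) (insert l V) l = Q \<union> inner_part P V v"
  proof (intro set_eqI iffI)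
    fix W assume "W \<in> inner_part (nc_join l v Q P) (insert l V) l"
    then show "W \<in> Q \<union> inner_part P V v"
      using P_iff[of W] unfolding inner_part_def join Max by blast
  next
    fix W assume "W \<in> Q \<union> inner_part P V v"
    then show "W \<in> inner_part (nc_join l v Q P) (insert l V) l"
      using P_iff[of W] Q_in[of W] QV[of W] Pl[of W] unfolding inner_part_def join Max by blast
  qed
  have outer: "outer_part (nc_join l v Q P) (insert l V) l = outer_part P V v"
  proof (intro set_eqI iffI)
    fix W assume "W \<in> outer_part (nc_join l v Q P) (insert l V) l"
    then show "W \<in> outer_part P V v"
      using P_iff[of W] Q_in[of W] unfolding outer_part_def join Max by blast
  next
    fix W assume "W \<in> outer_part P V v"
    then show "W \<in> outer_part (nc_join l v Q P) (insert l V) l"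
      using P_iff[of W] Pl[of W] unfolding outer_part_def join Max by blast
  qed
  have "finite Q" using Q finite_elements[OF _ nc_on_partition[OF Q]] by simp
  moreover have "finite P" using finite_elements[OF _ Pp] finite_subset[OF E] by simp
  ultimately have "(\<Prod>W\<in>Q \<union> inner_part P V v. k W) = (\<Prod>W\<in>Q. k W) * (\<Prod>W\<in>inner_part P V v. k W)"
    using QP by (intro prod.union_disjoint) (auto simp: inner_part_def)
  then show ?thesis
    by (simp add: block_weight_def block inner outer V_def[symmetric] mult_ac)
qed

lemma block_weight_sum:
  assumes "E \<subseteq> {..<l}" "l < n"
  shows "(\<Sum>P\<in>nc_start n E l. block_weight F k T l P) =
    F {l} * (\<Sum>P\<in>nc_on ({Suc l..<n} \<union> E). T P) +
    (\<Sum>v\<in>{Suc l..<n}. (\<Sum>Q\<in>nc_on {Suc l..<v}. \<Prod>W\<in>Q. k W) *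
       (\<Sum>P\<in>nc_start n E v. block_weight (\<lambda>V. F (insert l V)) k T v P))"
  unfolding nc_start_sum[OF assms] sum_distrib_left sum_distrib_right
proof (intro arg_cong2[of _ _ _ _ "(+)"] sum.cong[OF refl], goal_cases)
  case (1 P)
  then show ?case using assms by (rule block_weight_singleton)
next
  case (2 v)
  then have v: "l < v" "v < n" by auto
  show ?case
    by (subst sum.swap) (intro sum.cong refl block_weight_join; use assms v in simp)
qed

text \<open>
  A sum over the subsets \<open>V\<close> of the positions of a word: \<open>c\<close> collects the letters in \<open>V\<close>, \<open>g\<close> is the
  product of the current gap, each finished gap contributes a factor \<open>\<psi> g\<close>, and \<open>K\<close> evaluates
  the chosen letters together with the last gap.
\<close>

fun scan :: "('a::monoid_mult \<Rightarrow> complex) \<Rightarrow> ('b \<Rightarrow> 'a) \<Rightarrow> ('b list \<Rightarrow> 'a \<Rightarrow> complex) \<Rightarrow>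
    'b list \<Rightarrow> 'a \<Rightarrow> 'b list \<Rightarrow> complex" where
  "scan \<psi> e K c g [] = K c g"
| "scan \<psi> e K c g (x # w) = scan \<psi> e K c (g * e x) w + \<psi> g * scan \<psi> e K (c @ [x]) 1 w"

text \<open>Sorting by the next letter picked, or none, gives the recursion of
  \<open>block_weight_sum\<close>, where \<open>v\<close> is the next element of the block.\<close>

lemma scan_unroll:
  "scan \<psi> e K c g w = K c (g * prod_list (map e w)) +
    (\<Sum>v<length w. \<psi> (g * prod_list (map e (take v w))) *
       scan \<psi> e K (c @ [w ! v]) 1 (drop (Suc v) w))"
proof (induction w arbitrary: g)
  case (Cons x w)
  show ?case
    unfolding scan.simps Cons[of "g * e x"] length_Cons
    by (subst sum.lessThan_Suc_shift) (simp add: mult.assoc)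
qed simp

lemma nths_eq_map: "nths w V = map ((!) w) (filter (\<lambda>i. i \<in> V) [0..<length w])"
proof -
  have "zip w [0..<length w] = map (\<lambda>i. (w ! i, i)) [0..<length w]"
    by (rule nth_equalityI) auto
  then show ?thesis by (simp add: nths_def filter_map o_def)
qed

lemma nths_insert:
  assumes "V \<subseteq> {l<..}" "l < length w"
  shows "nths w (insert l V) = w ! l # nths w V"
proof -
  have split: "[0..<length w] = [0..<l] @ l # [Suc l..<length w]"
    using assms(2) by (metis less_imp_add_positive upt_add_eq_append upt_conv_Cons zero_le le_add1)
  have 1: "filter (\<lambda>i. i \<in> insert l V) [0..<l] = []" "filter (\<lambda>i. i \<in> V) [0..<l] = []"
    using assms(1) by (auto simp: filter_empty_conv)
  have 2: "filter (\<lambda>i. i \<in> insert l V) [Suc l..<length w] = filter (\<lambda>i. i \<in> V) [Suc l..<length w]"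
    by (rule filter_cong) auto
  have 3: "l \<notin> V" using assms(1) by auto
  show ?thesis unfolding nths_eq_map split filter_append 1 using 2 3 by simp
qed

text \<open>The accumulator \<open>c\<close> holds the letters of the block found before
  \<open>l\<close>. Hypotheses \<open>k\<close> and \<open>T\<close> say that the partitions of a
  finished gap, respectively of the last gap, sum to a moment.\<close>

lemma block_weight_scan:
  assumes w: "length w = n" and E: "E \<subseteq> {..<l}" and l: "l < n"
    and k: "\<And>a b. l < a \<Longrightarrow> a \<le> b \<Longrightarrow> b \<le> n \<Longrightarrow>
      (\<Sum>Q\<in>nc_on {a..<b}. \<Prod>W\<in>Q. k W) = \<psi> (prod_list (map e (take (b - a) (drop a w))))"
    and T: "\<And>m. l < m \<Longrightarrow> m \<le> n \<Longrightarrow>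
      (\<Sum>P\<in>nc_on ({m..<n} \<union> E). T P) = \<tau> (prod_list (map e (drop m w)))"
    and F: "\<And>V. V \<subseteq> {l..<n} \<Longrightarrow> l \<in> V \<Longrightarrow> F V = f (c @ nths w V)"
  shows "(\<Sum>P\<in>nc_start n E l. block_weight F k T l P) =
    scan \<psi> e (\<lambda>c g. f c * \<tau> g) (c @ [w ! l]) 1 (drop (Suc l) w)"
  using E l k T F
proof (induction "n - l" arbitrary: l F c rule: less_induct)
  case less
  have "F {l} = f (c @ [w ! l])"
    using less.prems(5)[of "{l}"] nths_insert[of "{}" l w] less.prems(2) w by simp
  moreover have "(\<Sum>P\<in>nc_start n E v. block_weight (\<lambda>V. F (insert l V)) k T v P) =
      scan \<psi> e (\<lambda>c g. f c * \<tau> g) ((c @ [w ! l]) @ [w ! v]) 1 (drop (Suc v) w)"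
    if v: "v \<in> {Suc l..<n}" for v
  proof (rule less.hyps)
    fix V assume V: "V \<subseteq> {v..<n}" "v \<in> V"
    have "insert l V \<subseteq> {l..<n}" using V v by auto
    moreover have "V \<subseteq> {l<..}" using V v by auto
    ultimately show "F (insert l V) = f ((c @ [w ! l]) @ nths w V)"
      using less.prems(5)[of "insert l V"] nths_insert[of V l w] less.prems(2) w by simp
  qed (use v less.prems in auto)
  moreover have "(\<Sum>P\<in>nc_on ({Suc l..<n} \<union> E). T P) = \<tau> (prod_list (map e (drop (Suc l) w)))"
    using less.prems(4)[of "Suc l"] less.prems(2) by simp
  moreover have "(\<Sum>Q\<in>nc_on {Suc l..<v}. \<Prod>W\<in>Q. k W) =
      \<psi> (prod_list (map e (take (v - Suc l) (drop (Suc l) w))))" if "v \<in> {Suc l..<n}" for v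
    using less.prems(3)[of "Suc l" v] that by simp
  ultimately have "(\<Sum>P\<in>nc_start n E l. block_weight F k T l P) =
      f (c @ [w ! l]) * \<tau> (prod_list (map e (drop (Suc l) w))) +
      (\<Sum>v\<in>{Suc l..<n}. \<psi> (prod_list (map e (take (v - Suc l) (drop (Suc l) w)))) *
         scan \<psi> e (\<lambda>c g. f c * \<tau> g) ((c @ [w ! l]) @ [w ! v]) 1 (drop (Suc v) w))"
    unfolding block_weight_sum[OF less.prems(1,2)]
    by (intro arg_cong2[of _ _ _ _ "(+)"] sum.cong arg_cong2[of _ _ _ _ "(*)"] refl) simp_all
  also have "(\<Sum>v\<in>{Suc l..<n}. H v) = (\<Sum>v<n - Suc l. H (Suc l + v))" for H :: "nat \<Rightarrow> complex"
    using sum.shift_bounds_nat_ivl[of H 0 "Suc l" "n - Suc l"] less.prems(2)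
    by (simp add: atLeast0LessThan add.commute)
  also have "f (c @ [w ! l]) * \<tau> (prod_list (map e (drop (Suc l) w))) +
      (\<Sum>v<n - Suc l. \<psi> (prod_list (map e (take (Suc l + v - Suc l) (drop (Suc l) w)))) *
         scan \<psi> e (\<lambda>c g. f c * \<tau> g) ((c @ [w ! l]) @ [w ! (Suc l + v)]) 1 (drop (Suc (Suc l + v)) w)) =
      scan \<psi> e (\<lambda>c g. f c * \<tau> g) (c @ [w ! l]) 1 (drop (Suc l) w)"
    by (subst scan_unroll) (simp add: w less.prems(2) Suc_le_eq add.commute)
  finally show ?case .
qed

section \<open>Moments as sums over blocks\<close>

text \<open>The four points are met in this order on the circle: one disjunct for each possible
  smallest point.\<close>

definition cyclic_less :: "nat \<Rightarrow> nat \<Rightarrow> nat \<Rightarrow> nat \<Rightarrow> bool" where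
  "cyclic_less i j k l \<longleftrightarrow> i < j \<and> j < k \<and> k < l \<or> j < k \<and> k < l \<and> l < i \<or>
    k < l \<and> l < i \<and> i < j \<or> l < i \<and> i < j \<and> j < k"

text \<open>Rotating the crossing pattern V, W, V, W yields the same pattern or W, V, W, V.
  Preserving the cyclic order is therefore enough.\<close>

lemma nc_on_image:
  assumes P: "P \<in> nc_on X" and inj: "inj_on f X"
    and cyc: "\<And>i j k l. i \<in> X \<Longrightarrow> j \<in> X \<Longrightarrow> k \<in> X \<Longrightarrow> l \<in> X \<Longrightarrow>
      f i < f j \<Longrightarrow> f j < f k \<Longrightarrow> f k < f l \<Longrightarrow> cyclic_less i j k l"
  shows "(`) f ` P \<in> nc_on (f ` X)"
proof -
  note part = nc_on_partition[OF P]
  have "partition_on (f ` X) ((`) f ` P - {{}})"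
    by (rule partition_on_inj_image[OF part inj])
  moreover have "{} \<notin> (`) f ` P" using part by (auto simp: partition_on_def)
  ultimately have 1: "partition_on (f ` X) ((`) f ` P)" by simp
  have 2: "\<not> alternate (f ` V) (f ` W)" if VW: "V \<in> P" "W \<in> P" "V \<noteq> W" for V W
  proof
    assume "alternate (f ` V) (f ` W)"
    then obtain i j k l where *: "i \<in> V" "j \<in> W" "k \<in> V" "l \<in> W" "f i < f j" "f j < f k" "f k < f l"
      unfolding alternate_def by blast
    then have X: "i \<in> X" "j \<in> X" "k \<in> X" "l \<in> X" using partition_on_sub[OF part] VW by blast+
    have "alternate V W \<or> alternate W V"
      using cyc[OF X *(5-7), unfolded cyclic_less_def] *(1-4) alternateI by metis
    then show False using nc_on_not_alternate[OF P] VW by metis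
  qed
  show ?thesis
    unfolding nc_on_def using 1 2 by auto
qed

lemma nc_on_image_inverse:
  assumes "P \<in> nc_on X" "\<And>x. x \<in> X \<Longrightarrow> g (f x) = x"
  shows "(`) g ` (`) f ` P = P"
proof -
  have "g ` f ` V = V" if "V \<in> P" for V
  proof -
    have "V \<subseteq> X" by (rule nc_on_sub[OF assms(1) that])
    then have "(\<lambda>x. g (f x)) ` V = (\<lambda>x. x) ` V" by (intro image_cong refl) (use assms(2) in auto)
    then show ?thesis by (simp add: image_image)
  qed
  then have "(\<lambda>V. g ` f ` V) ` P = (\<lambda>V. V) ` P" by (intro image_cong refl)
  then show ?thesis by (simp add: image_image)
qed

lemma nc_on_sum_image:
  fixes H :: "nat set set \<Rightarrow> complex"
  assumes bij: "bij_betw f X Y"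
    and cyc: "\<And>i j k l. i \<in> X \<Longrightarrow> j \<in> X \<Longrightarrow> k \<in> X \<Longrightarrow> l \<in> X \<Longrightarrow>
      f i < f j \<Longrightarrow> f j < f k \<Longrightarrow> f k < f l \<Longrightarrow> cyclic_less i j k l"
    and cyc': "\<And>i j k l. i \<in> X \<Longrightarrow> j \<in> X \<Longrightarrow> k \<in> X \<Longrightarrow> l \<in> X \<Longrightarrow>
      i < j \<Longrightarrow> j < k \<Longrightarrow> k < l \<Longrightarrow> cyclic_less (f i) (f j) (f k) (f l)"
  shows "(\<Sum>P\<in>nc_on Y. H P) = (\<Sum>P\<in>nc_on X. H ((`) f ` P))"
proof -
  define g where "g = the_inv_into X f"
  have inj: "inj_on f X" and Y: "Y = f ` X" using bij by (auto simp: bij_betw_def)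
  have gf: "g (f x) = x" if "x \<in> X" for x using inj that by (simp add: g_def the_inv_into_f_f)
  have inj_g: "inj_on g Y" using gf by (auto simp: Y inj_on_def)
  have gY: "g ` Y = X" using gf by (force simp: Y)
  have fg: "f (g y) = y" if "y \<in> Y" for y using that gf by (auto simp: Y)
  have "bij_betw ((`) ((`) f)) (nc_on X) (nc_on Y)"
  proof (rule bij_betw_byWitness[where f' = "(`) ((`) g)"])
    show "(`) ((`) f) ` nc_on X \<subseteq> nc_on Y"
      unfolding Y using nc_on_image[OF _ inj] cyc by blast
    have "(`) g ` P \<in> nc_on (g ` Y)" if "P \<in> nc_on Y" for P
    proof (rule nc_on_image[OF that inj_g])
      fix i j k l assume "i \<in> Y" "j \<in> Y" "k \<in> Y" "l \<in> Y" and *: "g i < g j" "g j < g k" "g k < g l"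
      then obtain a b c d where "a \<in> X" "b \<in> X" "c \<in> X" "d \<in> X" "i = f a" "j = f b" "k = f c" "l = f d"
        unfolding Y by blast
      then show "cyclic_less i j k l"
        using cyc'[of a b c d] * gf by simp
    qed
    then show "(`) ((`) g) ` nc_on Y \<subseteq> nc_on X" unfolding gY by blast
  qed (use nc_on_image_inverse[of _ _ g f] nc_on_image_inverse[of _ _ f g] gf fg in auto)
  from sum.reindex_bij_betw[OF this, of H] show ?thesis by simp
qed

text \<open>
  The order-preserving (for \<open>q = 0\<close>) or rotating renumbering of the positions in the arc
  \<open>m, \<dots>, n - 1, 0, \<dots>, q - 1\<close>.
\<close>

definition wrap :: "nat \<Rightarrow> nat \<Rightarrow> nat \<Rightarrow> nat" where
  "wrap n m i = (if i < n - m then i + m else i - (n - m))"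

lemma bij_wrap:
  assumes "q \<le> m" "m \<le> n"
  shows "bij_betw (wrap n m) {..<n - m + q} ({m..<n} \<union> {..<q})"
  by (rule bij_betw_byWitness[where f' = "\<lambda>j. if m \<le> j then j - m else j + (n - m)"])
    (use assms in \<open>auto simp: wrap_def\<close>)

lemma wrap_sum:
  fixes H :: "nat set set \<Rightarrow> complex"
  assumes "q \<le> m" "m \<le> n"
  shows "(\<Sum>P\<in>nc_on ({m..<n} \<union> {..<q}). H P) = (\<Sum>P\<in>nc_on {..<n - m + q}. H ((`) (wrap n m) ` P))"
proof (rule nc_on_sum_image[OF bij_wrap[OF assms]], goal_cases)
  \<comment> \<open>\<open>wrap\<close> is increasing on each of the two pieces of its domain and
    sends the second piece below the first.\<close>
  have lt: "x < n - m \<Longrightarrow> y < n - m \<Longrightarrow> wrap n m x < wrap n m y \<longleftrightarrow> x < y"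
    "\<not> x < n - m \<Longrightarrow> \<not> y < n - m \<Longrightarrow> wrap n m x < wrap n m y \<longleftrightarrow> x < y"
    "x < n - m \<Longrightarrow> \<not> y < n - m \<Longrightarrow> x < y \<and> \<not> wrap n m x < wrap n m y"
    "x < n - m \<Longrightarrow> \<not> y < n - m \<Longrightarrow> \<not> y < x \<and> wrap n m y < wrap n m x"
    if "x \<in> {..<n - m + q}" "y \<in> {..<n - m + q}" for x y
    using that assms by (auto simp: wrap_def)
  {
    case (1 i j k l)
    note p = lt[OF 1(1,2)] lt[OF 1(2,3)] lt[OF 1(3,4)] lt[OF 1(4,1)] lt[OF 1(2,1)] lt[OF 1(3,2)] lt[OF 1(4,3)] lt[OF 1(1,4)]
    from 1(5-7) show ?case
      by (cases "i < n - m"; cases "j < n - m"; cases "k < n - m"; cases "l < n - m"; simp add: p cyclic_less_def)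
  next
    case (2 i j k l)
    note p = lt[OF 2(1,2)] lt[OF 2(2,3)] lt[OF 2(3,4)] lt[OF 2(4,1)] lt[OF 2(2,1)] lt[OF 2(3,2)] lt[OF 2(4,3)] lt[OF 2(1,4)]
    from 2(5-7) show ?case
      by (cases "i < n - m"; cases "j < n - m"; cases "k < n - m"; cases "l < n - m"; simp add: p cyclic_less_def)
  }
qed

text \<open>Letters are read clockwise from position \<open>q\<close>, continuing past the end of
  the word into the positions below \<open>q\<close>.\<close>

definition nths_wrap :: "'b list \<Rightarrow> nat \<Rightarrow> nat set \<Rightarrow> 'b list" where
  "nths_wrap w q W = nths w {x \<in> W. q \<le> x} @ nths w {x \<in> W. x < q}"

lemma nths_take_subset:
  assumes "V \<subseteq> {..<k}"
  shows "nths (take k w) V = nths w V"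
proof (cases "k \<le> length w")
  case True
  have "nths w V = nths (take k w @ drop k w) V" by simp
  also have "\<dots> = nths (take k w) V @ nths (drop k w) {j. j + length (take k w) \<in> V}"
    by (rule nths_append)
  also have "{j. j + length (take k w) \<in> V} = {}" using assms True by auto
  finally show ?thesis by simp
qed simp

lemma nths_wrap_image:
  assumes "q \<le> m" "m \<le> n" "n \<le> length w" "V \<subseteq> {..<n - m + q}"
  shows "nths_wrap w q (wrap n m ` V) = nths (drop m (take n w) @ take q w) V"
proof -
  have 1: "{x \<in> wrap n m ` V. q \<le> x} = (+) m ` {i \<in> V. i < n - m}"
    using assms by (auto simp: wrap_def image_iff add.commute split: if_splits)
  have 2: "{x \<in> wrap n m ` V. x < q} = {i. i + (n - m) \<in> V}"
  proof (intro set_eqI iffI)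
    fix x assume "x \<in> {i. i + (n - m) \<in> V}"
    then show "x \<in> {x \<in> wrap n m ` V. x < q}"
      using assms by (auto simp: wrap_def image_iff intro!: bexI[of _ "x + (n - m)"])
  qed (use assms in \<open>auto simp: wrap_def split: if_splits\<close>)
  have len: "length (drop m (take n w)) = n - m" using assms by simp
  have "nths w ((+) m ` {i \<in> V. i < n - m}) = nths (drop m w) {i \<in> V. i < n - m}"
    by (simp add: nths_drop)
  also have "\<dots> = nths (take (n - m) (drop m w)) {i \<in> V. i < n - m}"
    by (rule nths_take_subset[symmetric]) auto
  also have "take (n - m) (drop m w) = drop m (take n w)" by (simp add: drop_take)
  also have "nths (drop m (take n w)) {i \<in> V. i < n - m} = nths (drop m (take n w)) V"
    unfolding nths_eq_map len by (intro arg_cong[where f = "map _"] filter_cong) auto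
  finally have 3: "nths w {x \<in> wrap n m ` V. q \<le> x} = nths (drop m (take n w)) V" using 1 by simp
  have "{i. i + (n - m) \<in> V} \<subseteq> {..<q}" using assms by auto
  then have 4: "nths w {x \<in> wrap n m ` V. x < q} = nths (take q w) {i. i + (n - m) \<in> V}"
    unfolding 2 by (simp add: nths_take_subset)
  show ?thesis unfolding nths_wrap_def 3 4 nths_append len ..
qed

lemma prod_image_wrap:
  fixes h :: "nat set \<Rightarrow> complex"
  assumes "q \<le> m" "m \<le> n" "P \<in> nc_on {..<n - m + q}"
  shows "(\<Prod>W\<in>(`) (wrap n m) ` P. h W) = (\<Prod>V\<in>P. h (wrap n m ` V))"
proof -
  have "inj_on (wrap n m) (\<Union>P)"
    using bij_wrap[OF assms(1,2)] nc_on_sub[OF assms(3)]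
    by (meson bij_betw_imp_inj_on inj_on_subset Sup_least)
  then have "inj_on ((`) (wrap n m)) P" by (rule inj_on_image)
  then show ?thesis by (simp add: prod.reindex)
qed

section \<open>Moments of arcs, and the expansion along the block of the first letter\<close>

lemma free_moment_nc:
  assumes "\<psi> 1 = 1"
  shows "\<psi> (prod_list as) = (\<Sum>P\<in>nc_on {..<length as}. \<Prod>V\<in>P. free_cumulant \<psi> (nths as V))"
  using free_moment_cumulant[of as \<psi>] assms
  by (cases "as = []") (simp_all add: noncrossing_partitions_eq)

lemma free_wrap_sum:
  assumes "\<psi> 1 = 1" "q \<le> m" "m \<le> n" "n \<le> length as"
  shows "(\<Sum>P\<in>nc_on ({m..<n} \<union> {..<q}). \<Prod>W\<in>P. free_cumulant \<psi> (nths_wrap as q W)) =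
    \<psi> (prod_list (drop m (take n as) @ take q as))"
proof -
  have len: "length (drop m (take n as) @ take q as) = n - m + q" using assms by simp
  show ?thesis
    unfolding wrap_sum[OF assms(2,3)] free_moment_nc[of \<psi>, OF assms(1)] len
  proof (intro sum.cong refl)
    fix P assume P: "P \<in> nc_on {..<n - m + q}"
    show "(\<Prod>W\<in>(`) (wrap n m) ` P. free_cumulant \<psi> (nths_wrap as q W)) =
        (\<Prod>V\<in>P. free_cumulant \<psi> (nths (drop m (take n as) @ take q as) V))"
      unfolding prod_image_wrap[OF assms(2,3) P]
      by (intro prod.cong refl arg_cong[where f = "free_cumulant \<psi>"] nths_wrap_image assms
          nc_on_sub[OF P])
  qed
qed

lemma free_segment_sum:
  assumes "\<psi> 1 = 1" "a \<le> b" "b \<le> length as"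
  shows "(\<Sum>Q\<in>nc_on {a..<b}. \<Prod>W\<in>Q. free_cumulant \<psi> (nths as W)) =
    \<psi> (prod_list (take (b - a) (drop a as)))"
  using free_wrap_sum[of \<psi> 0 a b as, OF assms(1) le0 assms(2,3)] by (simp add: nths_wrap_def drop_take)

lemma nc_start_0: "0 < n \<Longrightarrow> nc_start n {} 0 = nc_on {..<n}"
  by (auto simp: nc_start_def atLeast0LessThan)

definition cfree_weight ::
    "('a::monoid_mult \<Rightarrow> complex) \<Rightarrow> ('a \<Rightarrow> complex) \<Rightarrow> 'a list \<Rightarrow> nat set set \<Rightarrow> complex" where
  "cfree_weight \<phi> \<psi> as P =
    (\<Prod>V \<in> {V\<in>P. \<not> inner_block P V}. cfree_cumulant \<phi> \<psi> (nths as V)) *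
    (\<Prod>V \<in> {V\<in>P. inner_block P V}. free_cumulant \<psi> (nths as V))"

lemma cfree_moment_nc:
  assumes "\<phi> 1 = 1"
  shows "\<phi> (prod_list as) = (\<Sum>P\<in>nc_on {..<length as}. cfree_weight \<phi> \<psi> as P)"
  using cfree_moment_cumulant[of as \<phi> \<psi>] assms
  by (cases "as = []") (simp_all add: noncrossing_partitions_eq cfree_weight_def)

lemma wrap_0_image:
  assumes "m \<le> n" "P \<in> nc_on {..<n - m}" "V \<in> P"
  shows "wrap n m ` V = (+) m ` V"
  using nc_on_sub[OF assms(2) assms(3)]
  by (intro image_cong refl) (auto simp: wrap_def)

lemma inner_block_shift:
  "inner_block ((`) ((+) m) ` P) ((+) m ` V) \<longleftrightarrow> inner_block P V" for m :: nat
proof -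
  have inj: "(+) m ` W = (+) m ` V \<longleftrightarrow> W = V" for W V :: "nat set"
    by (rule inj_image_eq_iff) simp
  show ?thesis unfolding inner_block_def by (simp add: inj)
qed

lemma cfree_segment_sum:
  assumes "\<phi> 1 = 1" "m \<le> length as"
  shows "(\<Sum>P\<in>nc_on {m..<length as}. cfree_weight \<phi> \<psi> as P) = \<phi> (prod_list (drop m as))"
proof -
  define n where "n = length as"
  have m: "m \<le> n" using assms by (simp add: n_def)
  have "(\<Sum>P\<in>nc_on {m..<n}. cfree_weight \<phi> \<psi> as P) =
      (\<Sum>P\<in>nc_on {..<n - m}. cfree_weight \<phi> \<psi> as ((`) (wrap n m) ` P))"
    using wrap_sum[OF le0 m, of "cfree_weight \<phi> \<psi> as"] by simp
  also have "\<dots> = (\<Sum>P\<in>nc_on {..<n - m}. cfree_weight \<phi> \<psi> (drop m as) P)"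
  proof (intro sum.cong refl)
    fix P assume P: "P \<in> nc_on {..<n - m}"
    have im: "(`) (wrap n m) ` P = (`) ((+) m) ` P"
      by (intro image_cong refl wrap_0_image[OF m P])
    have inj: "inj_on ((`) ((+) m)) Q" for Q :: "nat set set"
      by (simp add: inj_on_def inj_image_eq_iff)
    have sets: "{V \<in> (`) ((+) m) ` P. \<not> inner_block ((`) ((+) m) ` P) V} =
        (`) ((+) m) ` {V \<in> P. \<not> inner_block P V}"
      "{V \<in> (`) ((+) m) ` P. inner_block ((`) ((+) m) ` P) V} =
        (`) ((+) m) ` {V \<in> P. inner_block P V}"
      by (auto simp: inner_block_shift)
    show "cfree_weight \<phi> \<psi> as ((`) (wrap n m) ` P) = cfree_weight \<phi> \<psi> (drop m as) P"
      unfolding im cfree_weight_def sets prod.reindex[OF inj] by (simp add: nths_drop)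
  qed
  also have "\<dots> = \<phi> (prod_list (drop m as))"
    by (subst cfree_moment_nc[of \<phi> _ \<psi>, OF assms(1)]) (simp add: n_def)
  finally show ?thesis by (simp add: n_def)
qed

text \<open>The block of position 0 is outer. Blocks in its finished gaps are enclosed by it, hence
  inner; those in its last gap are weighted as if the gap were the whole word.\<close>

lemma cfree_scan:
  assumes "\<psi> 1 = 1" "\<phi> 1 = 1"
  shows "\<phi> (prod_list (map e (x # w))) =
    scan \<psi> e (\<lambda>c g. cfree_cumulant \<phi> \<psi> (map e c) * \<phi> g) [x] 1 w"
proof -
  define as where "as = map e (x # w)"
  define n where "n = length (x # w)"
  have len: "length as = n" and n: "0 < n" by (simp_all add: as_def n_def)
  have "cfree_weight \<phi> \<psi> as P = block_weight (\<lambda>V. cfree_cumulant \<phi> \<psi> (nths as V))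
      (\<lambda>W. free_cumulant \<psi> (nths as W)) (cfree_weight \<phi> \<psi> as) 0 P" if P: "P \<in> nc_on {..<n}" for P
  proof -
    define V where "V = block_at P 0"
    have P': "P \<in> nc_start n {} 0" using P n by (simp add: nc_start_0)
    have V: "V \<in> P" "0 \<in> V" "V \<subseteq> {..<n}"
      using nc_start_block[OF P' _ n] by (auto simp: V_def atLeast0LessThan)
    note part = nc_on_partition[OF P]
    have fin: "finite V" "finite P"
      using V(3) finite_subset finite_elements[OF _ part] by auto
    have Max: "Max V \<in> V" using fin V by (intro Max_in) auto
    have in_gap: "0 < y" "y < Max V" if W: "W \<in> inner_part P V 0" and y: "y \<in> W" for W y
    proof -
      obtain x where x: "x \<in> W" "0 < x" "x < Max V" and WP: "W \<in> P" "W \<noteq> V"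
        using W unfolding inner_part_def by blast
      have ne: "y \<noteq> 0" "y \<noteq> Max V" using partition_on_same[OF part WP(1) V(1)] WP V Max y by metis+
      moreover have "\<not> Max V < y"
        using nc_on_alternate[OF P V(1) WP(1) V(2) x(1) Max y x(2,3)] WP by blast
      ultimately show "0 < y" "y < Max V" by auto
    qed
    have out: "Max V < y" if W: "W \<in> outer_part P V 0" and y: "y \<in> W" for W y
    proof -
      have WP: "W \<in> P" "W \<noteq> V" using W by (auto simp: outer_part_def)
      have "y \<noteq> 0" "y \<noteq> Max V" using partition_on_same[OF part WP(1) V(1)] WP V Max y by metis+
      then show ?thesis using W y by (fastforce simp: outer_part_def)
    qed
    have ne: "\<exists>x. x \<in> W" if "W \<in> P" for W by (rule partition_on_nonempty[OF part that])
    have split: "P = insert V (inner_part P V 0 \<union> outer_part P V 0)"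
      using V(1) by (auto simp: inner_part_def outer_part_def)
    have V_outer: "\<not> inner_block P V" using V(2) by (auto simp: inner_block_def)
    have in_inner: "inner_block P W" if "W \<in> inner_part P V 0" for W
      unfolding inner_block_def using V Max in_gap[OF that] that
      by (intro bexI[of _ V] conjI bexI[of _ 0] bexI[of _ "Max V"]) (auto simp: inner_part_def)
    \<comment> \<open>A block enclosing \<open>W\<close> has a point beyond \<open>Max V\<close>, so
      it is neither \<open>V\<close> nor inside a finished gap and must lie in the last gap
      too.\<close>
    have out_inner: "inner_block P W \<longleftrightarrow> inner_block (outer_part P V 0) W" if W: "W \<in> outer_part P V 0" for W
    proof
      assume "inner_block P W"
      then obtain U i j where U: "U \<in> P" "U \<noteq> W" "i \<in> U" "j \<in> U" "\<forall>v\<in>W. i < v \<and> v < j"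
        unfolding inner_block_def by blast
      obtain y where y: "y \<in> W" using ne[of W] W by (auto simp: outer_part_def)
      have j: "Max V < j" using out[OF W y] U(5) y by fastforce
      then have "j \<notin> V" using Max_ge[OF fin(1)] by force
      then have "U \<in> outer_part P V 0" using split U j in_gap(2)[of U j] by fastforce
      then show "inner_block (outer_part P V 0) W" using U unfolding inner_block_def by blast
    next
      assume "inner_block (outer_part P V 0) W"
      then show "inner_block P W" unfolding inner_block_def outer_part_def by blast
    qed
    have V_notin: "V \<notin> outer_part P V 0" "V \<notin> inner_part P V 0" 
      by (auto simp: outer_part_def inner_part_def)
    have disj: "inner_part P V 0 \<inter> outer_part P V 0 = {}"
      by (auto simp: outer_part_def inner_part_def)
    have P_iff: "W \<in> P \<longleftrightarrow> W = V \<or> W \<in> inner_part P V 0 \<or> W \<in> outer_part P V 0" for W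
      using V(1) by (auto simp: inner_part_def outer_part_def)
    have s1: "{W \<in> P. \<not> inner_block P W} =
        insert V {W \<in> outer_part P V 0. \<not> inner_block (outer_part P V 0) W}"
      by (rule set_eqI, unfold mem_Collect_eq insert_iff Un_iff)
        (use P_iff in_inner out_inner V_outer in metis)
    have s2: "{W \<in> P. inner_block P W} =
        inner_part P V 0 \<union> {W \<in> outer_part P V 0. inner_block (outer_part P V 0) W}"
      by (rule set_eqI, unfold mem_Collect_eq insert_iff Un_iff)
        (use P_iff in_inner out_inner V_outer in metis)
    have fin': "finite (inner_part P V 0)" "finite (outer_part P V 0)"
      using fin by (auto simp: inner_part_def outer_part_def)
    have p2: "(\<Prod>W\<in>{W \<in> P. inner_block P W}. h W) = (\<Prod>W\<in>inner_part P V 0. h W) *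
        (\<Prod>W\<in>{W \<in> outer_part P V 0. inner_block (outer_part P V 0) W}. h W)" for h :: "nat set \<Rightarrow> complex"
      unfolding s2 by (rule prod.union_disjoint) (use fin' disj in auto)
    have p1: "(\<Prod>W\<in>{W \<in> P. \<not> inner_block P W}. h W) = h V *
        (\<Prod>W\<in>{W \<in> outer_part P V 0. \<not> inner_block (outer_part P V 0) W}. h W)" for h :: "nat set \<Rightarrow> complex"
      unfolding s1 by (rule prod.insert) (use fin' V_notin in auto)
    show ?thesis
      unfolding block_weight_def V_def[symmetric] cfree_weight_def p1 p2 by (simp add: mult_ac)
  qed
  then have "\<phi> (prod_list as) = (\<Sum>P\<in>nc_start n {} 0. block_weight (\<lambda>V. cfree_cumulant \<phi> \<psi> (nths as V))
      (\<lambda>W. free_cumulant \<psi> (nths as W)) (cfree_weight \<phi> \<psi> as) 0 P)"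
    using cfree_moment_nc[of \<phi> as \<psi>] assms(2) len n by (simp add: nc_start_0)
  also have "\<dots> = scan \<psi> e (\<lambda>c g. cfree_cumulant \<phi> \<psi> (map e c) * \<phi> g)
      ([] @ [(x # w) ! 0]) 1 (drop (Suc 0) (x # w))"
  proof (rule block_weight_scan[where n = n and E = "{}"])
    show "(\<Sum>Q\<in>nc_on {a..<b}. \<Prod>W\<in>Q. free_cumulant \<psi> (nths as W)) =
        \<psi> (prod_list (map e (take (b - a) (drop a (x # w)))))" if "0 < a" "a \<le> b" "b \<le> n" for a b
      using free_segment_sum[of \<psi> a b as, OF assms(1) that(2)] that len
      by (simp only: as_def take_map drop_map)
    show "(\<Sum>P\<in>nc_on ({m..<n} \<union> {}). cfree_weight \<phi> \<psi> as P) = \<phi> (prod_list (map e (drop m (x # w))))"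
      if "0 < m" "m \<le> n" for m
      using cfree_segment_sum[of \<phi> m as \<psi>, OF assms(2)] that len by (simp only: as_def drop_map Un_empty_right)
    show "cfree_cumulant \<phi> \<psi> (nths as V) = cfree_cumulant \<phi> \<psi> (map e ([] @ nths (x # w) V))" for V
      by (simp add: as_def nths_map del: list.map)
  qed (use n in \<open>auto simp: n_def\<close>)
  finally show ?thesis by (simp add: as_def)
qed

text \<open>For equal functionals the distinction between inner and outer blocks has no effect.
  Results on conditionally free cumulants thus specialise to free ones.\<close>

lemma cfree_cumulant_same:
  assumes "as \<noteq> []"
  shows "cfree_cumulant \<psi> \<psi> as = free_cumulant \<psi> as"
  using assms
proof (induction as rule: measure_induct_rule[where f = length])
  case (less as)
  have "(\<Prod>V \<in> {V\<in>P. \<not> inner_block P V}. cfree_cumulant \<psi> \<psi> (nths as V)) *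
      (\<Prod>V \<in> {V\<in>P. inner_block P V}. free_cumulant \<psi> (nths as V)) =
      (\<Prod>V\<in>P. free_cumulant \<psi> (nths as V))"
    if P: "P \<in> noncrossing_partitions (length as) - {{{..<length as}}}" for P
  proof -
    have part: "partition_on {..<length as} P" using P by (simp add: noncrossing_partitions_def)
    have "cfree_cumulant \<psi> \<psi> (nths as V) = free_cumulant \<psi> (nths as V)" if V: "V \<in> P" for V
    proof (rule less.IH[OF length_nths_block_less[OF P V]])
      obtain x where "x \<in> V" using partition_on_nonempty[OF part V] by blast
      moreover have "x < length as" using partition_on_sub[OF part V] calculation by auto
      ultimately have "as ! x \<in> set (nths as V)" by (auto simp: set_nths)
      then show "nths as V \<noteq> []" by auto
    qed
    then have "(\<Prod>V \<in> {V\<in>P. \<not> inner_block P V}. cfree_cumulant \<psi> \<psi> (nths as V)) =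
        (\<Prod>V \<in> {V\<in>P. \<not> inner_block P V}. free_cumulant \<psi> (nths as V))"
      by (intro prod.cong) auto
    moreover have "P = {V\<in>P. \<not> inner_block P V} \<union> {V\<in>P. inner_block P V}" by blast
    moreover have "finite P" using finite_elements[OF _ part] by simp
    ultimately show ?thesis
      by (subst (4) \<open>P = _\<close>, subst prod.union_disjoint) auto
  qed
  then show ?case
    by (simp add: cfree_cumulant.simps[of \<psi> \<psi> as] free_cumulant.simps[of \<psi> as])
qed

section \<open>The cyclic formula: marked blocks sorted by their smallest position\<close>

lemma nc_start_initial:
  "q < n \<Longrightarrow> nc_start n {..<q} q = {P \<in> nc_on {..<n}. Min (block_at P q) = q}"
proof (intro set_eqI iffI)
  fix P assume q: "q < n" and P: "P \<in> nc_start n {..<q} q"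
  have "{q..<n} \<union> {..<q} = {..<n}" using q by auto
  then have nc: "P \<in> nc_on {..<n}" using P by (simp add: nc_start_def)
  note V = nc_start_block[OF P order.refl q]
  have "finite (block_at P q)" using V(3) finite_subset by blast
  then have "Min (block_at P q) = q" using V by (intro Min_eqI) auto
  then show "P \<in> {P \<in> nc_on {..<n}. Min (block_at P q) = q}" using nc by blast
next
  fix P assume q: "q < n" and "P \<in> {P \<in> nc_on {..<n}. Min (block_at P q) = q}"
  then have P: "P \<in> nc_on {..<n}" and Min: "Min (block_at P q) = q" by auto
  note part = nc_on_partition[OF P]
  have eq: "{q..<n} \<union> {..<q} = {..<n}" using q by auto
  have "V \<inter> {..<q} = {}" if V: "V \<in> P" "q \<in> V" for V
  proof -
    have "block_at P q = V" by (rule block_at_eq[OF part V])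
    moreover have "finite V" using partition_on_sub[OF part V(1)] finite_subset by blast
    ultimately show ?thesis using Min Min_le[of V] by fastforce
  qed
  then show "P \<in> nc_start n {..<q} q" using P by (simp add: nc_start_def eq)
qed

lemma sum_blocks_by_Min:
  fixes h :: "nat set \<Rightarrow> complex"
  assumes part: "partition_on {..<n} P"
  shows "(\<Sum>V\<in>P. h V) = (\<Sum>q\<in>{q \<in> {..<n}. Min (block_at P q) = q}. h (block_at P q))"
proof (rule sum.reindex_bij_witness[where i = "block_at P" and j = Min])
  have Min: "Min V \<in> V" if "V \<in> P" for V
    using partition_on_sub[OF part that] partition_on_nonempty[OF part that] finite_subset
    by (intro Min_in) auto
  show "block_at P (Min V) = V" if "V \<in> P" for V
    using block_at_eq[OF part that Min[OF that]] .
  then show "Min V \<in> {q \<in> {..<n}. Min (block_at P q) = q}" if "V \<in> P" for V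
    using that Min[OF that] partition_on_sub[OF part that] by auto
  show "block_at P q \<in> P" if "q \<in> {q \<in> {..<n}. Min (block_at P q) = q}" for q
    using that partition_on_ex[OF part, of q] block_at_eq[OF part] by auto
  show "h (block_at P (Min V)) = h V" if "V \<in> P" for V
    using block_at_eq[OF part that Min[OF that]] by simp
qed auto

text \<open>One reading starts at \<open>Max V\<close>, the other at \<open>q = Min V\<close>. Both
  start in \<open>V\<close>, and \<open>W\<close> lies within a single arc of the complement of
  \<open>V\<close>, so neither cuts it.\<close>

lemma nths_from_wrap:
  assumes P: "P \<in> nc_start n {..<q} q" and q: "q < n"
    and W: "W \<in> P" "W \<noteq> block_at P q"
  shows "nths_from as (block_at P q) W = nths_wrap as q W"
proof -
  define V where "V = block_at P q"
  have "{q..<n} \<union> {..<q} = {..<n}" using q by auto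
  then have nc: "P \<in> nc_on {..<n}" using P by (simp add: nc_start_def)
  note part = nc_on_partition[OF nc]
  have V: "V \<in> P" "q \<in> V" "V \<subseteq> {q..<n}" using nc_start_block[OF P order.refl q] by (auto simp: V_def)
  have fin: "finite V" using V(3) finite_subset by blast
  have Max: "Max V \<in> V" using fin V by (intro Max_in) auto
  have q_le: "q \<le> Max V" using fin V by (intro Max_ge) auto
  have ne: "y \<noteq> q" "y \<noteq> Max V" if "y \<in> W" for y
    using partition_on_same[OF part W(1) V(1)] W V Max that by (metis V_def)+
  have "(\<forall>y\<in>W. q < y \<and> y < Max V) \<or> (\<forall>y\<in>W. y < q \<or> Max V < y)"
  proof (cases "\<exists>x\<in>W. q < x \<and> x < Max V")
    case True
    then obtain x where x: "x \<in> W" "q < x" "x < Max V" by blast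
    have "q < y \<and> y < Max V" if y: "y \<in> W" for y
    proof -
      have "\<not> Max V < y"
        using nc_on_alternate[OF nc V(1) W(1) V(2) x(1) Max y x(2,3)] W by (auto simp: V_def)
      moreover have "\<not> y < q"
        using nc_on_alternate[OF nc W(1) V(1) y V(2) x(1) Max _ x(2,3)] W by (auto simp: V_def)
      ultimately show ?thesis using ne[OF y] by auto
    qed
    then show ?thesis by blast
  next
    case False
    then show ?thesis using ne by (meson linorder_neqE_nat)
  qed
  then show ?thesis
  proof
    assume *: "\<forall>y\<in>W. q < y \<and> y < Max V"
    then have s: "{w \<in> W. Max V < w} = {}" "{w \<in> W. w < Max V} = W" "{w \<in> W. q \<le> w} = W" "{w \<in> W. w < q} = {}"
      by auto
    show ?thesis unfolding nths_from_def nths_wrap_def V_def[symmetric] s by simp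
  next
    assume *: "\<forall>y\<in>W. y < q \<or> Max V < y"
    then have "{w \<in> W. Max V < w} = {w \<in> W. q \<le> w}" "{w \<in> W. w < Max V} = {w \<in> W. w < q}"
      using q_le by force+
    then show ?thesis by (simp add: nths_from_def nths_wrap_def V_def)
  qed
qed

text \<open>With \<open>q\<close> the smallest element of the marked block, the last gap consists of
  what follows its largest element and then the prefix of length \<open>q\<close>. The factor
  \<open>take q w\<close> at the end of the last moment is this prefix.\<close>

lemma cyclic_scan:
  assumes "\<psi> 1 = 1" and w: "w \<noteq> []"
  shows "\<omega> (prod_list (map e w)) + (1 - \<omega> 1) * cyclic_boolean \<psi> (map e w) - cyclic_boolean \<phi> (map e w) =
    (\<Sum>q<length w. scan \<psi> e (\<lambda>c g. cyclic_cfree_cumulant \<omega> \<phi> \<psi> (map e c) *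
        \<psi> (g * prod_list (map e (take q w)))) [w ! q] 1 (drop (Suc q) w))"
proof -
  define as where "as = map e w"
  define n where "n = length w"
  have len: "length as = n" and ne: "as \<noteq> []" using w by (simp_all add: as_def n_def)
  let ?D = "\<lambda>V. cyclic_cfree_cumulant \<omega> \<phi> \<psi> (nths as V)"
  let ?k = "\<lambda>q W. free_cumulant \<psi> (nths_wrap as q W)"
  let ?h = "\<lambda>P V. ?D V * (\<Prod>W \<in> P - {V}. free_cumulant \<psi> (nths_from as V W))"
  have "\<omega> (prod_list as) + (1 - \<omega> 1) * cyclic_boolean \<psi> as - cyclic_boolean \<phi> as =
      (\<Sum>P\<in>nc_on {..<n}. \<Sum>V\<in>P. ?h P V)"
    using cyclic_cfree_moment_cumulant[OF ne] by (simp add: noncrossing_partitions_eq len)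
  also have "\<dots> = (\<Sum>P\<in>nc_on {..<n}. \<Sum>q\<in>{q \<in> {..<n}. Min (block_at P q) = q}. ?h P (block_at P q))"
    by (intro sum.cong refl sum_blocks_by_Min nc_on_partition)
  also have "\<dots> = (\<Sum>P\<in>nc_on {..<n}. \<Sum>q<n. if Min (block_at P q) = q then ?h P (block_at P q) else 0)"
    by (rule sum.cong[OF refl], rule sum.inter_filter) simp
  also have "\<dots> = (\<Sum>q<n. \<Sum>P\<in>nc_on {..<n}. if Min (block_at P q) = q then ?h P (block_at P q) else 0)"
    by (rule sum.swap)
  also have "\<dots> = (\<Sum>q<n. \<Sum>P\<in>nc_start n {..<q} q. ?h P (block_at P q))"
    by (rule sum.cong[OF refl], subst nc_start_initial, simp, rule sum.inter_filter[symmetric])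
      (simp add: finite_nc_on)
  also have "\<dots> = (\<Sum>q<n. \<Sum>P\<in>nc_start n {..<q} q. block_weight ?D (?k q) (\<lambda>Q. \<Prod>W\<in>Q. ?k q W) q P)"
  proof (intro sum.cong refl)
    fix q P assume "q \<in> {..<n}" and P: "P \<in> nc_start n {..<q} q"
    then have q: "q < n" by simp
    define V where "V = block_at P q"
    have "finite P" using finite_elements[OF _ nc_start_partition[OF P]] by simp
    have "P - {V} = inner_part P V q \<union> outer_part P V q"
      by (auto simp: inner_part_def outer_part_def)
    moreover have "(\<Prod>W\<in>inner_part P V q \<union> outer_part P V q. ?k q W) =
        (\<Prod>W\<in>inner_part P V q. ?k q W) * (\<Prod>W\<in>outer_part P V q. ?k q W)"
      using \<open>finite P\<close> by (intro prod.union_disjoint) (auto simp: inner_part_def outer_part_def)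
    moreover have "(\<Prod>W \<in> P - {V}. free_cumulant \<psi> (nths_from as V W)) = (\<Prod>W \<in> P - {V}. ?k q W)"
      unfolding V_def by (intro prod.cong refl) (simp add: nths_from_wrap[OF P q])
    ultimately show "?h P (block_at P q) = block_weight ?D (?k q) (\<lambda>Q. \<Prod>W\<in>Q. ?k q W) q P"
      by (simp add: block_weight_def V_def mult.assoc)
  qed
  also have "\<dots> = (\<Sum>q<n. scan \<psi> e (\<lambda>c g. cyclic_cfree_cumulant \<omega> \<phi> \<psi> (map e c) *
        \<psi> (g * prod_list (map e (take q w)))) ([] @ [w ! q]) 1 (drop (Suc q) w))"
  proof (rule sum.cong[OF refl], rule block_weight_scan[where n = n and f = "\<lambda>c. cyclic_cfree_cumulant \<omega> \<phi> \<psi> (map e c)"])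
    fix q assume "q \<in> {..<n}"
    then have q: "q < n" by simp
    then show "q < n" .
    show "(\<Sum>Q\<in>nc_on {a..<b}. \<Prod>W\<in>Q. ?k q W) = \<psi> (prod_list (map e (take (b - a) (drop a w))))"
      if ab: "q < a" "a \<le> b" "b \<le> n" for a b
    proof -
      have "nths_wrap as q W = nths as W" if "Q \<in> nc_on {a..<b}" "W \<in> Q" for Q W
      proof -
        have "W \<subseteq> {a..<b}" by (rule nc_on_sub[OF that(1) that(2)])
        then have "{x \<in> W. q \<le> x} = W" "{x \<in> W. x < q} = {}" using ab by force+
        then show ?thesis unfolding nths_wrap_def by (simp only: nths_empty append_Nil2)
      qed
      then have "(\<Sum>Q\<in>nc_on {a..<b}. \<Prod>W\<in>Q. ?k q W) =
          (\<Sum>Q\<in>nc_on {a..<b}. \<Prod>W\<in>Q. free_cumulant \<psi> (nths as W))"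
        by (intro sum.cong prod.cong refl) simp
      also have "\<dots> = \<psi> (prod_list (take (b - a) (drop a as)))"
        by (rule free_segment_sum[of \<psi> a b as, OF assms(1)]) (use ab len in auto)
      finally show ?thesis by (simp only: as_def take_map drop_map)
    qed
    show "(\<Sum>P\<in>nc_on ({m..<n} \<union> {..<q}). \<Prod>W\<in>P. ?k q W) =
        \<psi> (prod_list (map e (drop m w)) * prod_list (map e (take q w)))" if "q < m" "m \<le> n" for m
      using free_wrap_sum[of \<psi> q m n as, OF assms(1)] that len
      by (simp add: as_def take_map drop_map)
    show "?D V = cyclic_cfree_cumulant \<omega> \<phi> \<psi> (map e ([] @ nths w V))" for V
      by (simp add: as_def nths_map)
  qed (simp_all add: n_def)
  finally show ?thesis by (simp add: as_def n_def)
qed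

section \<open>Boolean cumulants\<close>

lemma interval_partition_last_block:
  assumes P: "P \<in> interval_partitions n" and n: "0 < n"
  shows "block_at P (n - 1) \<in> P" "Min (block_at P (n - 1)) < n"
    "block_at P (n - 1) = {Min (block_at P (n - 1))..<n}"
proof -
  have part: "partition_on {..<n} P" using P by (simp add: interval_partitions_def)
  have "n - 1 \<in> {..<n}" using n by auto
  then obtain V where V: "V \<in> P" "n - 1 \<in> V" using partition_on_ex[OF part] by blast
  have eq: "block_at P (n - 1) = V" by (rule block_at_eq[OF part V])
  have "\<exists>i j. V = {i..j}" using P V(1) by (simp add: interval_partitions_def)
  then obtain i j where ij: "V = {i..j}" by blast
  have "{i..j} \<subseteq> {..<n}" using partition_on_sub[OF part V(1)] ij by simp
  moreover have le: "i \<le> n - 1" "n - 1 \<le> j" using V(2) ij by auto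
  ultimately have "j < n" by (meson atLeastAtMost_iff lessThan_iff order.trans order.refl subsetD)
  then have "j = n - 1" using le by simp
  then have V': "V = {i..<n}" using ij n by auto
  have "Min V = i" using le n unfolding V' by (intro Min_eqI) auto
  then show "block_at P (n - 1) \<in> P" "Min (block_at P (n - 1)) < n"
    "block_at P (n - 1) = {Min (block_at P (n - 1))..<n}"
    using V V' eq le n by auto
qed

lemma interval_partitions_0 [simp]: "interval_partitions 0 = {{}}"
  by (auto simp: interval_partitions_def partition_on_empty)

lemma finite_interval_partitions: "finite (interval_partitions n)"
  using finite_subset[OF interval_partitions_noncrossing finite_noncrossing_partitions] .

lemma interval_partitions_insert:
  assumes P: "P \<in> interval_partitions k" and k: "k < n"
  shows "insert {k..<n} P \<in> interval_partitions n" "block_at (insert {k..<n} P) (n - 1) = {k..<n}"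
    "{k..<n} \<notin> P"
proof -
  have "{..<n} - {k..<n} = {..<k}" using k by auto
  then have P': "partition_on ({..<n} - {k..<n}) P" using P by (simp add: interval_partitions_def)
  have sub: "{k..<n} \<subseteq> {..<n}" "{k..<n} \<noteq> {}" using k by auto
  note part = partition_on_add_block[OF sub P']
  have "{k..<n} = {k..n - 1}" using k by auto
  then have "\<exists>i j. {k..<n} = {i..j}" by blast
  then show "insert {k..<n} P \<in> interval_partitions n"
    using part(1) P by (simp add: interval_partitions_def)
  show "block_at (insert {k..<n} P) (n - 1) = {k..<n}"
    using k by (intro block_at_eq[OF part(1)]) auto
  show "{k..<n} \<notin> P" by (rule part(2))
qed

lemma interval_partitions_delete:
  assumes P: "P \<in> interval_partitions n" and V: "{k..<n} \<in> P" and k: "k < n"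
  shows "P - {{k..<n}} \<in> interval_partitions k"
proof -
  have "{..<n} - {k..<n} = {..<k}" using k by auto
  then show ?thesis
    using P partition_on_remove_block[OF _ V, of "{..<n}"] by (auto simp: interval_partitions_def)
qed

lemma interval_partitions_sum:
  fixes G :: "nat set set \<Rightarrow> complex"
  assumes n: "0 < n"
  shows "(\<Sum>P\<in>interval_partitions n. G P) =
    (\<Sum>k<n. \<Sum>P\<in>interval_partitions k. G (insert {k..<n} P))"
proof -
  have "(\<Sum>k<n. \<Sum>P\<in>interval_partitions k. G (insert {k..<n} P)) =
      (\<Sum>(k, P)\<in>(SIGMA k:{..<n}. interval_partitions k). G (insert {k..<n} P))"
    by (rule sum.Sigma) (simp_all add: finite_interval_partitions)
  also have "\<dots> = (\<Sum>P\<in>interval_partitions n. G P)"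
  proof (rule sum.reindex_bij_witness[where i = "\<lambda>P. (Min (block_at P (n - 1)), P - {block_at P (n - 1)})"
        and j = "\<lambda>(k, P). insert {k..<n} P"], goal_cases)
    case (1 a)
    then obtain k P where a: "a = (k, P)" "k < n" "P \<in> interval_partitions k" by auto
    have "Min {k..<n} = k" using a(2) by (intro Min_eqI) auto
    then show ?case using interval_partitions_insert[OF a(3,2)] a(1) by auto
  next
    case (2 a)
    then show ?case using interval_partitions_insert(1) by auto
  next
    case (3 P)
    then show ?case using interval_partition_last_block[OF 3 n] by auto
  next
    case (4 P)
    then show ?case
      using interval_partition_last_block[OF 4 n] interval_partitions_delete[OF 4, of "Min (block_at P (n - 1))"]
      by auto
  qed auto
  finally show ?thesis ..
qed

lemma boolean_right:
  assumes "\<phi> 1 = 1" "as \<noteq> []"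
  shows "\<phi> (prod_list as) =
    (\<Sum>k<length as. \<phi> (prod_list (take k as)) * boolean_cumulant \<phi> (drop k as))"
proof -
  have all: "\<phi> (prod_list as) = (\<Sum>P\<in>interval_partitions (length as). \<Prod>V\<in>P. boolean_cumulant \<phi> (nths as V))"
    for as using boolean_moment_cumulant[of as \<phi>] assms(1) by (cases "as = []") simp_all
  have "0 < length as" using assms(2) by simp
  then have "\<phi> (prod_list as) = (\<Sum>k<length as. \<Sum>P\<in>interval_partitions k.
      \<Prod>V\<in>insert {k..<length as} P. boolean_cumulant \<phi> (nths as V))"
    by (subst all, rule interval_partitions_sum)
  also have "\<dots> = (\<Sum>k<length as. \<phi> (prod_list (take k as)) * boolean_cumulant \<phi> (drop k as))"
  proof (intro sum.cong refl)
    fix k assume "k \<in> {..<length as}"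
    then have k: "k < length as" by simp
    have drop: "nths as {k..<length as} = drop k as"
      unfolding drop_eq_nths nths_eq_map by (intro arg_cong[where f = "map _"] filter_cong) auto
    have "(\<Prod>V\<in>insert {k..<length as} P. boolean_cumulant \<phi> (nths as V)) =
        (\<Prod>V\<in>P. boolean_cumulant \<phi> (nths (take k as) V)) * boolean_cumulant \<phi> (drop k as)"
      if P: "P \<in> interval_partitions k" for P
    proof -
      have part: "partition_on {..<k} P" using P by (simp add: interval_partitions_def)
      have "finite P" using finite_elements[OF _ part] by simp
      moreover have "(\<Prod>V\<in>P. boolean_cumulant \<phi> (nths as V)) =
          (\<Prod>V\<in>P. boolean_cumulant \<phi> (nths (take k as) V))"
        by (intro prod.cong refl) (simp add: nths_take_subset[OF partition_on_sub[OF part]])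
      ultimately show ?thesis
        using interval_partitions_insert(3)[OF P k] by (simp add: drop)
    qed
    then show "(\<Sum>P\<in>interval_partitions k. \<Prod>V\<in>insert {k..<length as} P. boolean_cumulant \<phi> (nths as V)) =
        \<phi> (prod_list (take k as)) * boolean_cumulant \<phi> (drop k as)"
      using k by (subst all) (simp add: sum_distrib_right min.absorb2)
  qed
  finally show ?thesis .
qed

lemma sum_triangle_swap:
  fixes f :: "nat \<Rightarrow> nat \<Rightarrow> complex"
  shows "(\<Sum>k<n. \<Sum>j<k. f j k) = (\<Sum>j<n. \<Sum>k\<in>{Suc j..<n}. f j k)"
proof -
  have "(\<Sum>k<n. \<Sum>j<k. f j k) = (\<Sum>k<n. \<Sum>j<n. if j < k then f j k else 0)"
  proof (rule sum.cong[OF refl])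
    fix k assume "k \<in> {..<n}"
    then have "{..<k} = {j \<in> {..<n}. j < k}" by auto
    then show "(\<Sum>j<k. f j k) = (\<Sum>j<n. if j < k then f j k else 0)"
      by (simp only: sum.inter_filter finite_lessThan)
  qed
  also have "\<dots> = (\<Sum>j<n. \<Sum>k<n. if j < k then f j k else 0)" by (rule sum.swap)
  also have "\<dots> = (\<Sum>j<n. \<Sum>k\<in>{Suc j..<n}. f j k)"
  proof (rule sum.cong[OF refl])
    fix j
    have "{Suc j..<n} = {k \<in> {..<n}. j < k}" by auto
    then show "(\<Sum>k<n. if j < k then f j k else 0) = (\<Sum>k\<in>{Suc j..<n}. f j k)"
      by (simp only: sum.inter_filter finite_lessThan)
  qed
  finally show ?thesis .
qed

lemma boolean_right_segment:
  assumes "\<phi> 1 = 1" "p < q" "q \<le> length as"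
  shows "(\<Sum>k\<in>{p..<q}. \<phi> (prod_list (drop p (take k as))) * boolean_cumulant \<phi> (drop k (take q as))) =
    \<phi> (prod_list (drop p (take q as)))"
proof -
  define u where "u = drop p (take q as)"
  have len: "length u = q - p" using assms by (simp add: u_def)
  then have "u \<noteq> []" using assms by auto
  have "\<phi> (prod_list u) = (\<Sum>k<q - p. \<phi> (prod_list (take k u)) * boolean_cumulant \<phi> (drop k u))"
    using boolean_right[of \<phi> u, OF assms(1) \<open>u \<noteq> []\<close>] len by simp
  also have "\<dots> = (\<Sum>k\<in>{p..<q}. \<phi> (prod_list (drop p (take k as))) * boolean_cumulant \<phi> (drop k (take q as)))"
  proof (rule sum.reindex_bij_witness[where i = "\<lambda>k. k - p" and j = "\<lambda>k. k + p"])
    fix k assume "k \<in> {..<q - p}"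
    then show "\<phi> (prod_list (drop p (take (k + p) as))) * boolean_cumulant \<phi> (drop (k + p) (take q as)) =
        \<phi> (prod_list (take k u)) * boolean_cumulant \<phi> (drop k u)"
      using assms by (simp add: u_def drop_take add.commute min_def)
  qed (use assms in auto)
  finally show ?thesis by (simp add: u_def)
qed

text \<open>Obtained from \<open>boolean_right\<close> without a second bijection: the prefix
  moments are expanded by induction, the sums exchanged, and the tails recombined by
  \<open>boolean_right_segment\<close>.\<close>

lemma boolean_left:
  assumes "\<phi> 1 = 1" "as \<noteq> []"
  shows "\<phi> (prod_list as) =
    (\<Sum>k<length as. boolean_cumulant \<phi> (take (Suc k) as) * \<phi> (prod_list (drop (Suc k) as)))"
  using assms(2)
proof (induction as rule: measure_induct_rule[where f = length])
  case (less as)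
  let ?b = "boolean_cumulant \<phi>" and ?n = "length as"
  have n: "0 < ?n" using less.prems by simp
  have IH: "\<phi> (prod_list (take k as)) = (if k = 0 then 1 else 0) +
      (\<Sum>j<k. ?b (take (Suc j) as) * \<phi> (prod_list (drop (Suc j) (take k as))))" if k: "k < ?n" for k
  proof (cases "k = 0")
    case False
    then have "\<phi> (prod_list (take k as)) =
        (\<Sum>j<k. ?b (take (Suc j) (take k as)) * \<phi> (prod_list (drop (Suc j) (take k as))))"
      using less.IH[of "take k as"] less.prems k by (simp add: min_def)
    also have "\<dots> = (\<Sum>j<k. ?b (take (Suc j) as) * \<phi> (prod_list (drop (Suc j) (take k as))))"
      by (intro sum.cong refl) (simp add: min_def)
    finally show ?thesis using False by simp
  qed (simp add: assms(1))
  have "\<phi> (prod_list as) = (\<Sum>k<?n. \<phi> (prod_list (take k as)) * ?b (drop k as))"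
    by (rule boolean_right[of \<phi> as, OF assms(1) less.prems])
  also have "\<dots> = (\<Sum>k<?n. (if k = 0 then ?b (drop k as) else 0) +
      (\<Sum>j<k. ?b (take (Suc j) as) * \<phi> (prod_list (drop (Suc j) (take k as))) * ?b (drop k as)))"
    by (intro sum.cong refl) (simp add: IH distrib_right sum_distrib_right)
  also have "\<dots> = ?b as + (\<Sum>j<?n. \<Sum>k\<in>{Suc j..<?n}.
      ?b (take (Suc j) as) * \<phi> (prod_list (drop (Suc j) (take k as))) * ?b (drop k as))"
    using n unfolding sum.distrib sum_triangle_swap by (simp add: sum.delta)
  \<comment> \<open>For \<open>j = ?n - 1\<close> the inner sum is empty, whereas the closed form
    would give \<open>?b as\<close>. The correction cancels against the one-block term split off in
    front.\<close>
  also have "\<dots> = ?b as + (\<Sum>j<?n. ?b (take (Suc j) as) * \<phi> (prod_list (drop (Suc j) as)) -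
      (if j = ?n - 1 then ?b as else 0))"
  proof (intro arg_cong2[of _ _ _ _ "(+)"] sum.cong refl)
    fix j assume j: "j \<in> {..<?n}"
    show "(\<Sum>k\<in>{Suc j..<?n}. ?b (take (Suc j) as) * \<phi> (prod_list (drop (Suc j) (take k as))) * ?b (drop k as)) =
        ?b (take (Suc j) as) * \<phi> (prod_list (drop (Suc j) as)) - (if j = ?n - 1 then ?b as else 0)"
    proof (cases "Suc j < ?n")
      case True
      then have "j \<noteq> ?n - 1" by simp
      with True show ?thesis
        using boolean_right_segment[of \<phi> "Suc j" ?n as, OF assms(1)]
        by (simp add: mult.assoc flip: sum_distrib_left)
    next
      case False
      then have "j = ?n - 1" "Suc j = ?n" using j by auto
      then show ?thesis using assms(1) by simp
    qed
  qed
  also have "\<dots> = (\<Sum>j<?n. ?b (take (Suc j) as) * \<phi> (prod_list (drop (Suc j) as)))"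
    using n by (simp add: sum_subtractf sum.delta)
  finally show ?case .
qed

text \<open>Used with \<open>S\<close> a set of starting points: the largest one, \<open>q\<close>,
  starts the only segment that wraps around.\<close>

lemma sum_Pow_Max:
  fixes G :: "nat set \<Rightarrow> complex"
  shows "(\<Sum>S\<in>Pow {..<n} - {{}}. G S) = (\<Sum>q<n. \<Sum>S\<in>Pow {..<q}. G (insert q S))"
proof (induction n)
  case (Suc n)
  have "Pow {..<Suc n} - {{}} = (Pow {..<n} - {{}}) \<union> insert n ` Pow {..<n}"
    by (auto simp: lessThan_Suc Pow_insert)
  moreover have "(Pow {..<n} - {{}}) \<inter> insert n ` Pow {..<n} = {}" by auto
  moreover have "inj_on (insert n) (Pow {..<n})"
    by (rule inj_onI) (metis PowD insert_ident lessThan_iff less_irrefl subsetD)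
  ultimately show ?case
    using Suc by (simp add: sum.union_disjoint sum.reindex)
qed simp

text \<open>The search for the next point after \<open>i\<close> stops at \<open>r\<close> at the
  latest, so what the sets contain beyond \<open>r\<close> is invisible.\<close>

lemma Least_gap_eq:
  fixes i r :: nat
  assumes "i < r" "\<And>x. x \<le> r \<Longrightarrow> x \<in> S \<longleftrightarrow> x \<in> T" "r \<in> S"
  shows "(LEAST d. 0 < d \<and> i + d \<in> S) = (LEAST d. 0 < d \<and> i + d \<in> T)"
proof -
  define d where "d = (LEAST d. 0 < d \<and> i + d \<in> S)"
  have ex: "0 < r - i \<and> i + (r - i) \<in> S" using assms by simp
  have d: "0 < d \<and> i + d \<in> S" unfolding d_def by (rule LeastI[of "\<lambda>d. 0 < d \<and> i + d \<in> S", OF ex])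
  have "d \<le> r - i" unfolding d_def by (rule Least_le[of "\<lambda>d. 0 < d \<and> i + d \<in> S", OF ex])
  then have le: "i + d \<le> r" using assms(1) by simp
  have "(LEAST d. 0 < d \<and> i + d \<in> T) = d"
  proof (rule Least_equality)
    show "0 < d \<and> i + d \<in> T" using d le assms(2) by blast
    fix y assume y: "0 < y \<and> i + y \<in> T"
    show "d \<le> y"
    proof (rule ccontr)
      assume "\<not> d \<le> y"
      then have "i + y \<le> r" using le by simp
      then have "0 < y \<and> i + y \<in> S" using y assms(2) by blast
      then show False using \<open>\<not> d \<le> y\<close> Least_le[of "\<lambda>d. 0 < d \<and> i + d \<in> S" y] by (simp add: d_def)
    qed
  qed
  then show ?thesis by (simp add: d_def)
qed

text \<open>The segments between the smallest starting point \<open>p\<close> and \<open>q\<close>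
  form an arbitrary interval partition and add up to a moment. \<open>h\<close> remembers
  \<open>p\<close>, where the segment starting at \<open>q\<close> will end; \<open>p = q\<close>
  accounts for the empty \<open>S\<close>.\<close>

lemma sum_segments:
  fixes h :: "nat \<Rightarrow> complex"
  assumes "\<phi> 1 = 1" "q \<le> length as"
  shows "(\<Sum>S\<in>Pow {..<q}. (\<Prod>i\<in>S. boolean_cumulant \<phi>
      (take (LEAST d. 0 < d \<and> i + d \<in> insert q S) (drop i as))) * h (Min (insert q S))) =
    (\<Sum>p\<le>q. \<phi> (prod_list (drop p (take q as))) * h p)"
  using assms(2)
proof (induction q rule: less_induct)
  case (less q)
  let ?b = "boolean_cumulant \<phi>"
  let ?G = "\<lambda>q S. (\<Prod>i\<in>S. ?b (take (LEAST d. 0 < d \<and> i + d \<in> insert q S) (drop i as))) * h (Min (insert q S))"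
  have "(\<Sum>S\<in>Pow {..<q}. ?G q S) = h q + (\<Sum>S\<in>Pow {..<q} - {{}}. ?G q S)"
    by (subst sum.remove[of _ "{}"]) auto
  also have "(\<Sum>S\<in>Pow {..<q} - {{}}. ?G q S) = (\<Sum>r<q. \<Sum>S\<in>Pow {..<r}. ?G q (insert r S))"
    by (rule sum_Pow_Max)
  also have "\<dots> = (\<Sum>r<q. ?b (drop r (take q as)) * (\<Sum>S\<in>Pow {..<r}. ?G r S))"
    unfolding sum_distrib_left
  proof (intro sum.cong refl)
    fix r S assume "r \<in> {..<q}" "S \<in> Pow {..<r}"
    then have r: "r < q" and S: "\<And>x. x \<in> S \<Longrightarrow> x < r" by auto
    then have fin: "finite S" using bounded_nat_set_is_finite by blast
    have "r \<notin> S" using S by auto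
    have L1: "(LEAST d. 0 < d \<and> r + d \<in> insert q (insert r S)) = q - r"
    proof (rule Least_equality)
      fix y assume "0 < y \<and> r + y \<in> insert q (insert r S)"
      then have "r + y = q" using S[of "r + y"] by auto
      then show "q - r \<le> y" by simp
    qed (use r in simp)
    have L2: "(LEAST d. 0 < d \<and> i + d \<in> insert q (insert r S)) = (LEAST d. 0 < d \<and> i + d \<in> insert r S)"
      if "i \<in> S" for i
      by (rule Least_gap_eq[of i r]) (use S[OF that] r in auto)
    have "Min (insert r S) \<le> r" using fin by (intro Min_le) auto
    then have M: "Min (insert q (insert r S)) = Min (insert r S)"
      using fin r by (subst Min_insert) (auto simp: min_def)
    have t: "take (q - r) (drop r as) = drop r (take q as)" by (simp add: drop_take)
    show "?G q (insert r S) = ?b (drop r (take q as)) * ?G r S"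
      using fin \<open>r \<notin> S\<close> by (simp add: L1 L2 M t mult.assoc del: insert_iff Min_insert)
  qed
  also have "\<dots> = (\<Sum>r<q. ?b (drop r (take q as)) * (\<Sum>p\<le>r. \<phi> (prod_list (drop p (take r as))) * h p))"
    by (intro sum.cong refl arg_cong2[of _ _ _ _ "(*)"] less.IH) (use less.prems in auto)
  also have "\<dots> = (\<Sum>r<q. \<Sum>p<Suc r. ?b (drop r (take q as)) * (\<phi> (prod_list (drop p (take r as))) * h p))"
    by (simp only: sum_distrib_left lessThan_Suc_atMost)
  also have "\<dots> = (\<Sum>p<q. \<Sum>k\<in>{p..<q}. ?b (drop k (take q as)) * (\<phi> (prod_list (drop p (take k as))) * h p))"
  proof -
    have "(\<Sum>k<q. \<Sum>p<Suc k. f p k) = (\<Sum>p<q. \<Sum>k\<in>{p..<q}. f p k)" for f :: "nat \<Rightarrow> nat \<Rightarrow> complex"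
    proof -
      have "(\<Sum>k<q. \<Sum>p<Suc k. f p k) = (\<Sum>k<q. \<Sum>p<k. f p k) + (\<Sum>k<q. f k k)"
        by (simp add: sum.distrib)
      also have "\<dots> = (\<Sum>p<q. f p p + (\<Sum>k\<in>{Suc p..<q}. f p k))"
        unfolding sum_triangle_swap by (simp add: sum.distrib)
      also have "\<dots> = (\<Sum>p<q. \<Sum>k\<in>{p..<q}. f p k)"
        by (intro sum.cong refl) (simp add: sum.atLeast_Suc_lessThan)
      finally show ?thesis .
    qed
    then show ?thesis .
  qed
  also have "\<dots> = (\<Sum>p<q. (\<Sum>k\<in>{p..<q}. \<phi> (prod_list (drop p (take k as))) * ?b (drop k (take q as))) * h p)"
    unfolding sum_distrib_right by (intro sum.cong refl) (simp add: mult_ac)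
  also have "\<dots> = (\<Sum>p<q. \<phi> (prod_list (drop p (take q as))) * h p)"
    by (intro sum.cong refl arg_cong2[of _ _ _ _ "(*)"] boolean_right_segment assms(1)) (use less.prems in auto)
  also have "h q + \<dots> = (\<Sum>p\<le>q. \<phi> (prod_list (drop p (take q as))) * h p)"
    using assms(1) by (simp add: lessThan_Suc_atMost[symmetric])
  finally show ?case .
qed

lemma cyclic_boolean_sum:
  assumes "\<phi> 1 = 1" "as \<noteq> []"
  shows "cyclic_boolean \<phi> as = (\<Sum>q<length as. \<Sum>p\<le>q.
    \<phi> (prod_list (drop p (take q as))) * boolean_cumulant \<phi> (drop q as @ take p as))"
proof -
  let ?n = "length as" and ?b = "boolean_cumulant \<phi>"
  have "cyclic_boolean \<phi> as = (\<Sum>S\<in>Pow {..<?n} - {{}}.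
      \<Prod>i\<in>S. ?b (take (LEAST d. 0 < d \<and> (i + d) mod ?n \<in> S) (rotate i as)))"
    using assms(2) by (simp add: cyclic_boolean_def)
  also have "\<dots> = (\<Sum>q<?n. \<Sum>S\<in>Pow {..<q}.
      \<Prod>i\<in>insert q S. ?b (take (LEAST d. 0 < d \<and> (i + d) mod ?n \<in> insert q S) (rotate i as)))"
    by (rule sum_Pow_Max)
  also have "\<dots> = (\<Sum>q<?n. \<Sum>S\<in>Pow {..<q}.
      (\<Prod>i\<in>S. ?b (take (LEAST d. 0 < d \<and> i + d \<in> insert q S) (drop i as))) *
      ?b (drop q as @ take (Min (insert q S)) as))"
  proof (intro sum.cong refl)
    fix q S assume "q \<in> {..<?n}" "S \<in> Pow {..<q}"
    then have q: "q < ?n" and S: "\<And>x. x \<in> S \<Longrightarrow> x < q" by auto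
    then have fin: "finite S" using bounded_nat_set_is_finite by blast
    have "q \<notin> S" using S by auto
    define m where "m = Min (insert q S)"
    have m: "m \<in> insert q S" "m \<le> q" "\<And>x. x \<in> insert q S \<Longrightarrow> m \<le> x"
      unfolding m_def using fin by (auto intro: Min_le simp del: Min_insert) (meson Min_in finite_insert insert_iff insert_not_empty)
    \<comment> \<open>From the largest starting point the next one is the smallest,
      \<open>m\<close>, reached after passing the end of the word; if \<open>S\<close> is empty this
      is a full turn.\<close>
    have Lq: "(LEAST d. 0 < d \<and> (q + d) mod ?n \<in> insert q S) = ?n - q + m"
    proof (rule Least_equality)
      have "(q + (?n - q + m)) mod ?n = m" using q m(2) by simp
      then show "0 < ?n - q + m \<and> (q + (?n - q + m)) mod ?n \<in> insert q S"
        using q m(1) by (simp del: insert_iff)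
      fix y assume y: "0 < y \<and> (q + y) mod ?n \<in> insert q S"
      show "?n - q + m \<le> y"
      proof (rule ccontr)
        assume "\<not> ?n - q + m \<le> y"
        then have lt: "q + y < ?n + m" using q by simp
        show False
        proof (cases "q + y < ?n")
          case True
          then have "q + y \<in> insert q S" using y by (simp del: insert_iff)
          then show False using y S[of "q + y"] by auto
        next
          case False
          have "q + y - ?n < ?n" using lt m(2) q by simp
          then have "(q + y) mod ?n = q + y - ?n" using False by (simp add: mod_if)
          then show False using m(3)[of "q + y - ?n"] y lt False by simp
        qed
      qed
    qed
    have "take (?n - q + m) (rotate q as) = drop q as @ take m as"
      using q m(2) by (simp add: rotate_drop_take min_def)
    moreover have "?b (take (LEAST d. 0 < d \<and> (i + d) mod ?n \<in> insert q S) (rotate i as)) =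
        ?b (take (LEAST d. 0 < d \<and> i + d \<in> insert q S) (drop i as))" if i: "i \<in> S" for i
    proof -
      have "i < q" by (rule S[OF i])
      \<comment> \<open>Up to \<open>q\<close> the reduction modulo the length changes nothing, and
        \<open>q\<close> itself already stops the search.\<close>
      have "(LEAST d. 0 < d \<and> i + d \<in> {x. x mod ?n \<in> insert q S}) =
          (LEAST d. 0 < d \<and> i + d \<in> insert q S)"
        by (rule Least_gap_eq[OF \<open>i < q\<close>]) (use q in auto)
      moreover have "(LEAST d. 0 < d \<and> i + d \<in> insert q S) \<le> q - i"
        by (rule Least_le) (use \<open>i < q\<close> in simp)
      ultimately show ?thesis using q \<open>i < q\<close> by (simp add: rotate_drop_take)
    qed
    ultimately show "(\<Prod>i\<in>insert q S. ?b (take (LEAST d. 0 < d \<and> (i + d) mod ?n \<in> insert q S) (rotate i as))) =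
        (\<Prod>i\<in>S. ?b (take (LEAST d. 0 < d \<and> i + d \<in> insert q S) (drop i as))) *
        ?b (drop q as @ take (Min (insert q S)) as)"
      using fin \<open>q \<notin> S\<close> by (simp add: Lq m_def[symmetric] del: insert_iff)
  qed
  also have "\<dots> = (\<Sum>q<?n. \<Sum>p\<le>q. \<phi> (prod_list (drop p (take q as))) * ?b (drop q as @ take p as))"
    by (intro sum.cong refl sum_segments assms(1)) auto
  finally show ?thesis .
qed

text \<open>Shifting all starting points by one modulo the length preserves every cyclic distance,
  so the segments correspond.\<close>

lemma cyclic_boolean_rotate1: "cyclic_boolean \<phi> (rotate1 as) = cyclic_boolean \<phi> as"
proof (cases "as = []")
  case False
  let ?n = "length as"
  define f where "f i = (i + 1) mod ?n" for i
  have n: "0 < ?n" using False by simp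
  have inj: "inj_on f {..<?n}"
    by (rule inj_onI) (auto simp: f_def mod_Suc split: if_splits)
  have "f ` {..<?n} \<subseteq> {..<?n}" using n by (auto simp: f_def)
  then have surj: "f ` {..<?n} = {..<?n}" using endo_inj_surj[OF _ _ inj] by simp
  have bij: "bij_betw ((`) f) (Pow {..<?n} - {{}}) (Pow {..<?n} - {{}})"
    using bij_betw_Pow[of f "{..<?n}" "{..<?n}"] inj surj
    by (intro bij_betw_DiffI) (auto simp: bij_betw_def)
  have mem: "f x \<in> f ` S \<longleftrightarrow> x \<in> S" if "S \<subseteq> {..<?n}" "x < ?n" for S x
    using inj_on_image_mem_iff[OF inj, of x S] that by auto
  have "cyclic_boolean \<phi> as = (\<Sum>S\<in>Pow {..<?n} - {{}}.
      \<Prod>i\<in>S. boolean_cumulant \<phi> (take (LEAST d. 0 < d \<and> (i + d) mod ?n \<in> S) (rotate i as)))"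
    using False by (simp add: cyclic_boolean_def)
  also have "\<dots> = (\<Sum>S\<in>Pow {..<?n} - {{}}. \<Prod>i\<in>f ` S.
      boolean_cumulant \<phi> (take (LEAST d. 0 < d \<and> (i + d) mod ?n \<in> f ` S) (rotate i as)))"
    by (rule sum.reindex_bij_betw[OF bij, symmetric])
  also have "\<dots> = (\<Sum>S\<in>Pow {..<?n} - {{}}. \<Prod>i\<in>S.
      boolean_cumulant \<phi> (take (LEAST d. 0 < d \<and> (i + d) mod ?n \<in> S) (rotate i (rotate1 as))))"
  proof (rule sum.cong[OF refl])
    fix S assume S: "S \<in> Pow {..<?n} - {{}}"
    have "inj_on f S" using inj S inj_on_subset by blast
    then have "(\<Prod>i\<in>f ` S. boolean_cumulant \<phi> (take (LEAST d. 0 < d \<and> (i + d) mod ?n \<in> f ` S) (rotate i as))) =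
        (\<Prod>i\<in>S. boolean_cumulant \<phi> (take (LEAST d. 0 < d \<and> (f i + d) mod ?n \<in> f ` S) (rotate (f i) as)))"
      by (simp add: prod.reindex)
    also have "\<dots> = (\<Prod>i\<in>S. boolean_cumulant \<phi>
        (take (LEAST d. 0 < d \<and> (i + d) mod ?n \<in> S) (rotate i (rotate1 as))))"
    proof (rule prod.cong[OF refl])
      fix i
      have "(f i + d) mod ?n = f ((i + d) mod ?n)" for d
        by (simp add: f_def mod_simps)
      then have "(f i + d) mod ?n \<in> f ` S \<longleftrightarrow> (i + d) mod ?n \<in> S" for d
        using mem[of S "(i + d) mod ?n"] S n by simp
      moreover have "rotate (f i) as = rotate i (rotate1 as)"
        by (simp add: f_def rotate_conv_mod[symmetric] rotate1_rotate_swap[symmetric])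
      ultimately show "boolean_cumulant \<phi> (take (LEAST d. 0 < d \<and> (f i + d) mod ?n \<in> f ` S) (rotate (f i) as)) =
          boolean_cumulant \<phi> (take (LEAST d. 0 < d \<and> (i + d) mod ?n \<in> S) (rotate i (rotate1 as)))"
        by simp
    qed
    finally show "(\<Prod>i\<in>f ` S. boolean_cumulant \<phi> (take (LEAST d. 0 < d \<and> (i + d) mod ?n \<in> f ` S) (rotate i as))) =
        (\<Prod>i\<in>S. boolean_cumulant \<phi> (take (LEAST d. 0 < d \<and> (i + d) mod ?n \<in> S) (rotate i (rotate1 as))))" .
  qed
  also have "\<dots> = cyclic_boolean \<phi> (rotate1 as)"
    using False by (simp add: cyclic_boolean_def)
  finally show ?thesis ..
qed simp

section \<open>Centred words\<close>

lemma linear_functionalI: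
  "(\<And>x y. f (x + y) = f x + f y) \<Longrightarrow> (\<And>c x. f (c *\<^sub>C x) = c * f x) \<Longrightarrow> linear_functional f"
  by (simp add: linear_functional_iff)

lemma linear_functional_add: "linear_functional f \<Longrightarrow> f (x + y) = f x + f y"
  and linear_functional_scale: "linear_functional f \<Longrightarrow> f (c *\<^sub>C x) = c * f x"
  by (simp_all add: linear_functional_iff)

lemma linear_functional_diff: "linear_functional f \<Longrightarrow> f (x - y) = f x - f y"
  using linear_functional_add[of f "x - y" y] by simp

lemma linear_functional_0: "linear_functional f \<Longrightarrow> f 0 = 0"
  using linear_functional_diff[of f 0 0] by simp

lemmas linear_functional_simps =
  linear_functional_add linear_functional_scale linear_functional_diff linear_functional_0

lemma linear_functional_mult: "linear_functional f \<Longrightarrow> linear_functional (\<lambda>x. f (u * x * v))"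
  by (intro linear_functionalI)
    (simp_all add: linear_functional_add linear_functional_scale distrib_left distrib_right
      mult_scaleC_left mult_scaleC_right)

lemma linear_functional_plus:
  "linear_functional f \<Longrightarrow> linear_functional g \<Longrightarrow> linear_functional (\<lambda>x. f x + g x)"
  by (simp add: linear_functional_iff algebra_simps)

lemma linear_functional_minus:
  "linear_functional f \<Longrightarrow> linear_functional g \<Longrightarrow> linear_functional (\<lambda>x. f x - g x)"
  by (simp add: linear_functional_iff algebra_simps)

lemma linear_functional_cmult: "linear_functional f \<Longrightarrow> linear_functional (\<lambda>x. c * f x)"
  by (simp add: linear_functional_iff algebra_simps)

lemma linear_functional_sum:
  "(\<And>i. i \<in> S \<Longrightarrow> linear_functional (f i)) \<Longrightarrow> linear_functional (\<lambda>x. \<Sum>i\<in>S. f i x)"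
  by (intro linear_functionalI)
    (simp_all add: linear_functional_add linear_functional_scale sum.distrib sum_distrib_left)

text \<open>The valuation \<open>e\<close> is a parameter so that the same calculus applies in the
  algebra, with \<open>snd\<close>, and in its tensor algebra, with \<open>letter\<close>.\<close>

definition centre :: "('a::complex_algebra_1 \<Rightarrow> complex) \<Rightarrow> ('b \<Rightarrow> 'a) \<Rightarrow> 'b list \<Rightarrow> 'a" where
  "centre \<psi> e r = prod_list (map e r) - \<psi> (prod_list (map e r)) *\<^sub>C 1"

text \<open>
  The value of a functional \<open>F\<close> on the tensor \<open>t\<^sub>1 \<otimes> \<dots> \<otimes> t\<^sub>m\<close>, where \<open>t\<^sub>k = r\<^sub>k - \<psi>(r\<^sub>k) 1\<close> is the
  centred version of the word \<open>r\<^sub>k\<close> in the tensor algebra. Here \<open>1\<close> is the empty word, so that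
  expanding the product deletes the words \<open>r\<^sub>k\<close>.
\<close>

fun centred_eval :: "('a::monoid_mult \<Rightarrow> complex) \<Rightarrow> ('b \<Rightarrow> 'a) \<Rightarrow> 'b list list \<Rightarrow>
    ('b list \<Rightarrow> complex) \<Rightarrow> complex" where
  "centred_eval \<psi> e [] F = F []"
| "centred_eval \<psi> e (r # rs) F =
    centred_eval \<psi> e rs (\<lambda>w. F (r @ w)) - \<psi> (prod_list (map e r)) * centred_eval \<psi> e rs F"

lemma centred_eval_append:
  "centred_eval \<psi> e (rs @ rs') F =
    centred_eval \<psi> e rs (\<lambda>w. centred_eval \<psi> e rs' (\<lambda>w'. F (w @ w')))"
  by (induction rs arbitrary: F) simp_all

lemma centred_eval_zero [simp]: "centred_eval \<psi> e rs (\<lambda>w. 0) = 0"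
  by (induction rs) simp_all

lemma centred_eval_add:
  "centred_eval \<psi> e rs (\<lambda>w. F w + G w) = centred_eval \<psi> e rs F + centred_eval \<psi> e rs G"
  by (induction rs arbitrary: F G) (simp_all add: algebra_simps)

lemma centred_eval_cmult:
  "centred_eval \<psi> e rs (\<lambda>w. c * F w) = c * centred_eval \<psi> e rs F"
  by (induction rs arbitrary: F) (simp_all add: algebra_simps)

lemma centred_eval_multc:
  "centred_eval \<psi> e rs (\<lambda>w. F w * c) = centred_eval \<psi> e rs F * c"
  using centred_eval_cmult[of \<psi> e rs c F] by (simp add: mult.commute)

lemma centred_eval_diff:
  "centred_eval \<psi> e rs (\<lambda>w. F w - G w) = centred_eval \<psi> e rs F - centred_eval \<psi> e rs G"
  using centred_eval_add[of \<psi> e rs F "\<lambda>w. - 1 * G w"]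
  unfolding centred_eval_cmult by simp

lemma centred_eval_sum:
  "centred_eval \<psi> e rs (\<lambda>w. \<Sum>i<n. F i w) = (\<Sum>i<n. centred_eval \<psi> e rs (F i))" for n :: nat
  by (induction n) (simp_all add: centred_eval_add)

lemma centred_eval_commute:
  "centred_eval \<psi> e rs (\<lambda>w. centred_eval \<psi> e rs' (\<lambda>w'. F w w')) =
    centred_eval \<psi> e rs' (\<lambda>w'. centred_eval \<psi> e rs (\<lambda>w. F w w'))"
  by (induction rs arbitrary: F) (simp_all add: centred_eval_diff centred_eval_cmult)

lemma centred_eval_cong:
  assumes "\<And>w. set w \<subseteq> set (concat rs) \<Longrightarrow> length w \<le> length (concat rs) \<Longrightarrow> F w = G w"
  shows "centred_eval \<psi> e rs F = centred_eval \<psi> e rs G"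
  using assms
proof (induction rs arbitrary: F G)
  case (Cons r rs)
  have "centred_eval \<psi> e rs (\<lambda>w. F (r @ w)) = centred_eval \<psi> e rs (\<lambda>w. G (r @ w))"
  proof (rule Cons.IH)
    fix w assume "set w \<subseteq> set (concat rs)" "length w \<le> length (concat rs)"
    then show "F (r @ w) = G (r @ w)" by (intro Cons.prems) auto
  qed
  moreover have "centred_eval \<psi> e rs F = centred_eval \<psi> e rs G"
  proof (rule Cons.IH)
    fix w assume "set w \<subseteq> set (concat rs)" "length w \<le> length (concat rs)"
    then show "F w = G w" by (intro Cons.prems) auto
  qed
  ultimately show ?case by simp
qed simp

text \<open>Every other term of the expansion deletes at least one nonempty run, so \<open>F\<close>
  sees a shorter word there.\<close>

lemma centred_eval_top:
  assumes "\<And>r. r \<in> set rs \<Longrightarrow> r \<noteq> []"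
    and "\<And>w. set w \<subseteq> set (concat rs) \<Longrightarrow> length w < length (concat rs) \<Longrightarrow> F w = 0"
  shows "centred_eval \<psi> e rs F = F (concat rs)"
  using assms
proof (induction rs arbitrary: F)
  case (Cons r rs)
  have "r \<noteq> []" using Cons.prems(1) by auto
  then have "centred_eval \<psi> e rs F = centred_eval \<psi> e rs (\<lambda>w. 0)"
  proof (intro centred_eval_cong)
    fix w assume "set w \<subseteq> set (concat rs)" "length w \<le> length (concat rs)"
    moreover from this have "length w < length (concat (r # rs))"
      using \<open>r \<noteq> []\<close> by (cases r) auto
    ultimately show "F w = 0" by (intro Cons.prems(2)) auto
  qed
  moreover have "centred_eval \<psi> e rs (\<lambda>w. F (r @ w)) = F (r @ concat rs)"
  proof (rule Cons.IH)
    fix w assume "set w \<subseteq> set (concat rs)" "length w < length (concat rs)"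
    then show "F (r @ w) = 0" by (intro Cons.prems(2)) auto
  qed (use Cons.prems(1) in auto)
  ultimately show ?case by simp
qed simp

text \<open>If the functional only sees the product in the algebra, deleting a run with coefficient
  -\<psi> amounts to inserting the centred element.\<close>

lemma centred_eval_linear:
  assumes f: "linear_functional f"
  shows "centred_eval \<psi> e rs (\<lambda>w. f (u * prod_list (map e w) * v)) =
    f (u * prod_list (map (centre \<psi> e) rs) * v)"
proof (induction rs arbitrary: u)
  case (Cons r rs)
  let ?c = "prod_list (map (centre \<psi> e) rs)" and ?r = "prod_list (map e r)"
  have "centred_eval \<psi> e (r # rs) (\<lambda>w. f (u * prod_list (map e w) * v)) =
      f (u * ?r * ?c * v) - \<psi> ?r * f (u * ?c * v)"
    using Cons[of "u * ?r"] Cons[of u] by (simp add: mult.assoc)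
  also have "\<dots> = f (u * ?r * ?c * v - \<psi> ?r *\<^sub>C (u * ?c * v))"
    using f by (simp add: linear_functional_diff linear_functional_scale)
  also have "u * ?r * ?c * v - \<psi> ?r *\<^sub>C (u * ?c * v) = u * (centre \<psi> e r * ?c) * v"
    by (simp add: centre_def algebra_simps mult_scaleC_left mult_scaleC_right)
  finally show ?case by simp
qed simp

section \<open>Scans of runs and of words\<close>

lemma scan_append: "scan \<psi> e K c g (r @ w) = scan \<psi> e (\<lambda>c g. scan \<psi> e K c g w) c g r"
  by (induction r arbitrary: c g) simp_all

lemma scan_add:
  "scan \<psi> e (\<lambda>c g. K c g + K' c g) c g w = scan \<psi> e K c g w + scan \<psi> e K' c g w"
  by (induction w arbitrary: c g) (simp_all add: algebra_simps)

lemma scan_cmult: "scan \<psi> e (\<lambda>c g. k * K c g) c g w = k * scan \<psi> e K c g w"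
  by (induction w arbitrary: c g) (simp_all add: algebra_simps)

lemma scan_zero [simp]: "scan \<psi> e (\<lambda>c g. 0) c g w = 0"
  by (induction w arbitrary: c g) simp_all

lemma scan_prefix: "scan \<psi> e K (c @ d) g w = scan \<psi> e (\<lambda>d. K (c @ d)) d g w"
  by (induction w arbitrary: d g) simp_all

lemma scan_linear:
  assumes "linear_functional \<psi>" "\<And>c. linear_functional (K c)"
  shows "linear_functional (\<lambda>g. scan \<psi> e K c g w)"
proof (induction w arbitrary: c)
  case Nil
  then show ?case using assms(2) by simp
next
  case (Cons x w)
  have "linear_functional (\<lambda>g. scan \<psi> e K c (1 * g * e x) w)"
    using linear_functional_mult[OF Cons, where u = 1] .
  moreover have "linear_functional (\<lambda>g. scan \<psi> e K (c @ [x]) 1 w * \<psi> g)"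
    by (rule linear_functional_cmult[OF assms(1)])
  ultimately show ?case by (simp add: linear_functional_plus mult.commute)
qed

lemma scan_centred_eval:
  "centred_eval \<psi> e rs (\<lambda>w. scan \<psi>' e' (\<lambda>c g. H c g w) c g r) =
    scan \<psi>' e' (\<lambda>c g. centred_eval \<psi> e rs (H c g)) c g r"
  by (induction r arbitrary: c g) (simp_all add: centred_eval_add centred_eval_cmult)

text \<open>\<open>B\<close> is an invariant of the gap product. Within a run of one colour it is
  the algebra of that colour, so facts valid only there may be used under the scan.\<close>

lemma scan_cong:
  assumes "1 \<in> B" "g \<in> B" "\<And>x h. x \<in> set w \<Longrightarrow> h \<in> B \<Longrightarrow> h * e x \<in> B"
    and "\<And>d h. set d \<subseteq> set w \<Longrightarrow> length d \<le> length w \<Longrightarrow> h \<in> B \<Longrightarrow> K (c @ d) h = K' (c @ d) h"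
  shows "scan \<psi> e K c g w = scan \<psi> e K' c g w"
  using assms(2-)
proof (induction w arbitrary: c g)
  case Nil
  have "K (c @ []) g = K' (c @ []) g" by (rule Nil.prems(3)) (use Nil.prems(1) in auto)
  then show ?case by simp
next
  case (Cons x w)
  have 1: "scan \<psi> e K c (g * e x) w = scan \<psi> e K' c (g * e x) w"
  proof (rule Cons.IH)
    fix d h assume "set d \<subseteq> set w" "length d \<le> length w" "h \<in> B"
    then show "K (c @ d) h = K' (c @ d) h" by (intro Cons.prems(3)) auto
  qed (use Cons.prems(1,2) in auto)
  have 2: "scan \<psi> e K (c @ [x]) 1 w = scan \<psi> e K' (c @ [x]) 1 w"
  proof (rule Cons.IH)
    fix d h assume d: "set d \<subseteq> set w" "length d \<le> length w" "h \<in> B"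
    then show "K ((c @ [x]) @ d) h = K' ((c @ [x]) @ d) h"
      using Cons.prems(3)[of "x # d" h] by auto
  qed (use Cons.prems assms(1) in auto)
  show ?case using 1 2 by simp
qed

lemmas scan_cong_UNIV = scan_cong[of UNIV, simplified]

text \<open>Only picking every letter survives; all gaps are then empty and contribute \<psi>(1) =
  1.\<close>

lemma scan_top:
  assumes "\<psi> 1 = 1"
    and "\<And>d h. set d \<subseteq> set w \<Longrightarrow> length d < length w \<Longrightarrow> K (c @ d) h = 0"
  shows "scan \<psi> e K c 1 w = K (c @ w) 1"
proof -
  have "scan \<psi> e K c g w = (if w = [] then K c g else \<psi> g * K (c @ w) 1)" for g
    using assms(2)
  proof (induction w arbitrary: c g)
    case (Cons x w)
    have "scan \<psi> e K c (g * e x) w = scan \<psi> e (\<lambda>c g. 0) c (g * e x) w"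
    proof (rule scan_cong_UNIV)
      fix d h assume "set d \<subseteq> set w" "length d \<le> length w"
      then show "K (c @ d) h = 0" by (intro Cons.prems) auto
    qed
    moreover have "scan \<psi> e K (c @ [x]) 1 w = (if w = [] then K (c @ [x]) 1 else \<psi> 1 * K ((c @ [x]) @ w) 1)"
    proof (rule Cons.IH)
      fix d h assume "set d \<subseteq> set w" "length d < length w"
      then show "K ((c @ [x]) @ d) h = 0" using Cons.prems[of "x # d" h] by auto
    qed
    ultimately show ?case using assms(1) by simp
  qed simp
  then show ?thesis using assms(1) by simp
qed

text \<open>Picking a letter of \<open>r\<close> as the first one closes the current gap. Each such
  pick is harmless, because the gap has value 0 or because \<open>K\<close> rejects the letter;
  hence all of \<open>r\<close> joins the gap.\<close>

lemma scan_skip: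
  assumes "\<And>p x q. r = p @ x # q \<Longrightarrow> \<psi> (g * prod_list (map e p)) = 0 \<or> (\<forall>c h. x \<in> set c \<longrightarrow> K c h = 0)"
  shows "scan \<psi> e K c g (r @ w) = scan \<psi> e K c (g * prod_list (map e r)) w"
  using assms
proof (induction r arbitrary: g)
  case (Cons x r)
  have "scan \<psi> e K c (g * e x) (r @ w) = scan \<psi> e K c (g * e x * prod_list (map e r)) w"
  proof (rule Cons.IH)
    fix p y q assume "r = p @ y # q"
    then show "\<psi> (g * e x * prod_list (map e p)) = 0 \<or> (\<forall>c h. y \<in> set c \<longrightarrow> K c h = 0)"
      using Cons.prems[of "x # p" y q] by (simp add: mult.assoc)
  qed
  moreover have "\<psi> g * scan \<psi> e K (c @ [x]) 1 (r @ w) = 0"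
  proof (cases "\<psi> g = 0")
    case False
    then have K: "\<forall>c h. x \<in> set c \<longrightarrow> K c h = 0" using Cons.prems[of "[]" x r] by auto
    have "scan \<psi> e K (c @ [x]) 1 (r @ w) = scan \<psi> e (\<lambda>c g. 0) (c @ [x]) 1 (r @ w)"
      by (rule scan_cong_UNIV) (use K in auto)
    then show ?thesis by simp
  qed simp
  ultimately show ?case by (simp add: mult.assoc)
qed simp

text \<open>\<open>p\<close> is the product of the letters before the first pick. On the circle they
  follow the end of the word, so they are appended to the last gap.\<close>

fun cyclic_scan_from :: "('a::monoid_mult \<Rightarrow> complex) \<Rightarrow> ('b \<Rightarrow> 'a) \<Rightarrow> ('b list \<Rightarrow> complex) \<Rightarrow>
    'a \<Rightarrow> 'b list \<Rightarrow> complex" where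
  "cyclic_scan_from \<psi> e D p [] = 0"
| "cyclic_scan_from \<psi> e D p (x # w) =
    scan \<psi> e (\<lambda>c g. D c * \<psi> (g * p)) [x] 1 w + cyclic_scan_from \<psi> e D (p * e x) w"

lemma cyclic_scan_from_sum:
  "cyclic_scan_from \<psi> e D p w = (\<Sum>q<length w.
    scan \<psi> e (\<lambda>c g. D c * \<psi> (g * (p * prod_list (map e (take q w))))) [w ! q] 1 (drop (Suc q) w))"
proof (induction w arbitrary: p)
  case (Cons x w)
  show ?case
    unfolding cyclic_scan_from.simps Cons length_Cons
    by (subst sum.lessThan_Suc_shift) (simp add: mult.assoc)
qed simp

lemma cyclic_scan_from_add:
  "cyclic_scan_from \<psi> e (\<lambda>c. D c + D' c) p w =
    cyclic_scan_from \<psi> e D p w + cyclic_scan_from \<psi> e D' p w"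
  by (induction w arbitrary: p) (simp_all add: distrib_right scan_add)

lemma cyclic_scan_from_linear:
  assumes "linear_functional \<psi>"
  shows "linear_functional (\<lambda>p. cyclic_scan_from \<psi> e D p w)"
proof (induction w)
  case (Cons x w)
  have 1: "linear_functional (\<lambda>p. scan \<psi> e (\<lambda>c g. D c * \<psi> (g * p)) d h u)" for d h u
  proof (induction u arbitrary: d h)
    case Nil
    show ?case using linear_functional_cmult[OF linear_functional_mult[OF assms, of h 1], of "D d"] by simp
  next
    case (Cons y u)
    then show ?case by (simp add: linear_functional_plus linear_functional_cmult)
  qed
  have "linear_functional (\<lambda>p. cyclic_scan_from \<psi> e D (1 * p * e x) w)"
    using linear_functional_mult[OF Cons, where u = 1] .
  with 1 show ?case by (simp add: linear_functional_plus)
qed (simp add: linear_functional_iff)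

lemma cyclic_scan_from_top:
  assumes "\<psi> 1 = 1"
    and "\<And>d. set d \<subseteq> set w \<Longrightarrow> length d < length w \<Longrightarrow> D d = 0"
  shows "cyclic_scan_from \<psi> e D p w = (if w = [] then 0 else D w * \<psi> p)"
  using assms(2)
proof (induction w arbitrary: p)
  case (Cons x w)
  have "scan \<psi> e (\<lambda>c g. D c * \<psi> (g * p)) [x] 1 w = D ([x] @ w) * \<psi> (1 * p)"
  proof (rule scan_top[of \<psi>, OF assms(1)])
    fix d h assume "set d \<subseteq> set w" "length d < length w"
    then have "D ([x] @ d) = 0" by (intro Cons.prems) auto
    then show "D ([x] @ d) * \<psi> (h * p) = 0" by simp
  qed
  moreover have "cyclic_scan_from \<psi> e D (p * e x) w = 0"
  proof -
    have "D w = 0" by (rule Cons.prems) auto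
    moreover have "D d = 0" if "set d \<subseteq> set w" "length d < length w" for d
      using that by (intro Cons.prems) auto
    ultimately show ?thesis using Cons.IH[of "p * e x"] by simp
  qed
  ultimately show ?case by simp
qed simp

text \<open>Blocks avoiding \<open>a\<close> contribute equally to both expansions, since their
  cyclic gaps agree. What remains is a relation between the differences
  \<open>D (a # c) - D (c @ [a])\<close>, where by induction only the one for \<open>c = w\<close>
  can be nonzero.\<close>

lemma cyclic_scan_invariant:
  assumes one: "\<psi> 1 = 1"
    and inv: "\<And>a w. cyclic_scan_from \<psi> e D 1 (w @ [a]) = cyclic_scan_from \<psi> e D 1 (a # w)"
  shows "D (w @ [a]) = D (a # w)"
proof (induction w arbitrary: a rule: measure_induct_rule[where f = length])
  case (less w)
  let ?S = "\<lambda>D. scan \<psi> e (\<lambda>c g. D c * \<psi> g)"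
  have snoc: "scan \<psi> e K c g (q @ [a]) =
      scan \<psi> e (\<lambda>c g. K c (g * e a)) c g q + scan \<psi> e (\<lambda>c g. \<psi> g * K (c @ [a]) 1) c g q" for K c g q
    by (simp add: scan_append flip: scan_add)
  let ?E = "\<lambda>p w. (\<Sum>q<length w. \<psi> (p * prod_list (map e (take q w))) *
      ?S (\<lambda>c. D (c @ [a])) [w ! q] 1 (drop (Suc q) w))"
  \<comment> \<open>The three terms: \<open>a\<close> is not picked and falls into the last gap;
    \<open>a\<close> is the last of several picks; \<open>a\<close> is the only pick.\<close>
  have right: "cyclic_scan_from \<psi> e D p (w @ [a]) =
      cyclic_scan_from \<psi> e D (e a * p) w + ?E p w + D [a] * \<psi> (p * prod_list (map e w))" for p w
  proof (induction w arbitrary: p)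
    case (Cons x w)
    have "scan \<psi> e (\<lambda>c g. D c * \<psi> (g * p)) [x] 1 (w @ [a]) =
        scan \<psi> e (\<lambda>c g. D c * \<psi> (g * (e a * p))) [x] 1 w +
        \<psi> p * ?S (\<lambda>c. D (c @ [a])) [x] 1 w"
      unfolding snoc by (simp add: mult.assoc mult_ac flip: scan_cmult)
    moreover have "?E p (x # w) = \<psi> p * ?S (\<lambda>c. D (c @ [a])) [x] 1 w + ?E (p * e x) w"
      unfolding length_Cons by (subst sum.lessThan_Suc_shift) (simp add: mult.assoc)
    ultimately show ?case using Cons[of "p * e x"] by (simp add: mult.assoc)
  qed simp
  have "scan \<psi> e (\<lambda>c g. D c * \<psi> (g * 1)) [a] 1 w = D [a] * \<psi> (prod_list (map e w)) +
      (\<Sum>q<length w. \<psi> (prod_list (map e (take q w))) *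
         ?S (\<lambda>c. D (a # c)) [w ! q] 1 (drop (Suc q) w))"
    using scan_prefix[of \<psi> e "\<lambda>c g. D c * \<psi> g" "[a]"] by (subst scan_unroll) simp
  then have eq: "(\<Sum>q<length w. \<psi> (prod_list (map e (take q w))) *
        ?S (\<lambda>c. D (a # c)) [w ! q] 1 (drop (Suc q) w)) = ?E 1 w"
    using inv[of w a] right[of 1 w] by simp
  define \<delta> where "\<delta> c = D (a # c) - D (c @ [a])" for c
  have scan_diff: "?S (\<lambda>c. D (a # c)) c g u - ?S (\<lambda>c. D (c @ [a])) c g u =
      ?S \<delta> c g u" for c g u
    using scan_add[of \<psi> e "\<lambda>c g. \<delta> c * \<psi> g" "\<lambda>c g. D (c @ [a]) * \<psi> g" c g u]
    by (simp add: \<delta>_def left_diff_distrib)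
  then have sum0: "(\<Sum>q<length w. \<psi> (prod_list (map e (take q w))) *
        ?S \<delta> [w ! q] 1 (drop (Suc q) w)) = 0"
  proof -
    have "(\<Sum>q<length w. \<psi> (prod_list (map e (take q w))) *
        (?S (\<lambda>c. D (a # c)) [w ! q] 1 (drop (Suc q) w) -
         ?S (\<lambda>c. D (c @ [a])) [w ! q] 1 (drop (Suc q) w))) = 0"
      using eq by (simp add: right_diff_distrib sum_subtractf)
    then show ?thesis by (simp only: scan_diff)
  qed
  have \<delta>0: "\<delta> c = 0" if "length c < length w" for c
    using less.IH[OF that, of a] by (simp add: \<delta>_def)
  show ?case
  proof (cases w)
    case (Cons x u)
    \<comment> \<open>Starting at a later position leaves too few letters, so only
      \<open>q = 0\<close> can reach the full word.\<close>
    have "?S \<delta> [w ! q] 1 (drop (Suc q) w) = (if q = 0 then \<delta> w else 0)"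
      if "q < length w" for q
    proof (cases "q = 0")
      case True
      have "?S \<delta> [x] 1 u = \<delta> ([x] @ u) * \<psi> 1"
        by (rule scan_top[of \<psi>, OF one]) (use \<delta>0 Cons in auto)
      then show ?thesis using True Cons one by simp
    next
      case False
      have "?S \<delta> [w ! q] 1 (drop (Suc q) w) =
          scan \<psi> e (\<lambda>c g. 0) [w ! q] 1 (drop (Suc q) w)"
        by (rule scan_cong_UNIV) (use \<delta>0 False that in auto)
      then show ?thesis using False by simp
    qed
    then have "(\<Sum>q<length w. \<psi> (prod_list (map e (take q w))) *
        ?S \<delta> [w ! q] 1 (drop (Suc q) w)) =
        (\<Sum>q<length w. if q = 0 then \<delta> w else 0)"
      by (intro sum.cong refl) (auto simp: one)
    also have "\<dots> = \<delta> w" using Cons by (simp add: sum.delta)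
    finally show ?thesis using sum0 by (simp add: \<delta>_def)
  qed simp
qed

section \<open>Freeness and vanishing mixed cumulants\<close>

text \<open>Each letter carries its index, because one element, for instance 1, may lie in several
  of the subalgebras.\<close>

definition mixed :: "('i \<times> 'a) list \<Rightarrow> bool" where
  "mixed c \<longleftrightarrow> (\<exists>x\<in>set c. \<exists>y\<in>set c. fst x \<noteq> fst y)"

definition runs :: "('i \<Rightarrow> 'a set) \<Rightarrow> 'i list \<Rightarrow> ('i \<times> 'a) list list \<Rightarrow> bool" where
  "runs A js rs \<longleftrightarrow> list_all2 (\<lambda>j r. set r \<subseteq> {j} \<times> A j) js rs"

lemma cfree_cumulant_mixed:
  "mixed c \<Longrightarrow> cfree_cumulant \<psi> \<psi> (map snd c) = free_cumulant \<psi> (map snd c)"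
  by (rule cfree_cumulant_same) (auto simp: mixed_def)

lemma mixed_vanish_iff:
  "mixed_vanish I A \<kappa> \<longleftrightarrow> (\<forall>c. set c \<subseteq> Sigma I A \<and> mixed c \<longrightarrow> \<kappa> (map snd c) = 0)"
proof (intro iffI allI impI)
  fix c :: "('a \<times> 'b) list"
  assume *: "mixed_vanish I A \<kappa>" "set c \<subseteq> Sigma I A \<and> mixed c"
  have "set (map fst c) \<subseteq> I" "list_all2 (\<lambda>j a. a \<in> A j) (map fst c) (map snd c)"
    "\<exists>j\<in>set (map fst c). \<exists>j'\<in>set (map fst c). j \<noteq> j'"
    using *(2) by (auto simp: mixed_def list_all2_conv_all_nth subset_iff)
  then show "\<kappa> (map snd c) = 0"
    using *(1) unfolding mixed_vanish_def by blast
next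
  assume *: "\<forall>c. set c \<subseteq> Sigma I A \<and> mixed c \<longrightarrow> \<kappa> (map snd c) = 0"
  show "mixed_vanish I A \<kappa>"
    unfolding mixed_vanish_def
  proof (intro allI impI)
    fix js as
    assume a: "set js \<subseteq> I \<and> list_all2 (\<lambda>j a. a \<in> A j) js as \<and> (\<exists>j\<in>set js. \<exists>j'\<in>set js. j \<noteq> j')"
    then have len: "length js = length as" by (auto dest: list_all2_lengthD)
    have "set (zip js as) \<subseteq> Sigma I A"
      using a len by (auto simp: set_zip list_all2_conv_all_nth)
    moreover have "mixed (zip js as)"
    proof -
      obtain j j' where j: "j \<in> set js" "j' \<in> set js" "j \<noteq> j'" using a by blast
      have "set js = fst ` set (zip js as)" using len by (metis list.set_map map_fst_zip)
      with j obtain x y where xy: "x \<in> set (zip js as)" "y \<in> set (zip js as)" "fst x = j" "fst y = j'"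
        by auto
      then have "fst x \<noteq> fst y" using j(3) by simp
      then show ?thesis using xy(1,2) unfolding mixed_def by blast
    qed
    ultimately have "\<kappa> (map snd (zip js as)) = 0" using * by blast
    then show "\<kappa> as = 0" using len by simp
  qed
qed

lemma runs_Nil [simp]: "runs A [] rs \<longleftrightarrow> rs = []" "runs A js [] \<longleftrightarrow> js = []"
  by (simp_all add: runs_def)

lemma runs_Cons [simp]:
  "runs A (j # js) (r # rs) \<longleftrightarrow> set r \<subseteq> {j} \<times> A j \<and> runs A js rs"
  by (simp add: runs_def)

lemma runs_append: "runs A js rs \<Longrightarrow> runs A js' rs' \<Longrightarrow> runs A (js @ js') (rs @ rs')"
  by (simp add: runs_def list_all2_appendI)

lemma runs_appendE:
  assumes "runs A js (rs @ rs')"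
  obtains js1 js2 where "js = js1 @ js2" "runs A js1 rs" "runs A js2 rs'"
  using assms unfolding runs_def by (auto simp: list_all2_append2)

lemma runs_ConsE:
  assumes "runs A js (r # rs)"
  obtains j js' where "js = j # js'" "set r \<subseteq> {j} \<times> A j" "runs A js' rs"
  using assms by (cases js) (auto simp: runs_def)

lemma runs_length: "runs A js rs \<Longrightarrow> length js = length rs"
  by (simp add: runs_def list_all2_lengthD)

lemma runs_set: "runs A js rs \<Longrightarrow> set js \<subseteq> I \<Longrightarrow> set (concat rs) \<subseteq> Sigma I A"
proof (induction rs arbitrary: js)
  case (Cons r rs)
  then show ?case by (elim runs_ConsE) (auto 4 3)
qed simp

lemma runs_exist:
  assumes "set w \<subseteq> Sigma I A" "w \<noteq> []"
  obtains js rs where "runs A js rs" "concat rs = w" "\<And>r. r \<in> set rs \<Longrightarrow> r \<noteq> []"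
    "distinct_adj js" "set js \<subseteq> I" "js \<noteq> []" "hd js = fst (hd w)" "last js = fst (last w)"
proof -
  have "\<exists>js rs. runs A js rs \<and> concat rs = w \<and> (\<forall>r\<in>set rs. r \<noteq> []) \<and>
      distinct_adj js \<and> set js \<subseteq> I \<and> js \<noteq> [] \<and> hd js = fst (hd w) \<and> last js = fst (last w)"
    using assms
  proof (induction w)
    case (Cons x w)
    show ?case
    proof (cases "w = []")
      case True
      then show ?thesis
        using Cons.prems by (intro exI[of _ "[fst x]"] exI[of _ "[[x]]"]) auto
    next
      case False
      then obtain js rs where *: "runs A js rs" "concat rs = w" "\<forall>r\<in>set rs. r \<noteq> []"
        "distinct_adj js" "set js \<subseteq> I" "js \<noteq> []" "hd js = fst (hd w)" "last js = fst (last w)"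
        using Cons by auto
      obtain j js' where js: "js = j # js'" using *(6) by (cases js) auto
      then obtain r rs' where rs: "rs = r # rs'" using *(1) by (cases rs) auto
      have x: "fst x \<in> I" "snd x \<in> A (fst x)" using Cons.prems by auto
      show ?thesis
      proof (cases "fst x = j")
        case True
        have "set (x # r) \<subseteq> {j} \<times> A j" using * js rs x True by (cases x) auto
        then show ?thesis using * js rs True False
          by (intro exI[of _ js] exI[of _ "(x # r) # rs'"]) auto
      next
        case neq: False
        have "set [x] \<subseteq> {fst x} \<times> A (fst x)" using x by (cases x) auto
        then show ?thesis using * js x neq False
          by (intro exI[of _ "fst x # js"] exI[of _ "[x] # rs"]) auto
      qed
    qed
  qed simp
  then show ?thesis using that by blast
qed

text \<open>The colours are read once around the circle, from \<open>i\<close> back to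
  \<open>i\<close>.\<close>

lemma distinct_adj_cyclic:
  assumes "distinct_adj (ks @ i # js)" "2 \<le> length (ks @ i # js)" "last (ks @ i # js) \<noteq> hd (ks @ i # js)"
  shows "distinct_adj (i # (js @ ks) @ [i])"
  using assms
  by (cases ks; cases js)
    (auto simp: distinct_adj_append_iff distinct_adj_Cons hd_append last_append split: if_splits)

section \<open>Alternating products and the effect of freeness on scans\<close>

locale subalgebra_family =
  fixes I :: "'i set" and A :: "'i \<Rightarrow> 'a::complex_algebra_1 set" and \<psi> :: "'a \<Rightarrow> complex"
  assumes unital: "unital_functional \<psi>"
    and subalgebra: "\<And>i. i \<in> I \<Longrightarrow> unital_subalgebra (A i)"
begin

abbreviation val :: "('i \<times> 'a) list \<Rightarrow> 'a" where
  "val w \<equiv> prod_list (map snd w)"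

abbreviation cen :: "('i \<times> 'a) list \<Rightarrow> 'a" where
  "cen \<equiv> centre \<psi> snd"

abbreviation ceval :: "('i \<times> 'a) list list \<Rightarrow> (('i \<times> 'a) list \<Rightarrow> complex) \<Rightarrow> complex" where
  "ceval \<equiv> centred_eval \<psi> snd"

abbreviation elems :: "'i list \<Rightarrow> 'a list \<Rightarrow> bool" where
  "elems \<equiv> list_all2 (\<lambda>j a. a \<in> A j)"

lemma linear_psi: "linear_functional \<psi>" and psi_one [simp]: "\<psi> 1 = 1"
  using unital by (simp_all add: unital_functional_def)

lemma one_in: "i \<in> I \<Longrightarrow> 1 \<in> A i"
  and mult_in: "i \<in> I \<Longrightarrow> x \<in> A i \<Longrightarrow> y \<in> A i \<Longrightarrow> x * y \<in> A i"
  using subalgebra[of i] by (auto simp: unital_subalgebra_def)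

lemma diff_scaleC_in: "i \<in> I \<Longrightarrow> x \<in> A i \<Longrightarrow> x - c *\<^sub>C 1 \<in> A i"
  using subalgebra[of i] unfolding unital_subalgebra_def
  by (intro complex_vector.subspace_diff complex_vector.subspace_scale) auto

lemma run_val: "i \<in> I \<Longrightarrow> set r \<subseteq> {i} \<times> A i \<Longrightarrow> val r \<in> A i"
  by (induction r) (auto simp: one_in mult_in)

lemma run_cen: "i \<in> I \<Longrightarrow> set r \<subseteq> {i} \<times> A i \<Longrightarrow> cen r \<in> A i"
  by (simp add: centre_def diff_scaleC_in run_val)

lemma psi_centred: "\<psi> (x - \<psi> x *\<^sub>C 1) = 0"
  by (simp add: linear_functional_simps[OF linear_psi])

lemma psi_cen [simp]: "\<psi> (cen r) = 0"
  by (simp add: centre_def psi_centred)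

text \<open>Recombines the two terms of \<open>centred_eval\<close> for a run, once the run has been
  moved into an argument in which \<open>f\<close> is linear.\<close>

lemma linear_cen:
  assumes "linear_functional f"
  shows "f (u * val r) - \<psi> (val r) * f u = f (u * cen r)"
proof -
  have "u * cen r = u * val r - \<psi> (val r) *\<^sub>C u"
    by (simp add: centre_def algebra_simps mult_scaleC_right)
  then show ?thesis
    by (simp add: linear_functional_simps[OF assms])
qed

lemma centered_cen: "centered \<psi> (map cen rs)"
  by (auto simp: centered_def)

lemma runs_elems: "runs A js rs \<Longrightarrow> set js \<subseteq> I \<Longrightarrow> elems js (map cen rs)"
proof (induction rs arbitrary: js)
  case (Cons r rs)
  then show ?case by (elim runs_ConsE) (auto simp: run_cen)
qed simp

text \<open>For \<psi> itself the factorised value is 0, since the words are nonempty and centred.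
  One notion thus covers freeness and the condition on \<phi>.\<close>

definition multiplicative :: "('a \<Rightarrow> complex) \<Rightarrow> bool" where
  "multiplicative f \<longleftrightarrow> linear_functional f \<and> f 1 = 1 \<and>
    (\<forall>js as. alternating I A js as \<and> centered \<psi> as \<longrightarrow> f (prod_list as) = prod_list (map f as))"

lemma multiplicative_prod:
  assumes "multiplicative f" "distinct_adj js" "set js \<subseteq> I" "elems js as" "centered \<psi> as"
  shows "f (prod_list as) = prod_list (map f as)"
proof (cases "as = []")
  case False
  then show ?thesis using assms unfolding multiplicative_def alternating_def by blast
qed (use assms in \<open>simp add: multiplicative_def\<close>)

text \<open>The first factor may be uncentred: its scalar part leaves a shorter alternating product,
  which factorises as well.\<close>

lemma multiplicative_left:
  assumes f: "multiplicative f" and js: "distinct_adj (j # js)" "set (j # js) \<subseteq> I"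
    and s: "s \<in> A j" and as: "elems js as" "centered \<psi> as"
  shows "f (s * prod_list as) = f s * prod_list (map f as)"
proof -
  have lin: "linear_functional f" and f1: "f 1 = 1" using f by (simp_all add: multiplicative_def)
  define s' where "s' = s - \<psi> s *\<^sub>C 1"
  have s': "s' \<in> A j" "\<psi> s' = 0" using js s by (simp_all add: s'_def diff_scaleC_in psi_centred)
  have "f (prod_list (s' # as)) = prod_list (map f (s' # as))"
    by (rule multiplicative_prod[OF f js]) (use s' as in \<open>auto simp: centered_def\<close>)
  moreover have "f (prod_list as) = prod_list (map f as)"
    by (rule multiplicative_prod[OF f _ _ as]) (use js in \<open>auto dest: distinct_adj_ConsD\<close>)
  moreover have "s * prod_list as = s' * prod_list as + \<psi> s *\<^sub>C prod_list as"
    by (simp add: s'_def algebra_simps mult_scaleC_left)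
  moreover have "f s = f s' + \<psi> s"
    by (simp add: s'_def linear_functional_simps[OF lin] f1)
  ultimately show ?thesis
    by (simp add: linear_functional_simps[OF lin] algebra_simps)
qed

lemma multiplicative_ends:
  assumes f: "multiplicative f" and js: "distinct_adj (j # js @ [k])" "set (j # js @ [k]) \<subseteq> I"
    and s: "s \<in> A j" and p: "p \<in> A k" and as: "elems js as" "centered \<psi> as"
  shows "f (s * prod_list as * p) = f s * prod_list (map f as) * f p"
proof -
  have lin: "linear_functional f" and f1: "f 1 = 1" using f by (simp_all add: multiplicative_def)
  define p' where "p' = p - \<psi> p *\<^sub>C 1"
  have p': "p' \<in> A k" "\<psi> p' = 0" using js p by (simp_all add: p'_def diff_scaleC_in psi_centred)
  have "f (s * prod_list (as @ [p'])) = f s * prod_list (map f (as @ [p']))"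
    by (rule multiplicative_left[OF f js s])
      (use p' as in \<open>auto simp: centered_def intro: list_all2_appendI\<close>)
  moreover have "f (s * prod_list as) = f s * prod_list (map f as)"
  proof (rule multiplicative_left[OF f _ _ s as])
    show "distinct_adj (j # js)" using js(1) by (metis append_Cons distinct_adj_appendD1)
  qed (use js in auto)
  moreover have "s * prod_list as * p = s * prod_list as * p' + \<psi> p *\<^sub>C (s * prod_list as)"
    by (simp add: p'_def algebra_simps mult_scaleC_right)
  moreover have "f p = f p' + \<psi> p"
    by (simp add: p'_def linear_functional_simps[OF lin] f1)
  ultimately show ?thesis
    by (simp add: linear_functional_simps[OF lin] algebra_simps)
qed

end

locale free_family = subalgebra_family +
  assumes free: "multiplicative \<psi>"
begin

lemma psi_ends:
  assumes "distinct_adj (j # js @ [k])" "set (j # js @ [k]) \<subseteq> I" "s \<in> A j" "p \<in> A k"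
    "elems js as" "centered \<psi> as" "as \<noteq> []"
  shows "\<psi> (s * prod_list as * p) = 0"
proof -
  obtain a as' where "as = a # as'" using assms(7) by (cases as) auto
  then have "prod_list (map \<psi> as) = 0" using assms(6) by (simp add: centered_def)
  then show ?thesis using multiplicative_ends[OF free assms(1-6)] by simp
qed

text \<open>
  Once the first picked letter has colour \<open>j\<close>, a further pick in a later run would leave a gap
  that starts in \<open>A j\<close>, continues with centred alternating elements and ends in \<open>A j\<close>; \<open>\<psi>\<close>
  vanishes on it.
\<close>

lemma ceval_scan:
  assumes lin: "\<And>c. linear_functional (K c)"
    and supp: "\<And>c g x. x \<in> set c \<Longrightarrow> fst x \<noteq> j \<Longrightarrow> K c g = 0"
    and s: "s \<in> A j"
    and "runs A js rs" "distinct_adj (j # ks @ js)" "set (j # ks @ js) \<subseteq> I"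
      "elems ks ts" "centered \<psi> ts"
  shows "ceval rs (\<lambda>w. scan \<psi> snd K c (s * prod_list ts) w) =
    K c (s * prod_list ts * prod_list (map cen rs))"
  using assms(4-)
proof (induction rs arbitrary: js ks ts)
  case (Cons r rs)
  from Cons.prems(1) obtain i js' where js: "js = i # js'" and r: "set r \<subseteq> {i} \<times> A i"
    and rs: "runs A js' rs" by (rule runs_ConsE)
  have i: "i \<in> I" using Cons.prems js by auto
  let ?g = "s * prod_list ts"
  have step: "scan \<psi> snd K c ?g (r @ w) = scan \<psi> snd K c (?g * val r) w" for w
  proof (rule scan_skip)
    fix p x q assume pq: "r = p @ x # q"
    show "\<psi> (?g * val p) = 0 \<or> (\<forall>c h. x \<in> set c \<longrightarrow> K c h = 0)"
    proof (cases "i = j")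
      case True
      then have "ks \<noteq> []" using Cons.prems(2) js by auto
      then have "ts \<noteq> []" using Cons.prems(4) by auto
      have "distinct_adj ((j # ks @ [i]) @ js')" using Cons.prems(2) js by simp
      then have "distinct_adj (j # ks @ [i])" by (rule distinct_adj_appendD1)
      moreover have "val p \<in> A i" using r pq by (intro run_val[OF i]) auto
      ultimately have "\<psi> (?g * val p) = 0"
        using psi_ends[of j ks i s "val p" ts] Cons.prems(3-5) js s \<open>ts \<noteq> []\<close> by simp
      then show ?thesis ..
    next
      case False
      have "fst x = i" using r pq by auto
      then show ?thesis using supp False by blast
    qed
  qed
  \<comment> \<open>The kept run and the deleted run now differ only in the gap argument, where
    linearity merges them into the centred run.\<close>
  note comb = linear_cen[OF scan_linear[OF linear_psi lin]]
  have "ceval (r # rs) (\<lambda>w. scan \<psi> snd K c ?g w) =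
      ceval rs (\<lambda>w. scan \<psi> snd K c (?g * val r) w - \<psi> (val r) * scan \<psi> snd K c ?g w)"
    by (simp add: step centred_eval_diff centred_eval_cmult)
  also have "\<dots> = ceval rs (\<lambda>w. scan \<psi> snd K c (s * prod_list (ts @ [cen r])) w)"
  proof -
    have "s * prod_list (ts @ [cen r]) = ?g * cen r" by (simp add: mult.assoc)
    then show ?thesis by (simp only: comb)
  qed
  also have "\<dots> = K c (s * prod_list (ts @ [cen r]) * prod_list (map cen rs))"
  proof (rule Cons.IH[OF rs])
    show "elems (ks @ [i]) (ts @ [cen r])"
      using Cons.prems(4) run_cen[OF i r] by (intro list_all2_appendI) auto
    show "centered \<psi> (ts @ [cen r])" using Cons.prems(5) by (auto simp: centered_def)
  qed (use Cons.prems js in auto)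
  finally show ?case by (simp add: mult.assoc)
qed simp

text \<open>Picks are confined to \<open>r\<close>. The later runs all join the last gap, each
  through its centred value.\<close>

lemma ceval_scan_run:
  assumes lin: "\<And>c. linear_functional (K c)"
    and supp: "\<And>c g x. x \<in> set c \<Longrightarrow> fst x \<noteq> j \<Longrightarrow> K c g = 0"
    and r: "set r \<subseteq> {j} \<times> A j"
    and rs: "runs A js rs" "distinct_adj (j # js)" "set (j # js) \<subseteq> I"
  shows "ceval rs (\<lambda>w. scan \<psi> snd K c 1 (r @ w)) =
    scan \<psi> snd (\<lambda>c g. K c (g * prod_list (map cen rs))) c 1 r"
proof -
  have j: "j \<in> I" using rs(3) by simp
  have "ceval rs (\<lambda>w. scan \<psi> snd K c 1 (r @ w)) =
      scan \<psi> snd (\<lambda>c g. ceval rs (\<lambda>w. scan \<psi> snd K c g w)) c 1 r"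
    by (simp add: scan_append scan_centred_eval)
  also have "\<dots> = scan \<psi> snd (\<lambda>c g. K c (g * prod_list (map cen rs))) c 1 r"
  proof (rule scan_cong[of "A j"])
    fix d h assume "h \<in> A j"
    then show "ceval rs (\<lambda>w. scan \<psi> snd K (c @ d) h w) = K (c @ d) (h * prod_list (map cen rs))"
      using ceval_scan[OF lin supp _ rs(1), where s = h and ks = "[]" and ts = "[]" and c = "c @ d"] rs
      by (simp add: centered_def)
  qed (use one_in[OF j] mult_in[OF j] r in auto)
  finally show ?thesis .
qed

text \<open>\<open>ts\<close> holds the centred runs passed before any pick. If the first pick has
  colour \<open>i\<close>, the whole block lies in one run; its last gap goes round the circle from
  \<open>A i\<close> through all the other centred runs back into \<open>A i\<close>, where \<psi>
  vanishes by \<open>psi_ends\<close>.\<close>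

lemma ceval_cyclic_scan_zero:
  assumes D: "\<And>c. set c \<subseteq> Sigma I A \<Longrightarrow> mixed c \<Longrightarrow> D c = 0"
    and "runs A js rs" "elems ks ts" "centered \<psi> ts" "distinct_adj (ks @ js)" "set (ks @ js) \<subseteq> I"
      "2 \<le> length (ks @ js)" "last (ks @ js) \<noteq> hd (ks @ js)"
  shows "ceval rs (\<lambda>w. cyclic_scan_from \<psi> snd D (prod_list ts) w) = 0"
  using assms(2-)
proof (induction rs arbitrary: js ks ts)
  case (Cons r rs)
  from Cons.prems(1) obtain i js' where js: "js = i # js'" and r: "set r \<subseteq> {i} \<times> A i"
    and rs: "runs A js' rs" by (rule runs_ConsE)
  have i: "i \<in> I" using Cons.prems js by auto
  let ?T = "prod_list ts" and ?Z = "cyclic_scan_from \<psi> snd D"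
  define cs where "cs = map cen rs @ ts"
  have d1: "distinct_adj (i # js')" using Cons.prems(4) js by auto
  have d2: "distinct_adj (i # (js' @ ks) @ [i])"
    by (rule distinct_adj_cyclic) (use Cons.prems(4,6,7) js in auto)
  have el: "elems (js' @ ks) cs"
    unfolding cs_def using runs_elems[OF rs] Cons.prems(2,5) js by (intro list_all2_appendI) auto
  have ce: "centered \<psi> cs" using Cons.prems(3) by (auto simp: cs_def centered_def)
  have ne: "cs \<noteq> []"
  proof -
    have "length cs = length (js' @ ks)" using list_all2_lengthD[OF el] by simp
    then show ?thesis using Cons.prems(6) js by auto
  qed
  \<comment> \<open>The current run is absorbed letter by letter; \<open>p\<close> is the part of it
    lying before the possible first pick.\<close>
  have in_run: "ceval rs (\<lambda>w. ?Z (?T * p) (q @ w)) =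
      ceval rs (\<lambda>w. ?Z (?T * p * val q) w)"
    if "p \<in> A i" "set q \<subseteq> {i} \<times> A i" for p q
    using that
  proof (induction q arbitrary: p)
    case (Cons x q)
    \<comment> \<open>The picked \<open>x\<close> has colour \<open>i\<close>, so any other colour
      in the block makes it mixed. Restricting \<open>D\<close> to colour \<open>i\<close> therefore
      changes nothing, and it provides the support condition of
      \<open>ceval_scan_run\<close>.\<close>
    define D' where "D' c = (if \<forall>y\<in>set c. fst y = i then D c else 0)" for c
    have x: "fst x = i" "snd x \<in> A i" using Cons.prems(2) by auto
    have "ceval rs (\<lambda>w. scan \<psi> snd (\<lambda>c g. D c * \<psi> (g * (?T * p))) [x] 1 (q @ w)) =
        ceval rs (\<lambda>w. scan \<psi> snd (\<lambda>c g. D' c * \<psi> (g * (?T * p))) [x] 1 (q @ w))"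
    proof (rule centred_eval_cong, rule scan_cong_UNIV)
      fix w d h assume "set w \<subseteq> set (concat rs)" "set d \<subseteq> set (q @ w)"
      moreover have "set (concat rs) \<subseteq> Sigma I A"
        using runs_set[OF rs] \<open>set (ks @ js) \<subseteq> I\<close> js by auto
      moreover have "set (x # q) \<subseteq> Sigma I A" using Cons.prems(2) i by auto
      ultimately have "set d \<subseteq> Sigma I A" "x \<in> Sigma I A" by (auto dest!: subsetD)
      then have "set ([x] @ d) \<subseteq> Sigma I A" by simp
      then have "D ([x] @ d) = D' ([x] @ d)"
        using D[of "[x] @ d"] x(1) by (auto simp: D'_def mixed_def)
      then show "D ([x] @ d) * \<psi> (h * (?T * p)) = D' ([x] @ d) * \<psi> (h * (?T * p))" by simp
    qed
    also have "\<dots> = scan \<psi> snd (\<lambda>c g. D' c * \<psi> (g * prod_list (map cen rs) * (?T * p))) [x] 1 q"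
    proof (rule ceval_scan_run[OF _ _ _ rs d1])
      show "linear_functional (\<lambda>g. D' c * \<psi> (g * (?T * p)))" for c
        using linear_functional_cmult[OF linear_functional_mult[OF linear_psi, of 1 "?T * p"]] by simp
    qed (use Cons.prems js i \<open>set (ks @ js) \<subseteq> I\<close> in \<open>auto simp: D'_def\<close>)
    also have "\<dots> = scan \<psi> snd (\<lambda>c g. 0) [x] 1 q"
    proof (rule scan_cong[of "A i"])
      fix d h assume "h \<in> A i"
      then have "\<psi> (h * prod_list cs * p) = 0"
        using Cons.prems(1) \<open>set (ks @ js) \<subseteq> I\<close> js
        by (intro psi_ends[OF d2 _ _ _ el ce ne]) auto
      then show "D' ([x] @ d) * \<psi> (h * prod_list (map cen rs) * (?T * p)) = 0"
        by (simp add: cs_def mult.assoc)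
    qed (use one_in[OF i] mult_in[OF i] Cons.prems in auto)
    finally have "ceval rs (\<lambda>w. scan \<psi> snd (\<lambda>c g. D c * \<psi> (g * (?T * p))) [x] 1 (q @ w)) = 0" by simp
    then have "ceval rs (\<lambda>w. ?Z (?T * p) ((x # q) @ w)) =
        ceval rs (\<lambda>w. ?Z (?T * (p * snd x)) (q @ w))"
      by (simp add: centred_eval_add mult.assoc)
    also have "\<dots> = ceval rs (\<lambda>w. ?Z (?T * (p * snd x) * val q) w)"
      using Cons.prems x mult_in[OF i] by (intro Cons.IH) auto
    finally show ?case by (simp add: mult.assoc)
  qed simp
  note comb = linear_cen[OF cyclic_scan_from_linear[OF linear_psi]]
  have "ceval (r # rs) (\<lambda>w. ?Z ?T w) =
      ceval rs (\<lambda>w. ?Z (?T * val r) w - \<psi> (val r) * ?Z ?T w)"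
    using in_run[OF one_in[OF i] r] by (simp add: centred_eval_diff centred_eval_cmult)
  also have "\<dots> = ceval rs (\<lambda>w. ?Z (prod_list (ts @ [cen r])) w)"
    by (simp add: comb)
  also have "\<dots> = 0"
  proof (rule Cons.IH[OF rs])
    show "elems (ks @ [i]) (ts @ [cen r])"
      using Cons.prems(2) run_cen[OF i r] by (intro list_all2_appendI) auto
    show "centered \<psi> (ts @ [cen r])" using Cons.prems(3) by (auto simp: centered_def)
  qed (use Cons.prems js in auto)
  finally show ?case .
qed simp

text \<open>If every rotation had ends of one colour, cyclically adjacent letters would always share
  their colour, and the word would not be mixed.\<close>

lemma exists_rotation:
  assumes "mixed w"
  obtains m where "fst (hd (rotate m w)) \<noteq> fst (last (rotate m w))"
proof -
  have "\<exists>m. fst (hd (rotate m w)) \<noteq> fst (last (rotate m w))"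
  proof (rule ccontr)
    assume "\<nexists>m. fst (hd (rotate m w)) \<noteq> fst (last (rotate m w))"
    then have *: "fst (hd (rotate m w)) = fst (last (rotate m w))" for m by blast
    have ne: "w \<noteq> []" using assms by (auto simp: mixed_def)
    have "fst (w ! m) = fst (w ! 0)" if "m < length w" for m
      using that
    proof (induction m)
      case (Suc m)
      have "rotate (Suc m) w = rotate1 (rotate m w)" by simp
      moreover have "rotate m w = w ! m # drop (Suc m) w @ take m w"
        using Suc.prems by (simp add: rotate_drop_take Cons_nth_drop_Suc[symmetric])
      ultimately have "last (rotate (Suc m) w) = w ! m" by simp
      moreover have "hd (rotate (Suc m) w) = w ! Suc m"
        using Suc.prems by (simp add: hd_rotate_conv_nth ne del: rotate_Suc)
      ultimately show ?case using *[of "Suc m"] Suc by (simp del: rotate_Suc)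
    qed simp
    then show False using assms unfolding mixed_def by (metis in_set_conv_nth)
  qed
  then show ?thesis using that by blast
qed

text \<open>Induction on the length, after rotating the word so that its ends differ in colour. The
  unmixed part \<open>D'\<close> contributes 0 by \<open>ceval_cyclic_scan_zero\<close>; the mixed
  part \<open>\<delta>\<close> vanishes on shorter words, so \<open>centred_eval_top\<close> leaves
  its value on the whole word.\<close>

lemma cyclic_mixed_zero:
  assumes inv: "\<And>w a. D (w @ [a]) = D (a # w)"
    and zero: "\<And>js rs. runs A js rs \<Longrightarrow> distinct_adj js \<Longrightarrow> set js \<subseteq> I \<Longrightarrow> 2 \<le> length js \<Longrightarrow>
      last js \<noteq> hd js \<Longrightarrow> ceval rs (cyclic_scan_from \<psi> snd D 1) = 0"
    and w: "set w \<subseteq> Sigma I A" "mixed w"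
  shows "D w = 0"
  using w
proof (induction w rule: measure_induct_rule[where f = length])
  case (less w)
  have rot1: "D (rotate1 u) = D u" for u by (cases u) (simp_all add: inv)
  have rot: "D (rotate m u) = D u" for m u by (induction m) (simp_all add: rot1)
  obtain m where m: "fst (hd (rotate m w)) \<noteq> fst (last (rotate m w))"
    using exists_rotation[OF less.prems(2)] .
  define u where "u = rotate m w"
  have u: "set u \<subseteq> Sigma I A" "u \<noteq> []" "length u = length w" "mixed u"
    using less.prems by (auto simp: u_def mixed_def)
  obtain js rs where R: "runs A js rs" "concat rs = u" "\<And>r. r \<in> set rs \<Longrightarrow> r \<noteq> []"
    "distinct_adj js" "set js \<subseteq> I" "js \<noteq> []" "hd js = fst (hd u)" "last js = fst (last u)"
    using runs_exist[OF u(1,2)] by metis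
  have ends: "last js \<noteq> hd js" using R m by (simp add: u_def)
  then have len: "2 \<le> length js" using R(6) by (cases js; cases "tl js") auto
  define \<delta> where "\<delta> c = (if mixed c then D c else 0)" for c
  define D' where "D' c = (if mixed c then 0 else D c)" for c
  have sum: "(\<lambda>c. D' c + \<delta> c) = D" by (auto simp: D'_def \<delta>_def)
  have "cyclic_scan_from \<psi> snd D 1 = (\<lambda>w. cyclic_scan_from \<psi> snd D' 1 w + cyclic_scan_from \<psi> snd \<delta> 1 w)"
    using cyclic_scan_from_add[of \<psi> snd D' \<delta> 1] unfolding sum by (rule ext)
  then have "0 = ceval rs (cyclic_scan_from \<psi> snd D' 1) + ceval rs (cyclic_scan_from \<psi> snd \<delta> 1)"
    using zero[OF R(1,4,5) len ends] by (simp add: centred_eval_add)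
  also have "ceval rs (cyclic_scan_from \<psi> snd D' 1) = 0"
    using ceval_cyclic_scan_zero[of D' js rs "[]" "[]"] R len ends
    by (simp add: D'_def centered_def)
  also have "ceval rs (cyclic_scan_from \<psi> snd \<delta> 1) = cyclic_scan_from \<psi> snd \<delta> 1 (concat rs)"
  proof (rule centred_eval_top[OF R(3)])
    fix v assume v: "set v \<subseteq> set (concat rs)" "length v < length (concat rs)"
    have "\<delta> d = 0" if d: "set d \<subseteq> set (concat rs)" "length d < length (concat rs)" for d
      using less.IH[of d] d u R(2) by (auto simp: \<delta>_def)
    note \<delta>0 = this
    have "\<delta> d = 0" if "set d \<subseteq> set v" "length d < length v" for d
      using that v by (intro \<delta>0) auto
    from cyclic_scan_from_top[of \<psi> v \<delta>, OF psi_one this]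
    show "cyclic_scan_from \<psi> snd \<delta> 1 v = 0" by (simp add: \<delta>0[OF v])
  qed auto
  also have "cyclic_scan_from \<psi> snd \<delta> 1 (concat rs) = \<delta> u"
  proof -
    have "\<delta> d = 0" if d: "set d \<subseteq> set u" "length d < length u" for d
      using less.IH[of d] d u by (auto simp: \<delta>_def)
    then show ?thesis using cyclic_scan_from_top[of \<psi> u \<delta> snd 1] u(2) R(2) by simp
  qed
  finally have "D u = 0" using u(4) by (simp add: \<delta>_def)
  then show ?case using rot[of m w] by (simp add: u_def)
qed

end

locale cfree_family = free_family I A \<psi>
  for I :: "'i set" and A :: "'i \<Rightarrow> 'a::complex_algebra_1 set" and \<psi> :: "'a \<Rightarrow> complex" +
  fixes \<phi> :: "'a \<Rightarrow> complex"
  assumes cfree: "multiplicative \<phi>"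
begin

lemma linear_phi: "linear_functional \<phi>" and phi_one [simp]: "\<phi> 1 = 1"
  using cfree by (simp_all add: multiplicative_def)

text \<open>The moment of the first run times the later centred runs is computed twice.
  Multiplicativity gives a product; in the expansion, the blocks with the colour of the first run
  already produce that product, and the other blocks leave only the cumulant of
  \<open>w\<close>.\<close>

lemma cfree_mixed_zero:
  assumes w: "set w \<subseteq> Sigma I A" "mixed w"
  shows "cfree_cumulant \<phi> \<psi> (map snd w) = 0"
  using w
proof (induction w rule: measure_induct_rule[where f = length])
  case (less w)
  let ?\<kappa> = "\<lambda>c. cfree_cumulant \<phi> \<psi> (map snd c)"
  have ne: "w \<noteq> []" using less.prems(2) by (auto simp: mixed_def)
  obtain js rs where R: "runs A js rs" "concat rs = w" "\<And>r. r \<in> set rs \<Longrightarrow> r \<noteq> []"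
    "distinct_adj js" "set js \<subseteq> I" "js \<noteq> []"
    using runs_exist[OF less.prems(1) ne] by metis
  obtain j js' where js: "js = j # js'" using R(6) by (cases js) auto
  obtain r0 rs' where rs: "rs = r0 # rs'" using R(1) js by (cases rs) auto
  obtain x r where r0: "r0 = x # r" using R(3) rs by (cases r0) auto
  have run: "set (x # r) \<subseteq> {j} \<times> A j" and R': "runs A js' rs'" using R(1) js rs r0 by auto
  have j: "j \<in> I" using R(5) js by simp
  let ?C = "prod_list (map cen rs')" and ?S = "\<lambda>f. scan \<psi> snd (\<lambda>c g. f c * \<phi> g) [x] 1"
  define \<kappa>' where "\<kappa>' c = (if \<forall>y\<in>set c. fst y = j then ?\<kappa> c else 0)" for c
  define \<delta> where "\<delta> c = (if \<forall>y\<in>set c. fst y = j then 0 else ?\<kappa> c)" for c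
  have C: "\<phi> (s * ?C) = \<phi> s * prod_list (map \<phi> (map cen rs'))" if "s \<in> A j" for s
    using multiplicative_left[OF cfree, of j js' s "map cen rs'"] that R(4,5) js runs_elems[OF R']
      centered_cen by simp
  have expand: "\<phi> (val (x # r) * val v) = ?S \<kappa>' (r @ v) +
      ?S \<delta> (r @ v)" for v
  proof -
    have "(\<lambda>c g. ?\<kappa> c * \<phi> g) = (\<lambda>c g. \<kappa>' c * \<phi> g + \<delta> c * \<phi> g)" by (auto simp: \<kappa>'_def \<delta>_def fun_eq_iff)
    then show ?thesis
      using cfree_scan[of \<psi> \<phi> snd x "r @ v"] by (simp add: mult.assoc flip: scan_add)
  qed
  have "\<phi> (val (x # r)) * prod_list (map \<phi> (map cen rs')) = \<phi> (val (x # r) * ?C * 1)"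
    using C[OF run_val[OF j run]] by simp
  also have "\<dots> = ceval rs' (\<lambda>v. \<phi> (val (x # r) * val v * 1))"
    by (rule centred_eval_linear[OF linear_phi, symmetric])
  also have "\<dots> = ceval rs' (\<lambda>v. ?S \<kappa>' (r @ v)) +
      ceval rs' (\<lambda>v. ?S \<delta> (r @ v))"
    using expand by (simp add: centred_eval_add)
  also have "ceval rs' (\<lambda>v. ?S \<kappa>' (r @ v)) =
      scan \<psi> snd (\<lambda>c g. \<kappa>' c * \<phi> (g * ?C)) [x] 1 r"
  proof (rule ceval_scan_run[OF _ _ _ R'])
    show "linear_functional (\<lambda>g. \<kappa>' c * \<phi> g)" for c by (rule linear_functional_cmult[OF linear_phi])
  qed (use run R(4,5) js in \<open>auto simp: \<kappa>'_def\<close>)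
  also have "\<dots> = scan \<psi> snd (\<lambda>c g. prod_list (map \<phi> (map cen rs')) * (?\<kappa> c * \<phi> g)) [x] 1 r"
  proof (rule scan_cong[of "A j"])
    fix d h assume "set d \<subseteq> set r" "h \<in> A j"
    moreover from this run have "\<forall>y\<in>set ([x] @ d). fst y = j" by auto
    ultimately show "\<kappa>' ([x] @ d) * \<phi> (h * ?C) =
        prod_list (map \<phi> (map cen rs')) * (?\<kappa> ([x] @ d) * \<phi> h)"
      using C by (simp add: \<kappa>'_def)
  qed (use one_in[OF j] mult_in[OF j] run in auto)
  also have "\<dots> = prod_list (map \<phi> (map cen rs')) * \<phi> (val (x # r))"
    using cfree_scan[of \<psi> \<phi> snd x r] by (simp add: scan_cmult)
  also have "ceval rs' (\<lambda>v. ?S \<delta> (r @ v)) = ?\<kappa> w"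
  proof -
    have w: "w = [x] @ (r @ concat rs')" using R(2) rs r0 by simp
    have \<delta>0: "\<delta> ([x] @ d) = 0" if "set d \<subseteq> set (r @ concat rs')" "length d < length (r @ concat rs')" for d
    proof (cases "\<forall>y\<in>set ([x] @ d). fst y = j")
      case False
      moreover have "fst x = j" using run by auto
      ultimately have "mixed ([x] @ d)" by (auto simp: mixed_def)
      moreover have "set ([x] @ d) \<subseteq> Sigma I A" using that(1) less.prems(1) w by auto
      ultimately show ?thesis using less.IH[of "[x] @ d"] that(2) w by (simp add: \<delta>_def)
    qed (simp add: \<delta>_def)
    have "ceval rs' (\<lambda>v. ?S \<delta> (r @ v)) =
        ?S \<delta> (r @ concat rs')"
    proof (rule centred_eval_top)
      fix v assume v: "set v \<subseteq> set (concat rs')" "length v < length (concat rs')"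
      have "?S \<delta> (r @ v) = scan \<psi> snd (\<lambda>c g. 0) [x] 1 (r @ v)"
      proof (rule scan_cong_UNIV)
        fix d h assume "set d \<subseteq> set (r @ v)" "length d \<le> length (r @ v)"
        then have "\<delta> ([x] @ d) = 0" using v by (intro \<delta>0) auto
        then show "\<delta> ([x] @ d) * \<phi> h = 0" by simp
      qed
      then show "?S \<delta> (r @ v) = 0" by simp
    qed (use R(3) rs in auto)
    also have "\<dots> = \<delta> ([x] @ (r @ concat rs')) * \<phi> 1"
    proof (rule scan_top)
      show "\<delta> ([x] @ d) * \<phi> h = 0"
        if "set d \<subseteq> set (r @ concat rs')" "length d < length (r @ concat rs')" for d h
        using \<delta>0[OF that] by simp
    qed simp
    also have "\<dots> = ?\<kappa> w"
    proof -
      have "\<not> (\<forall>y\<in>set w. fst y = j)" using less.prems(2) unfolding mixed_def by metis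
      then have "\<delta> w = ?\<kappa> w" unfolding \<delta>_def by (rule if_not_P)
      then show ?thesis by (simp only: w[symmetric] phi_one mult_1_right)
    qed
    finally show ?thesis .
  qed
  finally show ?case by simp
qed

end

section \<open>The cyclic Boolean functional on centred words\<close>

text \<open>Sum over the first Boolean block, which consists of \<open>y\<close> and a nonempty
  prefix of the remaining word; \<open>F\<close> evaluates the rest.\<close>

fun left_split :: "('b list \<Rightarrow> complex) \<Rightarrow> ('b list \<Rightarrow> complex) \<Rightarrow> 'b list \<Rightarrow> 'b list \<Rightarrow> complex" where
  "left_split \<beta> F y [] = 0"
| "left_split \<beta> F y (a # u) = \<beta> (y @ [a]) * F u + left_split \<beta> F (y @ [a]) u"

lemma left_split_append:
  "left_split \<beta> F y (s @ u) =
    (\<Sum>k<length s. \<beta> (y @ take (Suc k) s) * F (drop (Suc k) s @ u)) + left_split \<beta> F (y @ s) u"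
proof (induction s arbitrary: y)
  case (Cons a s)
  show ?case
    using Cons[of "y @ [a]"] unfolding length_Cons by (subst sum.lessThan_Suc_shift) simp
qed simp

lemma left_split_sum:
  "left_split \<beta> F y u = (\<Sum>k<length u. \<beta> (y @ take (Suc k) u) * F (drop (Suc k) u))"
  using left_split_append[of \<beta> F y u "[]"] by simp

text \<open>Sum over the starting point of the wrapping Boolean block: it consists of a nonempty
  suffix followed by the initial piece \<open>y\<close>, and \<open>m\<close> is the product of the
  letters already left in the middle.\<close>

fun wrap_split :: "('a::monoid_mult \<Rightarrow> complex) \<Rightarrow> ('b \<Rightarrow> 'a) \<Rightarrow> ('b list \<Rightarrow> complex) \<Rightarrow>
    'b list \<Rightarrow> 'a \<Rightarrow> 'b list \<Rightarrow> complex" where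
  "wrap_split \<phi> e \<beta> y m [] = 0"
| "wrap_split \<phi> e \<beta> y m (a # u) = \<phi> m * \<beta> (a # u @ y) + wrap_split \<phi> e \<beta> y (m * e a) u"

lemma wrap_split_append:
  "wrap_split \<phi> e \<beta> y m (q @ u) =
    (\<Sum>k<length q. \<phi> (m * prod_list (map e (take k q))) * \<beta> (drop k q @ u @ y)) +
    wrap_split \<phi> e \<beta> y (m * prod_list (map e q)) u"
proof (induction q arbitrary: m)
  case (Cons a q)
  show ?case
    using Cons[of "m * e a"] unfolding length_Cons
    by (subst sum.lessThan_Suc_shift) (simp add: mult.assoc)
qed simp

lemma wrap_split_sum:
  "wrap_split \<phi> e \<beta> y m u =
    (\<Sum>k<length u. \<phi> (m * prod_list (map e (take k u))) * \<beta> (drop k u @ y))"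
  using wrap_split_append[of \<phi> e \<beta> y m u "[]"] by simp

lemma wrap_split_linear:
  assumes "linear_functional \<phi>"
  shows "linear_functional (\<lambda>m. wrap_split \<phi> e \<beta> y m u)"
proof (induction u)
  case (Cons a u)
  have "linear_functional (\<lambda>m. wrap_split \<phi> e \<beta> y (1 * m * e a) u)"
    by (rule linear_functional_mult[OF Cons])
  moreover have "linear_functional (\<lambda>m. \<beta> (a # u @ y) * \<phi> m)"
    by (rule linear_functional_cmult[OF assms])
  ultimately show ?case by (simp add: linear_functional_plus mult.commute)
qed (simp add: linear_functional_iff)

text \<open>Sum over the end of the initial piece of the wrapping block; \<open>y\<close> is what
  has been read of it.\<close>

fun cyclic_split :: "('a::monoid_mult \<Rightarrow> complex) \<Rightarrow> ('b \<Rightarrow> 'a) \<Rightarrow> ('b list \<Rightarrow> complex) \<Rightarrow>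
    'b list \<Rightarrow> 'b list \<Rightarrow> complex" where
  "cyclic_split \<phi> e \<beta> y [] = 0"
| "cyclic_split \<phi> e \<beta> y (a # u) = wrap_split \<phi> e \<beta> (y @ [a]) 1 u + cyclic_split \<phi> e \<beta> (y @ [a]) u"

lemma cyclic_split_append:
  "cyclic_split \<phi> e \<beta> y (r @ u) =
    (\<Sum>k<length r. wrap_split \<phi> e \<beta> (y @ take (Suc k) r) 1 (drop (Suc k) r @ u)) +
    cyclic_split \<phi> e \<beta> (y @ r) u"
proof (induction r arbitrary: y)
  case (Cons a r)
  show ?case
    using Cons[of "y @ [a]"] unfolding length_Cons by (subst sum.lessThan_Suc_shift) simp
qed simp

text \<open>In \<open>cyclic_boolean_sum\<close>, the terms with \<open>p = 0\<close> have no
  genuinely wrapping segment and add up to the moment by \<open>boolean_right\<close>; the terms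
  with \<open>p > 0\<close> form \<open>cyclic_split\<close>.\<close>

lemma cyclic_boolean_split:
  assumes "\<phi> 1 = 1"
  shows "cyclic_boolean \<phi> (map e w) = \<phi> (prod_list (map e w)) +
    cyclic_split \<phi> e (\<lambda>c. boolean_cumulant \<phi> (map e c)) [] w"
proof (cases "w = []")
  case True
  then show ?thesis using assms by (simp add: cyclic_boolean_def)
next
  case False
  let ?\<beta> = "\<lambda>c. boolean_cumulant \<phi> (map e c)" and ?n = "length w"
  define f where "f p q = \<phi> (prod_list (map e (drop p (take q w)))) * ?\<beta> (drop q w @ take p w)" for p q
  have "cyclic_boolean \<phi> (map e w) = (\<Sum>q<?n. \<Sum>p\<le>q. f p q)"
    using cyclic_boolean_sum[of \<phi> "map e w"] assms False by (simp add: f_def take_map drop_map)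
  also have "\<dots> = (\<Sum>q<?n. f 0 q) + (\<Sum>q<?n. \<Sum>p<q. f (Suc p) q)"
    by (simp only: lessThan_Suc_atMost[symmetric] sum.lessThan_Suc_shift sum.distrib)
  also have "(\<Sum>q<?n. f 0 q) = \<phi> (prod_list (map e w))"
    using boolean_right[of \<phi> "map e w"] assms False by (simp add: f_def take_map drop_map)
  also have "(\<Sum>q<?n. \<Sum>p<q. f (Suc p) q) = (\<Sum>p<?n. \<Sum>q\<in>{Suc p..<?n}. f (Suc p) q)"
    by (rule sum_triangle_swap)
  also have "\<dots> = (\<Sum>p<?n. wrap_split \<phi> e ?\<beta> (take (Suc p) w) 1 (drop (Suc p) w))"
  proof (rule sum.cong[OF refl])
    fix p
    show "(\<Sum>q\<in>{Suc p..<?n}. f (Suc p) q) = wrap_split \<phi> e ?\<beta> (take (Suc p) w) 1 (drop (Suc p) w)"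
      unfolding wrap_split_sum
    proof (rule sum.reindex_bij_witness[where i = "\<lambda>k. k + Suc p" and j = "\<lambda>q. q - Suc p"])
      fix q assume "q \<in> {Suc p..<?n}"
      then have "take (q - Suc p) (drop (Suc p) w) = drop (Suc p) (take q w)"
        "drop (q - Suc p) (drop (Suc p) w) = drop q w"
        by (simp_all add: drop_take)
      then show "\<phi> (1 * prod_list (map e (take (q - Suc p) (drop (Suc p) w)))) *
          boolean_cumulant \<phi> (map e (drop (q - Suc p) (drop (Suc p) w) @ take (Suc p) w)) = f (Suc p) q"
        by (simp only: f_def mult_1_left)
    qed auto
  qed
  also have "\<dots> = cyclic_split \<phi> e ?\<beta> [] w"
    using cyclic_split_append[of \<phi> e ?\<beta> "[]" w "[]"] by simp
  finally show ?thesis .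
qed

section \<open>Boolean cumulants under conditional freeness\<close>

context cfree_family
begin

definition bool_cum :: "('i \<times> 'a) list \<Rightarrow> complex" where
  "bool_cum c = boolean_cumulant \<phi> (map snd c)"

text \<open>Expand \<phi> by its first Boolean block. The blocks ending inside \<open>s\<close>
  already give the full factorised moment, so the longer ones sum to 0. By induction, those ending
  before the end of \<open>p\<close> vanish, which leaves the cumulant of the whole word.\<close>

lemma bool_cum_zero:
  assumes s: "s \<noteq> []" "set s \<subseteq> {j} \<times> A j"
    and "runs A js rs" "set p \<subseteq> {k} \<times> A k" "p \<noteq> []"
      "distinct_adj (j # js @ [k])" "set (j # js @ [k]) \<subseteq> I"
  shows "ceval rs (\<lambda>w. bool_cum (s @ w @ p)) = 0"
  using assms(3-)
proof (induction "length (concat rs) + length p" arbitrary: js rs p k rule: less_induct)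
  case less
  let ?F = "\<lambda>u. \<phi> (val u)"
  let ?X = "left_split bool_cum ?F"
  have jk: "j \<in> I" "k \<in> I" using less.prems(5) by auto
  have js: "set js \<subseteq> I" using less.prems(5) by auto
  have el: "elems js (map cen rs)" by (rule runs_elems[OF less.prems(1) js])
  have mult: "ceval rs (\<lambda>w. \<phi> (a * val w * val p)) = \<phi> a * prod_list (map \<phi> (map cen rs)) * \<phi> (val p)"
    if "a \<in> A j" for a
    using multiplicative_ends[OF cfree less.prems(4,5) that run_val[OF jk(2) less.prems(2)] el centered_cen]
    by (simp add: centred_eval_linear[OF linear_phi])
  have "?F (s @ w @ p) = (\<Sum>i<length s. bool_cum (take (Suc i) s) * \<phi> (val (drop (Suc i) s) * val w * val p)) +
      ?X s (w @ p)" for w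
    using boolean_left[of \<phi> "map snd (s @ w @ p)"] s(1) left_split_sum[of bool_cum ?F "[]" "s @ w @ p"]
      left_split_append[of bool_cum ?F "[]" s "w @ p"]
    by (simp add: take_map drop_map mult.assoc bool_cum_def)
  then have "ceval rs (\<lambda>w. \<phi> (val s * val w * val p)) =
      (\<Sum>i<length s. bool_cum (take (Suc i) s) *
        ceval rs (\<lambda>w. \<phi> (val (drop (Suc i) s) * val w * val p))) + ceval rs (\<lambda>w. ?X s (w @ p))"
    by (simp add: mult.assoc centred_eval_add centred_eval_sum centred_eval_cmult)
  also have "(\<Sum>i<length s. bool_cum (take (Suc i) s) *
        ceval rs (\<lambda>w. \<phi> (val (drop (Suc i) s) * val w * val p))) =
      (\<Sum>i<length s. bool_cum (take (Suc i) s) * \<phi> (val (drop (Suc i) s))) *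
        (prod_list (map \<phi> (map cen rs)) * \<phi> (val p))"
    unfolding sum_distrib_right
  proof (intro sum.cong refl)
    fix i
    have "set (drop (Suc i) s) \<subseteq> {j} \<times> A j" using s(2) set_drop_subset[of "Suc i" s] by blast
    then have in_A: "val (drop (Suc i) s) \<in> A j" by (rule run_val[OF jk(1)])
    show "bool_cum (take (Suc i) s) * ceval rs (\<lambda>w. \<phi> (val (drop (Suc i) s) * val w * val p)) =
        bool_cum (take (Suc i) s) * \<phi> (val (drop (Suc i) s)) * (prod_list (map \<phi> (map cen rs)) * \<phi> (val p))"
      unfolding mult[OF in_A] by (simp add: mult_ac)
  qed
  also have "(\<Sum>i<length s. bool_cum (take (Suc i) s) * \<phi> (val (drop (Suc i) s))) = \<phi> (val s)"
    using boolean_left[of \<phi> "map snd s"] s(1) by (simp add: take_map drop_map bool_cum_def)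
  finally have X0: "ceval rs (\<lambda>w. ?X s (w @ p)) = 0"
    using mult[OF run_val[OF jk(1) s(2)]] by simp
  \<comment> \<open>\<open>rs0\<close> are the runs already inside the first block,
    \<open>rs1\<close> those still ahead. Moving a run across loses only blocks ending within it, to
    which the outer induction applies.\<close>
  have "ceval rs0 (\<lambda>y. ceval rs1 (\<lambda>w. ?X (s @ y) (w @ p))) = ceval rs (\<lambda>w. bool_cum (s @ w @ p))"
    if "rs = rs0 @ rs1" for rs0 rs1
    using that
  proof (induction rs1 arbitrary: rs0)
    case Nil
    obtain p' where p': "length p = Suc p'" using less.prems(3) by (cases p) auto
    have zero: "ceval rs (\<lambda>y. bool_cum (s @ y @ take (Suc i) p)) = 0" if "i < p'" for i
    proof -
      have "set (take (Suc i) p) \<subseteq> {k} \<times> A k" using less.prems(2) set_take_subset[of "Suc i" p] by blast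
      moreover have "take (Suc i) p \<noteq> []" using less.prems(3) by auto
      ultimately show ?thesis
        using less.hyps[of rs "take (Suc i) p" js k] less.prems p' that by simp
    qed
    have "ceval rs (\<lambda>y. ?X (s @ y) p) =
        (\<Sum>i<length p. ceval rs (\<lambda>y. bool_cum (s @ y @ take (Suc i) p)) * ?F (drop (Suc i) p))"
      by (simp add: left_split_sum centred_eval_sum centred_eval_multc)
    also have "\<dots> = (\<Sum>i<length p. if i = p' then ceval rs (\<lambda>y. bool_cum (s @ y @ p)) else 0)"
    proof (rule sum.cong[OF refl])
      fix i assume "i \<in> {..<length p}"
      then show "ceval rs (\<lambda>y. bool_cum (s @ y @ take (Suc i) p)) * ?F (drop (Suc i) p) =
          (if i = p' then ceval rs (\<lambda>y. bool_cum (s @ y @ p)) else 0)"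
        using zero[of i] p' by (cases "i = p'") auto
    qed
    also have "\<dots> = ceval rs (\<lambda>y. bool_cum (s @ y @ p))" using p' by simp
    finally show ?case using Nil by simp
  next
    case (Cons r rs2)
    from less.prems(1) have "runs A js (rs0 @ r # rs2)" using Cons.prems by simp
    then obtain js0 js1 where "js = js0 @ js1" and rs0: "runs A js0 rs0" and "runs A js1 (r # rs2)"
      by (rule runs_appendE)
    moreover from this(3) obtain i js2 where "js1 = i # js2" and r: "set r \<subseteq> {i} \<times> A i"
      by (rule runs_ConsE)
    ultimately have js012: "js = js0 @ i # js2" by simp
    have zero: "ceval rs0 (\<lambda>y. bool_cum (s @ y @ take (Suc l) r)) = 0" if l: "l < length r" for l
    proof (rule less.hyps[OF _ rs0])
      have "0 < length p" using less.prems(3) by simp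
      moreover have "length (concat rs) = length (concat rs0) + length r + length (concat rs2)"
        using Cons.prems by simp
      moreover have "length (take (Suc l) r) \<le> length r" by simp
      ultimately show "length (concat rs0) + length (take (Suc l) r) < length (concat rs) + length p"
        by linarith
      show "set (take (Suc l) r) \<subseteq> {i} \<times> A i" using r set_take_subset[of "Suc l" r] by blast
      show "take (Suc l) r \<noteq> []" using l by auto
      have "distinct_adj ((j # js0 @ [i]) @ js2 @ [k])" using less.prems(4) js012 by simp
      then show "distinct_adj (j # js0 @ [i])" by (rule distinct_adj_appendD1)
    qed (use less.prems(5) js012 in auto)
    have X: "?X (s @ y) (r @ w @ p) = (\<Sum>l<length r. bool_cum (s @ y @ take (Suc l) r) *
        ?F (drop (Suc l) r @ w @ p)) + ?X (s @ y @ r) (w @ p)" for y w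
      using left_split_append[of bool_cum ?F "s @ y" r "w @ p"] by simp
    have "ceval rs0 (\<lambda>y. ceval (r # rs2) (\<lambda>w. ?X (s @ y) (w @ p))) =
        (\<Sum>l<length r. ceval rs0 (\<lambda>y. bool_cum (s @ y @ take (Suc l) r)) *
          ceval rs2 (\<lambda>w. ?F (drop (Suc l) r @ w @ p))) +
        ceval (rs0 @ [r]) (\<lambda>y. ceval rs2 (\<lambda>w. ?X (s @ y) (w @ p)))"
      by (simp add: centred_eval_append X centred_eval_add centred_eval_diff
          centred_eval_sum centred_eval_cmult centred_eval_multc)
    also have "\<dots> = ceval (rs0 @ [r]) (\<lambda>y. ceval rs2 (\<lambda>w. ?X (s @ y) (w @ p)))"
      by (simp add: zero)
    also have "\<dots> = ceval rs (\<lambda>w. bool_cum (s @ w @ p))"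
      by (rule Cons.IH) (use Cons.prems in simp)
    finally show ?case .
  qed
  from this[of "[]" rs] X0 show ?case by simp
qed

text \<open>A wrapping block starting in a run of \<open>rs1\<close> continues through the later
  runs and \<open>rs0\<close> and ends with \<open>p\<close>, which is the shape of
  \<open>bool_cum_zero\<close>. A run before its start joins the middle as a centred
  element.\<close>

lemma ceval_wrap_split_zero:
  assumes p: "p \<noteq> []" "set p \<subseteq> {i} \<times> A i"
    and rs0: "runs A js0 rs0"
    and "runs A js1 rs1" "distinct_adj (js1 @ js0 @ [i])" "set (js1 @ js0 @ [i]) \<subseteq> I"
  shows "ceval rs0 (\<lambda>y. ceval rs1 (\<lambda>w. wrap_split \<phi> snd bool_cum (y @ p) m w)) = 0"
  using assms(4-)
proof (induction rs1 arbitrary: js1 m)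
  case (Cons r rs2)
  from Cons.prems(1) obtain l js2 where js1: "js1 = l # js2" and r: "set r \<subseteq> {l} \<times> A l"
    and rs2: "runs A js2 rs2" by (rule runs_ConsE)
  let ?W = "wrap_split \<phi> snd bool_cum"
  have zero: "ceval rs0 (\<lambda>y. ceval rs2 (\<lambda>w. bool_cum (drop k r @ w @ y @ p))) = 0" if "k < length r" for k
  proof -
    have "set (drop k r) \<subseteq> {l} \<times> A l" using r set_drop_subset[of k r] by blast
    then have "ceval (rs2 @ rs0) (\<lambda>w. bool_cum (drop k r @ w @ p)) = 0"
      using that Cons.prems js1 p
      by (intro bool_cum_zero[OF _ _ runs_append[OF rs2 rs0]]) auto
    then show ?thesis by (subst centred_eval_commute) (simp add: centred_eval_append)
  qed
  note comb = linear_cen[OF wrap_split_linear[OF linear_phi]]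
  have "ceval rs0 (\<lambda>y. ceval (r # rs2) (\<lambda>w. ?W (y @ p) m w)) =
      (\<Sum>k<length r. \<phi> (m * val (take k r)) *
        ceval rs0 (\<lambda>y. ceval rs2 (\<lambda>w. bool_cum (drop k r @ w @ y @ p)))) +
      ceval rs0 (\<lambda>y. ceval rs2 (\<lambda>w. ?W (y @ p) (m * val r) w - \<psi> (val r) * ?W (y @ p) m w))"
    by (simp add: wrap_split_append centred_eval_add centred_eval_diff centred_eval_sum centred_eval_cmult)
  also have "\<dots> = ceval rs0 (\<lambda>y. ceval rs2 (\<lambda>w. ?W (y @ p) (m * cen r) w))"
    by (simp add: zero comb)
  also have "\<dots> = 0" by (rule Cons.IH[OF rs2]) (use Cons.prems js1 in \<open>auto dest: distinct_adj_ConsD\<close>)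
  finally show ?case .
qed simp

text \<open>The runs in \<open>rs0\<close> belong entirely to the initial piece. If this piece ends
  inside the next run, the wrapping block starts in the same run or in a later one, and it vanishes
  in both cases.\<close>

lemma ceval_cyclic_split_zero:
  assumes "runs A js rs" "runs A js0 rs0" "distinct_adj (js0 @ js)" "set (js0 @ js) \<subseteq> I"
    "2 \<le> length (js0 @ js)" "last (js0 @ js) \<noteq> hd (js0 @ js)"
  shows "ceval rs0 (\<lambda>y. ceval rs (\<lambda>w. cyclic_split \<phi> snd bool_cum y w)) = 0"
  using assms
proof (induction rs arbitrary: js rs0 js0)
  case (Cons r rs2)
  from Cons.prems(1) obtain i js2 where js: "js = i # js2" and r: "set r \<subseteq> {i} \<times> A i"
    and rs2: "runs A js2 rs2" by (rule runs_ConsE)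
  let ?W = "wrap_split \<phi> snd bool_cum" and ?C = "cyclic_split \<phi> snd bool_cum"
  have d: "distinct_adj (i # (js2 @ js0) @ [i])"
    by (rule distinct_adj_cyclic) (use Cons.prems(3,5,6) js in auto)
  have I: "set (i # (js2 @ js0) @ [i]) \<subseteq> I" using Cons.prems(4) js by auto
  have zero: "ceval rs0 (\<lambda>y. ceval rs2 (\<lambda>w. ?W (y @ take (Suc k) r) 1 (drop (Suc k) r @ w))) = 0"
    if k: "k < length r" for k
  proof -
    define p q where "p = take (Suc k) r" and "q = drop (Suc k) r"
    have p: "p \<noteq> []" "set p \<subseteq> {i} \<times> A i"
      using k r set_take_subset[of "Suc k" r] by (auto simp: p_def)
    \<comment> \<open>The block starts in the remainder of the run in which its initial piece ends,
      so it goes through all the other runs. Cyclic alternation makes these colours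
      alternate.\<close>
    have "ceval rs0 (\<lambda>y. ceval rs2 (\<lambda>w. bool_cum (drop l q @ w @ y @ p))) = 0" if "l < length q" for l
    proof -
      have "set (drop l q) \<subseteq> {i} \<times> A i"
        using r set_drop_subset[of l q] set_drop_subset[of "Suc k" r] by (auto simp: q_def)
      then have "ceval (rs2 @ rs0) (\<lambda>w. bool_cum (drop l q @ w @ p)) = 0"
        using that p d I
        by (intro bool_cum_zero[OF _ _ runs_append[OF rs2 Cons.prems(2)]]) auto
      then show ?thesis by (subst centred_eval_commute) (simp add: centred_eval_append)
    qed
    moreover have "ceval rs0 (\<lambda>y. ceval rs2 (\<lambda>w. ?W (y @ p) (1 * val q) w)) = 0"
      using distinct_adj_ConsD[OF d] I
      by (intro ceval_wrap_split_zero[OF p Cons.prems(2) rs2]) auto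
    ultimately show ?thesis
      unfolding p_def[symmetric] q_def[symmetric]
      by (simp add: wrap_split_append centred_eval_add centred_eval_sum centred_eval_cmult)
  qed
  have "ceval rs0 (\<lambda>y. ceval (r # rs2) (\<lambda>w. ?C y w)) =
      (\<Sum>k<length r. ceval rs0 (\<lambda>y. ceval rs2 (\<lambda>w. ?W (y @ take (Suc k) r) 1 (drop (Suc k) r @ w)))) +
      ceval (rs0 @ [r]) (\<lambda>y. ceval rs2 (\<lambda>w. ?C y w))"
    by (simp add: cyclic_split_append centred_eval_append centred_eval_add centred_eval_diff
        centred_eval_sum centred_eval_cmult)
  also have "\<dots> = ceval (rs0 @ [r]) (\<lambda>y. ceval rs2 (\<lambda>w. ?C y w))" by (simp add: zero)
  also have "\<dots> = 0"
  proof (rule Cons.IH[OF rs2])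
    show "runs A (js0 @ [i]) (rs0 @ [r])" using Cons.prems(2) r by (intro runs_append) auto
  qed (use Cons.prems js in auto)
  finally show ?case .
qed simp

lemma ceval_cyclic_boolean:
  assumes "runs A js rs" "distinct_adj js" "set js \<subseteq> I" "2 \<le> length js" "last js \<noteq> hd js"
  shows "ceval rs (\<lambda>w. cyclic_boolean \<phi> (map snd w)) = prod_list (map \<phi> (map cen rs))"
proof -
  have "ceval rs (\<lambda>w. cyclic_boolean \<phi> (map snd w)) =
      ceval rs (\<lambda>w. \<phi> (1 * val w * 1)) + ceval rs (cyclic_split \<phi> snd bool_cum [])"
    by (simp add: cyclic_boolean_split centred_eval_add bool_cum_def[abs_def])
  also have "ceval rs (cyclic_split \<phi> snd bool_cum []) = 0"
    using ceval_cyclic_split_zero[of js rs "[]" "[]"] assms by simp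
  also have "ceval rs (\<lambda>w. \<phi> (1 * val w * 1)) = \<phi> (1 * prod_list (map cen rs) * 1)"
    by (rule centred_eval_linear[OF linear_phi])
  finally show ?thesis
    using multiplicative_prod[OF cfree assms(2,3) runs_elems[OF assms(1,3)] centered_cen] by simp
qed

end

section \<open>From vanishing mixed cumulants back to multiplicativity\<close>

context subalgebra_family
begin

text \<open>Expand along the block of \<open>a\<close>. If the next pick is the adjacent letter, the
  block is mixed; if it comes later, the gap is a nonempty centred alternating product on which
  \<psi> vanishes. Only the singleton block survives. The length bound in \<open>zero\<close> allows
  use inside the induction that proves freeness.\<close>

lemma cfree_mixed_step:
  assumes one: "\<phi> 1 = 1"
    and \<kappa>: "\<And>c. set c \<subseteq> Sigma I A \<Longrightarrow> mixed c \<Longrightarrow> cfree_cumulant \<phi> \<psi> (map snd c) = 0"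
    and zero: "\<And>js' as'. distinct_adj js' \<Longrightarrow> set js' \<subseteq> I \<Longrightarrow> elems js' as' \<Longrightarrow> centered \<psi> as' \<Longrightarrow>
      as' \<noteq> [] \<Longrightarrow> length as' \<le> length as \<Longrightarrow> \<psi> (prod_list as') = 0"
    and js: "distinct_adj (j # js)" "set (j # js) \<subseteq> I"
    and as: "elems (j # js) (a # as)" "centered \<psi> (a # as)"
  shows "\<phi> (a * prod_list as) = \<phi> a * \<phi> (prod_list as)"
proof -
  define w where "w = zip js as"
  have len: "length js = length as" using list_all2_lengthD[OF as(1)] by simp
  have w: "map snd w = as" "length w = length as" using len by (simp_all add: w_def)
  have wS: "set w \<subseteq> Sigma I A"
    using as(1) js(2) len by (auto simp: w_def set_zip list_all2_conv_all_nth)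
  let ?K = "\<lambda>c g. cfree_cumulant \<phi> \<psi> (map snd c) * \<phi> g"
  have terms: "\<psi> (1 * val (take v w)) * scan \<psi> snd ?K ([(j, a)] @ [w ! v]) 1 (drop (Suc v) w) = 0"
    if v: "v < length w" for v
  proof (cases "v = 0")
    case True
    have "fst (w ! 0) \<noteq> j"
      using v js(1) len w(2) True by (cases js) (auto simp: w_def)
    moreover have "w ! 0 \<in> set w" using v True by simp
    ultimately have c: "mixed (([(j, a)] @ [w ! v]) @ d)" for d using True by (auto simp: mixed_def)
    have "scan \<psi> snd ?K ([(j, a)] @ [w ! v]) 1 (drop (Suc v) w) =
        scan \<psi> snd (\<lambda>c g. 0) ([(j, a)] @ [w ! v]) 1 (drop (Suc v) w)"
    proof (rule scan_cong_UNIV)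
      fix d h assume "set d \<subseteq> set (drop (Suc v) w)"
      moreover have "set (drop (Suc v) w) \<subseteq> set w" by (rule set_drop_subset)
      moreover have "w ! v \<in> set w" using v by simp
      moreover have "j \<in> I" "a \<in> A j" using js as by auto
      ultimately have "set (([(j, a)] @ [w ! v]) @ d) \<subseteq> Sigma I A" using wS by auto
      from \<kappa>[OF this c] show "?K (([(j, a)] @ [w ! v]) @ d) h = 0" by simp
    qed
    then show ?thesis by simp
  next
    case False
    have "\<psi> (prod_list (take v as)) = 0"
    proof (rule zero[of "take v js"])
      show "distinct_adj (take v js)"
        using distinct_adj_ConsD[OF js(1)] distinct_adj_appendD1[of "take v js" "drop v js"] by simp
      show "set (take v js) \<subseteq> I" using js(2) set_take_subset[of v js] by auto
      show "elems (take v js) (take v as)" using as(1) by (simp add: list_all2_takeI)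
      show "centered \<psi> (take v as)" using as(2) by (auto simp: centered_def dest: in_set_takeD)
    qed (use False v w in auto)
    then show ?thesis using w by (simp add: take_map[symmetric])
  qed
  have "(\<Sum>v<length w. \<psi> (1 * val (take v w)) * scan \<psi> snd ?K ([(j, a)] @ [w ! v]) 1 (drop (Suc v) w)) = 0"
    by (rule sum.neutral) (use terms in blast)
  then have "\<phi> (val ((j, a) # w)) = ?K [(j, a)] (1 * val w)"
    unfolding cfree_scan[of \<psi> \<phi> snd "(j, a)" w, OF psi_one one] scan_unroll[of _ _ _ _ _ w]
    by (simp only: add_0_right)
  moreover have "cfree_cumulant \<phi> \<psi> [a] = \<phi> a"
    using cfree_scan[of \<psi> \<phi> snd "(j, a)" "[]"] one by simp
  ultimately show ?thesis using w by simp
qed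

text \<open>Strong induction with \<open>cfree_mixed_step\<close> for \<phi> = \<psi>; a centred
  first factor makes the product vanish.\<close>

lemma free_mixed_zero:
  assumes \<kappa>: "\<And>c. set c \<subseteq> Sigma I A \<Longrightarrow> mixed c \<Longrightarrow> free_cumulant \<psi> (map snd c) = 0"
    and "distinct_adj js" "set js \<subseteq> I" "elems js as" "centered \<psi> as" "as \<noteq> []"
  shows "\<psi> (prod_list as) = 0"
  using assms(2-)
proof (induction as arbitrary: js rule: measure_induct_rule[where f = length])
  case (less as)
  obtain a as' where as: "as = a # as'" using less.prems(5) by (cases as) auto
  then obtain j js' where js: "js = j # js'" using less.prems(3) by (cases js) auto
  have "\<psi> (a * prod_list as') = \<psi> a * \<psi> (prod_list as')"
  proof (rule cfree_mixed_step[of \<psi>, OF psi_one])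
    show "cfree_cumulant \<psi> \<psi> (map snd c) = 0" if "set c \<subseteq> Sigma I A" "mixed c" for c
      using \<kappa>[OF that] that(2) by (simp add: cfree_cumulant_mixed)
  qed (use less js as in auto)
  then show ?case using less.prems(4) as by (simp add: centered_def)
qed

lemma cfree_mixed_multiplicative:
  assumes lin: "linear_functional \<phi>" and one: "\<phi> 1 = 1"
    and \<kappa>: "\<And>c. set c \<subseteq> Sigma I A \<Longrightarrow> mixed c \<Longrightarrow> cfree_cumulant \<phi> \<psi> (map snd c) = 0"
    and \<kappa>': "\<And>c. set c \<subseteq> Sigma I A \<Longrightarrow> mixed c \<Longrightarrow> free_cumulant \<psi> (map snd c) = 0"
  shows "multiplicative \<phi>"
proof -
  have "\<phi> (prod_list as) = prod_list (map \<phi> as)"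
    if "distinct_adj js" "set js \<subseteq> I" "elems js as" "centered \<psi> as" for js as
    using that
  proof (induction as arbitrary: js)
    case (Cons a as)
    then obtain j js' where js: "js = j # js'" by (cases js) auto
    have "\<phi> (a * prod_list as) = \<phi> a * \<phi> (prod_list as)"
      by (rule cfree_mixed_step[of \<phi>, OF one \<kappa> free_mixed_zero[OF \<kappa>']]) (use Cons.prems js in auto)
    also have "\<phi> (prod_list as) = prod_list (map \<phi> as)"
      by (rule Cons.IH[of js']) (use Cons.prems js in \<open>auto simp: centered_def dest: distinct_adj_ConsD\<close>)
    finally show ?case by simp
  qed (simp add: one)
  then show ?thesis
    unfolding multiplicative_def alternating_def using lin one by blast
qed

end

section \<open>The tensor algebra\<close>

lemma multilinear_iff: "multilinear F \<longleftrightarrow> (\<forall>us vs. linear_functional (\<lambda>x. F (us @ x # vs)))"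
  by (auto simp: multilinear_def linear_functional_iff)

lemma multilinear_prod: "linear_functional f \<Longrightarrow> multilinear (\<lambda>as. f (prod_list as))"
  unfolding multilinear_iff
  using linear_functional_mult[of f] by (simp add: mult.assoc)

lemma linear_functional_mult_const: "linear_functional f \<Longrightarrow> linear_functional (\<lambda>x. f x * c)"
  by (simp add: linear_functional_iff algebra_simps)

text \<open>Solve \<open>boolean_right\<close> for its term \<open>k = 0\<close>. In every other
  term the marked letter lies in just one factor: the moment of a prefix, or the cumulant of a
  proper suffix, which induction on the letters before it handles.\<close>

lemma multilinear_boolean_cumulant:
  assumes lin: "linear_functional \<phi>" and one: "\<phi> 1 = 1"
  shows "multilinear (boolean_cumulant \<phi>)"
proof -
  have "linear_functional (\<lambda>x. boolean_cumulant \<phi> (us @ x # vs))" for us vs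
  proof (induction "length us" arbitrary: us rule: less_induct)
    case less
    let ?n = "length us + length vs"
    have eq: "boolean_cumulant \<phi> (us @ x # vs) = \<phi> (prod_list (us @ x # vs)) -
        (\<Sum>k<?n. \<phi> (prod_list (take (Suc k) (us @ x # vs))) *
          boolean_cumulant \<phi> (drop (Suc k) (us @ x # vs)))" for x
    proof -
      have "length (us @ x # vs) = Suc ?n" by simp
      then have "\<phi> (prod_list (us @ x # vs)) = (\<Sum>k<Suc ?n. \<phi> (prod_list (take k (us @ x # vs))) *
          boolean_cumulant \<phi> (drop k (us @ x # vs)))"
        using boolean_right[of \<phi> "us @ x # vs"] one by simp
      then show ?thesis by (simp only: sum.lessThan_Suc_shift) (simp add: one)
    qed
    have "linear_functional (\<lambda>x. \<phi> (prod_list (take (Suc k) (us @ x # vs))) *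
        boolean_cumulant \<phi> (drop (Suc k) (us @ x # vs)))" for k
    proof (cases "Suc k \<le> length us")
      case True
      have "linear_functional (\<lambda>x. boolean_cumulant \<phi> (drop (Suc k) us @ x # vs))"
        by (rule less.hyps) (use True in simp)
      then show ?thesis using True by (simp add: linear_functional_cmult)
    next
      case False
      define d where "d = k - length us"
      have d: "k = length us + d" using False by (simp add: d_def)
      have "linear_functional (\<lambda>x. \<phi> (prod_list (us @ x # take d vs)))"
        using multilinear_prod[OF lin] by (simp add: multilinear_iff)
      moreover have "take (Suc k) (us @ x # vs) = us @ x # take d vs"
        "drop (Suc k) (us @ x # vs) = drop d vs" for x
        using d by (simp_all add: Suc_diff_le)
      ultimately show ?thesis by (simp only: linear_functional_mult_const)
    qed
    moreover have "linear_functional (\<lambda>x. \<phi> (prod_list (us @ x # vs)))"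
      using multilinear_prod[OF lin] by (simp add: multilinear_iff)
    ultimately show ?case
      unfolding eq by (intro linear_functional_minus linear_functional_sum)
  qed
  then show ?thesis by (simp add: multilinear_iff)
qed

text \<open>In each term of \<open>cyclic_boolean_sum\<close> the marked letter occurs once: in the
  suffix or prefix part of the wrapping segment, or in the moment between them.\<close>

lemma multilinear_cyclic_boolean:
  assumes lin: "linear_functional \<phi>" and one: "\<phi> 1 = 1"
  shows "multilinear (cyclic_boolean \<phi>)"
  unfolding multilinear_iff
proof (intro allI)
  fix us vs :: "'a list"
  let ?n = "Suc (length us + length vs)" and ?l = "length us"
  have \<beta>: "linear_functional (\<lambda>x. boolean_cumulant \<phi> (us @ x # vs))" for us vs
    using multilinear_boolean_cumulant[OF assms] by (simp add: multilinear_iff)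
  have \<phi>: "linear_functional (\<lambda>x. \<phi> (prod_list (us @ x # vs)))" for us vs
    using multilinear_prod[OF lin] by (simp add: multilinear_iff)
  have "linear_functional (\<lambda>x. \<phi> (prod_list (drop p (take q (us @ x # vs)))) *
      boolean_cumulant \<phi> (drop q (us @ x # vs) @ take p (us @ x # vs)))" if "p \<le> q" for p q
  proof -
    consider "q \<le> ?l" | "p \<le> ?l" "?l < q" | "?l < p" using that by linarith
    then show ?thesis
    proof cases
      case 1
      then have "p \<le> ?l" using that by simp
      with 1 show ?thesis
        using \<beta>[of "drop q us" "vs @ take p us"] by (simp add: linear_functional_cmult)
    next
      case 2
      then obtain d where "q = Suc (?l + d)" by (metis less_iff_Suc_add)
      with 2 show ?thesis
        using \<phi>[of "drop p us" "take d vs"] by (simp add: linear_functional_mult_const Suc_diff_le)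
    next
      case 3
      then obtain c where c: "p = Suc (?l + c)" by (metis less_iff_Suc_add)
      from 3 that obtain d where d: "q = Suc (?l + d)" by (metis less_iff_Suc_add less_le_trans)
      from c d show ?thesis
        using \<beta>[of "drop d vs @ us" "take c vs"] that by (simp add: linear_functional_cmult Suc_diff_le)
    qed
  qed
  then have "linear_functional (\<lambda>x. \<Sum>q<?n. \<Sum>p\<le>q. \<phi> (prod_list (drop p (take q (us @ x # vs)))) *
      boolean_cumulant \<phi> (drop q (us @ x # vs) @ take p (us @ x # vs)))"
    by (intro linear_functional_sum) simp
  then show "linear_functional (\<lambda>x. cyclic_boolean \<phi> (us @ x # vs))"
    by (simp add: cyclic_boolean_sum[of \<phi>, OF one])
qed

lemma tensor_extend:
  assumes "multilinear F"
  shows "linear_functional (tensor_extend F)" "tensor_extend F (pure_tensor as) = F as"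
  using theI'[OF tensor_extend_unique_exists[OF assms]] unfolding tensor_extend_def by blast+

lemma pure_tensor_Nil: "pure_tensor [] = 1"
  by (simp add: pure_tensor.abs_eq one_tensor_algebra.abs_eq flip: zero_tensor_word_def)

lemma pure_tensor_append: "pure_tensor (as @ bs) = pure_tensor as * pure_tensor bs"
  by (simp add: pure_tensor.abs_eq times_tensor_algebra.abs_eq mult_single plus_tensor_word_def)

abbreviation letter :: "'i \<times> 'a::complex_algebra_1 \<Rightarrow> 'a tensor_algebra" where
  "letter x \<equiv> pure_tensor [snd x]"

lemma prod_letters: "prod_list (map letter w) = pure_tensor (map snd w)"
  by (induction w) (simp_all add: pure_tensor_Nil flip: pure_tensor_append)

section \<open>Centred tensors and reduction to words\<close>

context subalgebra_family
begin

abbreviation tpsi :: "'a tensor_algebra \<Rightarrow> complex" where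
  "tpsi \<equiv> tensor_functional \<psi>"

abbreviation tcen :: "('i \<times> 'a) list \<Rightarrow> 'a tensor_algebra" where
  "tcen \<equiv> centre tpsi letter"

lemma linear_tpsi: "linear_functional tpsi"
  and tpsi_pure [simp]: "tpsi (pure_tensor as) = \<psi> (prod_list as)"
  by (rule tensor_extend[OF multilinear_prod[OF linear_psi]])+

lemma tpsi_one [simp]: "tpsi 1 = 1"
  using tpsi_pure[of "[]"] by (simp add: pure_tensor_Nil)

lemma ceval_tensor: "centred_eval tpsi letter rs F = ceval rs F"
  by (induction rs arbitrary: F) (simp_all add: prod_letters)

lemma ceval_pure_tensor:
  assumes "linear_functional f"
  shows "f (prod_list (map tcen rs)) = ceval rs (\<lambda>w. f (pure_tensor (map snd w)))"
  using centred_eval_linear[OF assms, of tpsi letter rs 1 1]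
  by (simp add: ceval_tensor prod_letters)

lemma tcen_in:
  assumes "set r \<subseteq> {j} \<times> A j"
  shows "tcen r \<in> tensor_subalgebra (A j)"
proof -
  have "snd x \<in> A j" if "x \<in> set r" for x using assms that by auto
  then have "map snd r \<in> lists (A j)" by auto
  then have "pure_tensor (map snd r) \<in> tensor_subalgebra (A j)"
    unfolding tensor_subalgebra_def by (intro complex_vector.span_base imageI)
  moreover have "pure_tensor [] \<in> tensor_subalgebra (A j)"
    unfolding tensor_subalgebra_def by (intro complex_vector.span_base imageI) simp
  ultimately show ?thesis
    unfolding centre_def prod_letters tensor_subalgebra_def pure_tensor_Nil
    by (intro complex_vector.span_diff complex_vector.span_scale)
qed

lemma tpsi_tcen [simp]: "tpsi (tcen r) = 0"
  by (simp add: centre_def linear_functional_simps[OF linear_tpsi])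

lemma runs_tcen: "runs A js rs \<Longrightarrow> list_all2 (\<lambda>j t. t \<in> tensor_subalgebra (A j)) js (map tcen rs)"
proof (induction rs arbitrary: js)
  case (Cons r rs)
  then show ?case by (elim runs_ConsE) (auto simp: tcen_in)
qed simp

text \<open>Centring is linear and fixes centred tensors. It therefore carries the spanning pure
  tensors to a family spanning all of them.\<close>

lemma tensor_centred_span:
  assumes "t \<in> tensor_subalgebra (A j)" "tpsi t = 0"
  shows "t \<in> complex_vector.span {tcen r |r. set r \<subseteq> {j} \<times> A j}"
proof -
  let ?S = "complex_vector.span {tcen r |r. set r \<subseteq> {j} \<times> A j}"
  have "t - tpsi t *\<^sub>C 1 \<in> ?S"
  proof (rule complex_vector.span_induct[OF assms(1)[unfolded tensor_subalgebra_def],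
        of "\<lambda>t. t - tpsi t *\<^sub>C 1 \<in> ?S"])
    show "complex_vector.subspace {t. t - tpsi t *\<^sub>C 1 \<in> ?S}"
    proof (rule complex_vector.subspaceI)
      show "0 \<in> {t. t - tpsi t *\<^sub>C 1 \<in> ?S}"
        by (simp add: linear_functional_0[OF linear_tpsi] complex_vector.span_zero)
    next
      fix x y assume "x \<in> {t. t - tpsi t *\<^sub>C 1 \<in> ?S}" "y \<in> {t. t - tpsi t *\<^sub>C 1 \<in> ?S}"
      then have "(x - tpsi x *\<^sub>C 1) + (y - tpsi y *\<^sub>C 1) \<in> ?S"
        by (intro complex_vector.span_add) auto
      then show "x + y \<in> {t. t - tpsi t *\<^sub>C 1 \<in> ?S}"
        by (simp add: linear_functional_add[OF linear_tpsi] scaleC_add_left algebra_simps)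
    next
      fix c x assume "x \<in> {t. t - tpsi t *\<^sub>C 1 \<in> ?S}"
      then have "c *\<^sub>C (x - tpsi x *\<^sub>C 1) \<in> ?S"
        by (intro complex_vector.span_scale) auto
      then show "c *\<^sub>C x \<in> {t. t - tpsi t *\<^sub>C 1 \<in> ?S}"
        by (simp add: linear_functional_scale[OF linear_tpsi] complex_vector.scale_right_diff_distrib
            scaleC_scaleC)
    qed
  next
    fix x assume "x \<in> pure_tensor ` lists (A j)"
    then obtain as where as: "as \<in> lists (A j)" "x = pure_tensor as" by blast
    have "x - tpsi x *\<^sub>C 1 = tcen (map (Pair j) as)"
      unfolding centre_def prod_letters as(2) by (simp add: o_def)
    moreover have "set (map (Pair j) as) \<subseteq> {j} \<times> A j" using as(1) by auto
    ultimately show "x - tpsi x *\<^sub>C 1 \<in> ?S"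
      by (intro complex_vector.span_base) blast
  qed
  then show ?thesis using assms(2) by simp
qed

text \<open>The entries are replaced by centred words one at a time, from left to right, using
  linearity in the current slot.\<close>

lemma tensor_runs_suffice:
  assumes f: "linear_functional f"
    and runs: "\<And>rs. runs A js rs \<Longrightarrow> f (prod_list (map tcen rs)) = 0"
    and ts: "list_all2 (\<lambda>j t. t \<in> tensor_subalgebra (A j)) js ts" "centered tpsi ts"
  shows "f (prod_list ts) = 0"
proof -
  have "f (prod_list (map tcen rs0) * prod_list ts2) = 0"
    if "js = js0 @ js2" "runs A js0 rs0" "list_all2 (\<lambda>j t. t \<in> tensor_subalgebra (A j)) js2 ts2"
      "centered tpsi ts2" for js0 js2 rs0 ts2
    using that
  proof (induction ts2 arbitrary: js0 js2 rs0)
    case Nil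
    then show ?case using runs[of rs0] by simp
  next
    case (Cons t ts2)
    then obtain j js3 where js2: "js2 = j # js3" by (cases js2) auto
    let ?P = "\<lambda>x. f (prod_list (map tcen rs0) * x * prod_list ts2)"
    have lin: "linear_functional ?P" by (rule linear_functional_mult[OF f])
    have "t \<in> complex_vector.span {tcen r |r. set r \<subseteq> {j} \<times> A j}"
      using Cons.prems js2 by (intro tensor_centred_span) (auto simp: centered_def)
    then have "?P t = 0"
    proof (rule complex_vector.span_induct)
      show "complex_vector.subspace {x. ?P x = 0}"
        by (rule complex_vector.subspaceI)
          (simp_all add: linear_functional_0[OF f] linear_functional_simps[OF lin])
    next
      fix x assume "x \<in> {tcen r |r. set r \<subseteq> {j} \<times> A j}"
      then obtain r where r: "x = tcen r" "set r \<subseteq> {j} \<times> A j" by blast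
      have "f (prod_list (map tcen (rs0 @ [r])) * prod_list ts2) = 0"
      proof (rule Cons.IH)
        show "js = (js0 @ [j]) @ js3" using Cons.prems js2 by simp
        show "runs A (js0 @ [j]) (rs0 @ [r])" using Cons.prems(2) r(2) by (intro runs_append) auto
      qed (use Cons.prems js2 in \<open>auto simp: centered_def\<close>)
      then show "?P x = 0" using r(1) by (simp add: mult.assoc)
    qed
    then show ?case by (simp add: mult.assoc)
  qed
  from this[of "[]" js "[]" ts] ts show ?thesis by simp
qed

lemma conditionally_free_iff:
  assumes "unital_functional \<phi>"
  shows "conditionally_free I A \<psi> \<phi> \<longleftrightarrow> multiplicative \<psi> \<and> multiplicative \<phi>"
proof -
  have "prod_list (map \<psi> as) = 0" if "alternating I A js as" "centered \<psi> as" for js as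
    using that by (cases as) (auto simp: alternating_def centered_def)
  then show ?thesis
    unfolding conditionally_free_def multiplicative_def
    using assms unital by (auto simp: unital_functional_def)
qed

definition cyclically_alternating_runs :: "'i list \<Rightarrow> ('i \<times> 'a) list list \<Rightarrow> bool" where
  "cyclically_alternating_runs js rs \<longleftrightarrow>
    runs A js rs \<and> distinct_adj js \<and> set js \<subseteq> I \<and> 2 \<le> length js \<and> last js \<noteq> hd js"

text \<open>Freeness of the tensor subalgebras comes for free from that of the \<open>A i\<close>,
  since \<open>tpsi\<close> factors through multiplication. Only the condition on
  \<open>\<Omega>\<close> remains, and centred words suffice to test it.\<close>

lemma cyclically_free_tensor_iff:
  assumes free: "multiplicative \<psi>" and \<Omega>: "linear_functional \<Omega>"
  shows "cyclically_free I (\<lambda>i. tensor_subalgebra (A i)) tpsi \<Omega> \<longleftrightarrow>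
    (\<forall>js rs. cyclically_alternating_runs js rs \<longrightarrow> ceval rs (\<lambda>w. \<Omega> (pure_tensor (map snd w))) = 0)"
    (is "_ \<longleftrightarrow> ?R")
proof
  assume L: "cyclically_free I (\<lambda>i. tensor_subalgebra (A i)) tpsi \<Omega>"
  show ?R
  proof (intro allI impI)
    fix js rs assume R: "cyclically_alternating_runs js rs"
    have "length js = length rs" using R runs_length[of A js rs] by (simp add: cyclically_alternating_runs_def)
    moreover have "centered tpsi (map tcen rs)" by (auto simp: centered_def)
    ultimately have "\<Omega> (prod_list (map tcen rs)) = 0"
      using L R runs_tcen[of js rs]
      unfolding cyclically_free_def cyclically_alternating_def alternating_def cyclically_alternating_runs_def
      by (metis length_map list.size(3) not_numeral_le_zero)
    then show "ceval rs (\<lambda>w. \<Omega> (pure_tensor (map snd w))) = 0"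
      using ceval_pure_tensor[OF \<Omega>] by simp
  qed
next
  assume R: ?R
  have "tpsi (prod_list ts) = 0"
    if alt: "alternating I (\<lambda>i. tensor_subalgebra (A i)) js ts" "centered tpsi ts" for js ts
  proof (rule tensor_runs_suffice[OF linear_tpsi _ _ alt(2)])
    show "list_all2 (\<lambda>j t. t \<in> tensor_subalgebra (A j)) js ts"
      using alt(1) by (simp add: alternating_def)
    fix rs assume rs: "runs A js rs"
    have js: "distinct_adj js" "set js \<subseteq> I" "js \<noteq> []"
      using alt(1) by (auto simp: alternating_def)
    have "tpsi (prod_list (map tcen rs)) = ceval rs (\<lambda>w. \<psi> (1 * val w * 1))"
      using ceval_pure_tensor[OF linear_tpsi] by simp
    also have "\<dots> = \<psi> (prod_list (map cen rs))"
      by (simp only: centred_eval_linear[OF linear_psi]) simp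
    also have "\<dots> = prod_list (map \<psi> (map cen rs))"
      by (rule multiplicative_prod[OF free js(1,2) runs_elems[OF rs js(2)] centered_cen])
    also have "\<dots> = 0"
      using rs js(3) by (cases rs) auto
    finally show "tpsi (prod_list (map tcen rs)) = 0" .
  qed
  moreover have "\<Omega> (prod_list ts) = 0"
    if alt: "cyclically_alternating I (\<lambda>i. tensor_subalgebra (A i)) js ts" "centered tpsi ts" for js ts
  proof (rule tensor_runs_suffice[OF \<Omega> _ _ alt(2)])
    show len: "list_all2 (\<lambda>j t. t \<in> tensor_subalgebra (A j)) js ts"
      using alt(1) by (simp add: cyclically_alternating_def alternating_def)
    fix rs assume "runs A js rs"
    then have "cyclically_alternating_runs js rs"
      using alt(1) list_all2_lengthD[OF len]
      by (simp add: cyclically_alternating_runs_def cyclically_alternating_def alternating_def)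
    then show "\<Omega> (prod_list (map tcen rs)) = 0"
      using R ceval_pure_tensor[OF \<Omega>] by simp
  qed
  ultimately show "cyclically_free I (\<lambda>i. tensor_subalgebra (A i)) tpsi \<Omega>"
    unfolding cyclically_free_def free_wrt_def by blast
qed

end

theorem theorem1p15:
  fixes \<psi> \<phi> \<omega> :: "'a::complex_algebra_1 \<Rightarrow> complex"
    and I :: "'i set"
    and A :: "'i \<Rightarrow> 'a set"
  assumes "unital_functional \<psi>"
    and "unital_functional \<phi>"
    and "tracial_functional \<omega>"
    and "\<And>i. i \<in> I \<Longrightarrow> unital_subalgebra (A i)"
  defines "C1 \<equiv> cyclically_conditionally_free I A \<psi> \<phi> \<omega>"
    and "C2 \<equiv> conditionally_free I A \<psi> \<phi> \<and>
      cyclically_free I (\<lambda>i. tensor_subalgebra (A i))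
        (tensor_functional \<psi>)
        (\<lambda>t. tensor_functional \<omega> t - tensor_extend (cyclic_boolean \<phi>) t
              + (1 - \<omega> 1) * tensor_extend (cyclic_boolean \<psi>) t)"
    and "C3 \<equiv> mixed_vanish I A (cyclic_cfree_cumulant \<omega> \<phi> \<psi>) \<and>
      mixed_vanish I A (free_cumulant \<psi>) \<and>
      mixed_vanish I A (cfree_cumulant \<phi> \<psi>)"
  shows "(C1 \<longleftrightarrow> C2) \<and> (C2 \<longleftrightarrow> C3)"
proof -
  interpret S: subalgebra_family I A \<psi> by unfold_locales (use assms in auto)
  have lin: "linear_functional \<psi>" "linear_functional \<phi>" "linear_functional \<omega>"
    and one: "\<psi> 1 = 1" "\<phi> 1 = 1" and trace: "\<And>x y. \<omega> (x * y) = \<omega> (y * x)"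
    using assms(1-3) by (auto simp: unital_functional_def tracial_functional_def)
  define \<Omega> where "\<Omega> t = tensor_functional \<omega> t - tensor_extend (cyclic_boolean \<phi>) t
      + (1 - \<omega> 1) * tensor_extend (cyclic_boolean \<psi>) t" for t
  define D :: "('i \<times> 'a) list \<Rightarrow> complex" where "D c = cyclic_cfree_cumulant \<omega> \<phi> \<psi> (map snd c)" for c
  let ?\<Omega> = "\<lambda>w. \<Omega> (pure_tensor (map snd w))"
  note multi = multilinear_prod[OF lin(3)] multilinear_cyclic_boolean[OF lin(2) one(2)]
    multilinear_cyclic_boolean[OF lin(1) one(1)]
  have lin_\<Omega>: "linear_functional \<Omega>"
    unfolding \<Omega>_def[abs_def]
    by (intro linear_functional_plus linear_functional_minus linear_functional_cmult
        tensor_extend(1) multi)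
  have \<Omega>_pure: "\<Omega> (pure_tensor as) =
      \<omega> (prod_list as) - cyclic_boolean \<phi> as + (1 - \<omega> 1) * cyclic_boolean \<psi> as" for as
    by (simp add: \<Omega>_def tensor_extend(2)[OF multi(1)] tensor_extend(2)[OF multi(2)]
        tensor_extend(2)[OF multi(3)])
  have \<Omega>_scan: "\<Omega> (pure_tensor (map snd w)) = cyclic_scan_from \<psi> snd D 1 w" for w :: "('i \<times> 'a) list"
  proof (cases "w = []")
    \<comment> \<open>On the empty word the value is \<omega>(1) - 1 + (1 - \<omega>(1)) = 0,
      matching the empty sum over blocks.\<close>
    case True
    then show ?thesis by (simp add: \<Omega>_pure cyclic_boolean_def)
  next
    case False
    then show ?thesis
      using cyclic_scan[of \<psi> w \<omega> snd \<phi>, OF one(1)]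
      by (simp add: \<Omega>_pure cyclic_scan_from_sum D_def diff_add_eq)
  qed
  \<comment> \<open>The trace property of \<omega> enters here; the two cyclic Boolean functionals
    are rotation invariant by themselves.\<close>
  have \<Omega>_rotate: "\<Omega> (pure_tensor (as @ [a])) = \<Omega> (pure_tensor (a # as))" for as a
    using cyclic_boolean_rotate1[of \<phi> "a # as"] cyclic_boolean_rotate1[of \<psi> "a # as"]
      trace[of "prod_list as" a] by (simp add: \<Omega>_pure)
  have D_rotate: "D (w @ [a]) = D (a # w)" for w a
    by (rule cyclic_scan_invariant[of \<psi> snd, OF one(1)], unfold \<Omega>_scan[symmetric])
      (simp add: \<Omega>_rotate)
  \<comment> \<open>The second condition, tested only on centred words; both other conditions are
    compared with this form.\<close>
  define C2' where "C2' \<longleftrightarrow> S.multiplicative \<psi> \<and> S.multiplicative \<phi> \<and>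
    (\<forall>js rs. S.cyclically_alternating_runs js rs \<longrightarrow>
      S.ceval rs ?\<Omega> = 0)"
  have C2: "C2 \<longleftrightarrow> C2'"
    unfolding C2_def C2'_def \<Omega>_def[symmetric]
    using S.conditionally_free_iff[OF assms(2)] S.cyclically_free_tensor_iff[OF _ lin_\<Omega>] by blast
  have C1: "C1 \<longleftrightarrow> C2'"
  proof (cases "S.multiplicative \<psi> \<and> S.multiplicative \<phi>")
    case False
    then show ?thesis
      using S.conditionally_free_iff[OF assms(2)]
      by (auto simp: C1_def C2'_def cyclically_conditionally_free_def)
  next
    case True
    interpret F: cfree_family I A \<psi> \<phi> by unfold_locales (use True in auto)
    \<comment> \<open>Taking \<phi> = \<psi> evaluates [\<psi>] on centred words as well.\<close>
    interpret P: cfree_family I A \<psi> \<psi> by unfold_locales (use True in auto)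
    have eval: "S.ceval rs ?\<Omega> =
        \<omega> (prod_list (map S.cen rs)) - prod_list (map \<phi> (map S.cen rs))"
      if R: "S.cyclically_alternating_runs js rs" for js rs
    proof -
      note R' = R[unfolded S.cyclically_alternating_runs_def]
      have "S.ceval rs ?\<Omega> =
          S.ceval rs (\<lambda>w. \<omega> (1 * S.val w * 1)) - S.ceval rs (\<lambda>w. cyclic_boolean \<phi> (map snd w)) +
          (1 - \<omega> 1) * S.ceval rs (\<lambda>w. cyclic_boolean \<psi> (map snd w))"
        by (simp add: \<Omega>_pure centred_eval_add centred_eval_diff centred_eval_cmult)
      also have "S.ceval rs (\<lambda>w. cyclic_boolean \<phi> (map snd w)) = prod_list (map \<phi> (map S.cen rs))"
        using R' by (intro F.ceval_cyclic_boolean[of js]) auto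
      also have "S.ceval rs (\<lambda>w. cyclic_boolean \<psi> (map snd w)) = prod_list (map \<psi> (map S.cen rs))"
        using R' by (intro P.ceval_cyclic_boolean[of js]) auto
      \<comment> \<open>The correction term with coefficient 1 - \<omega>(1) therefore disappears on
        cyclically alternating centred words.\<close>
      also have "prod_list (map \<psi> (map S.cen rs)) = 0"
        using R' by (cases rs) auto
      also have "S.ceval rs (\<lambda>w. \<omega> (1 * S.val w * 1)) = \<omega> (1 * prod_list (map S.cen rs) * 1)"
        by (rule centred_eval_linear[OF lin(3)])
      finally show ?thesis by simp
    qed
    show ?thesis
    proof
      assume C1
      then have \<omega>: "\<omega> (prod_list as) = prod_list (map \<phi> as)"
        if "cyclically_alternating I A js as" "centered \<psi> as" for js as
        using that by (auto simp: C1_def cyclically_conditionally_free_def)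
      have "S.ceval rs ?\<Omega> = 0"
        if R: "S.cyclically_alternating_runs js rs" for js rs
      proof -
        note R' = R[unfolded S.cyclically_alternating_runs_def]
        have "length js = length rs" using R' runs_length by blast
        then have "cyclically_alternating I A js (map S.cen rs)"
          using R' S.runs_elems[of js rs] by (auto simp: cyclically_alternating_def alternating_def)
        then show ?thesis using eval[OF R] \<omega> S.centered_cen by simp
      qed
      then show C2' using True by (simp add: C2'_def)
    next
      assume C2'
      have "\<omega> (prod_list as) = prod_list (map \<phi> as)"
        if alt: "cyclically_alternating I A js as" "centered \<psi> as" for js as
      proof -
        \<comment> \<open>One-letter runs: their entries are already centred, so centring returns
          the original elements and \<open>eval\<close> applies to them.\<close>
        define rs where "rs = map (\<lambda>x. [x]) (zip js as)"
        have el: "list_all2 (\<lambda>j a. a \<in> A j) js as"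
          using alt(1) by (simp add: cyclically_alternating_def alternating_def)
        then have len: "length js = length as" by (rule list_all2_lengthD)
        have "runs A js rs"
          using el len by (auto simp: runs_def rs_def list_all2_conv_all_nth)
        then have R: "S.cyclically_alternating_runs js rs"
          using alt(1) len
          by (simp add: S.cyclically_alternating_runs_def cyclically_alternating_def alternating_def)
        have "map S.cen rs = map (\<lambda>a. a) as"
        proof (rule nth_equalityI)
          fix i assume "i < length (map S.cen rs)"
          then have i: "i < length as" "i < length js" using len by (simp_all add: rs_def)
          then have "\<psi> (as ! i) = 0" using alt(2) by (simp add: centered_def)
          then show "map S.cen rs ! i = map (\<lambda>a. a) as ! i"
            using i by (simp add: rs_def centre_def)
        qed (use len in \<open>simp add: rs_def\<close>)
        then show ?thesis
          using eval[OF R] \<open>C2'\<close> R by (simp add: C2'_def)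
      qed
      then show C1
        using True S.conditionally_free_iff[OF assms(2)]
        by (auto simp: C1_def cyclically_conditionally_free_def)
    qed
  qed
  have C3: "C2' \<longleftrightarrow> C3"
  proof
    assume C2'
    interpret F: cfree_family I A \<psi> \<phi> by unfold_locales (use \<open>C2'\<close> in \<open>auto simp: C2'_def\<close>)
    interpret P: cfree_family I A \<psi> \<psi> by unfold_locales (use \<open>C2'\<close> in \<open>auto simp: C2'_def\<close>)
    have "D c = 0" if c: "set c \<subseteq> Sigma I A" "mixed c" for c
    proof (rule F.cyclic_mixed_zero[OF D_rotate _ c])
      fix js rs assume "runs A js rs" "distinct_adj js" "set js \<subseteq> I" "2 \<le> length js" "last js \<noteq> hd js"
      then have "S.cyclically_alternating_runs js rs" by (simp add: S.cyclically_alternating_runs_def)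
      then have "S.ceval rs ?\<Omega> = 0" using \<open>C2'\<close> by (simp add: C2'_def)
      then show "S.ceval rs (cyclic_scan_from \<psi> snd D 1) = 0" by (simp add: \<Omega>_scan)
    qed
    moreover have "free_cumulant \<psi> (map snd c) = 0" if c: "set c \<subseteq> Sigma I A" "mixed c" for c
      using P.cfree_mixed_zero[OF c] c(2) by (simp add: cfree_cumulant_mixed)
    ultimately show C3
      unfolding C3_def mixed_vanish_iff using F.cfree_mixed_zero by (auto simp: D_def)
  next
    assume C3
    then have \<kappa>: "\<And>c. set c \<subseteq> Sigma I A \<Longrightarrow> mixed c \<Longrightarrow> D c = 0"
      "\<And>c. set c \<subseteq> Sigma I A \<Longrightarrow> mixed c \<Longrightarrow> free_cumulant \<psi> (map snd c) = 0"
      "\<And>c. set c \<subseteq> Sigma I A \<Longrightarrow> mixed c \<Longrightarrow> cfree_cumulant \<phi> \<psi> (map snd c) = 0"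
      by (auto simp: C3_def mixed_vanish_iff D_def)
    have "cfree_cumulant \<psi> \<psi> (map snd c) = 0" if c: "set c \<subseteq> Sigma I A" "mixed c" for c
      using \<kappa>(2)[OF c] c(2) by (simp add: cfree_cumulant_mixed)
    from S.cfree_mixed_multiplicative[OF lin(1) one(1) this \<kappa>(2)]
    have free: "S.multiplicative \<psi>" .
    have cfree: "S.multiplicative \<phi>"
      by (rule S.cfree_mixed_multiplicative[OF lin(2) one(2) \<kappa>(3,2)])
    interpret F: free_family I A \<psi> by unfold_locales (rule free)
    have "S.ceval rs ?\<Omega> = 0"
      if R: "S.cyclically_alternating_runs js rs" for js rs
    proof -
      note R' = R[unfolded S.cyclically_alternating_runs_def]
      have "S.ceval rs ?\<Omega> = S.ceval rs (cyclic_scan_from \<psi> snd D 1)"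
        by (simp add: \<Omega>_scan)
      also have "\<dots> = 0"
        using F.ceval_cyclic_scan_zero[where D = D and js = js and rs = rs and ks = "[]" and ts = "[]"] \<kappa>(1) R'
        by (simp add: centered_def)
      finally show ?thesis .
    qed
    then show C2' using free cfree by (simp add: C2'_def)
  qed
  show ?thesis using C1 C2 C3 by blast
qed

end
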